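(* Let $r\ge 2$ and let $f\in\mathcal{C}^r(\mathbb{T},\mathbb{T})$ be a $\mathcal{C}^r$-smooth orientation-preserving expanding circle map that is not smoothly conjugate to the linear map. Let $\mu$ be the unique $f$-invariant probability measure of maximal entropy on $\mathbb{T}$, and let $\overline{\chi}:=\int_{\mathbb{T}}\ln f'\,\mathrm{d}\mu$ be the Lyapunov exponent of $f$ with respect to $\mu$. Then there exist constants $\sigma>0$ and $C>0$ such that for all $n\in\mathbb{N}=\{1,2,\dots\}$ and all $a,b\in\mathbb{R}\cup\{+\infty\}$ with $a<b$, $$\left|\,\mathbb{P}\left(\frac{(\chi_n-\overline{\chi})\sqrt{n}}{\sigma}\in[a,b]\right)-\frac{1}{\sqrt{2\pi}}\int_a^b \exp\left(-\frac{x^2}{2}\right)\mathrm{d}x\,\right|\le\frac{C}{\sqrt[4]{n}}.$$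
   Context: $\mathbb{T}=\mathbb{R}/\mathbb{Z}$. The map $f$ is orientation-preserving and expanding: $f'(x)>1$ for all $x\in\mathbb{T}$ (equivalently $\min_{\mathbb{T}}f'>1$). Let $K\ge 2$ be the degree of $f$. The linear map is $x\mapsto Kx \bmod 1$; $f$ is smoothly conjugate to it if there is a $\mathcal{C}^1$ diffeomorphism $\phi:\mathbb{T}\to\mathbb{T}$ with $\phi(f(x))=K\phi(x) \bmod 1$ for all $x$. $\mathrm{Fix}(f^n)=\{p\in\mathbb{T}: f^n(p)=p\}$ is the set of periodic points of period $n$ ($n$ not necessarily the smallest period); it has exactly $K^n-1$ elements. For $p\in\mathrm{Fix}(f^n)$ the periodic Lyapunov exponent is $$\chi_n(p):=\frac1n\ln (f^n)'(p)=\frac1n\sum_{k=0}^{n-1}\ln f'(f^k(p)).$$ For fixed $n$, $\chi_n$ is regarded as a random variable on $\mathrm{Fix}(f^n)$ with the uniform (normalized counting) probability $\mathbb{P}$; thus $\mathbb{P}(\chi_n\in[x,y])=\#\{p\in\mathrm{Fix}(f^n):\chi_n(p)\in[x,y]\}/\#\mathrm{Fix}(f^n)$. When $b=+\infty$, the event "$\in[a,b]$" means "$\ge a$". *)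

theory Defs
  imports "HOL-Probability.Probability"
begin

section \<open>The circle as a quotient of the reals\<close>

quotient_type circle = real / "\<lambda>x y :: real. x - y \<in> \<int>"
proof (rule equivpI)
  show "reflp (\<lambda>x y :: real. x - y \<in> \<int>)"
    by (rule reflpI) simp
  show "symp (\<lambda>x y :: real. x - y \<in> \<int>)"
    by (rule sympI) (use Ints_minus in fastforce)
  show "transp (\<lambda>x y :: real. x - y \<in> \<int>)"
    by (rule transpI) (use Ints_add in fastforce)
qed

lemma abs_circle_eq_iff: "abs_circle x = abs_circle y \<longleftrightarrow> x - y \<in> \<int>"
  by (simp add: circle.abs_eq_iff)

instantiation circle :: topological_space
begin

definition open_circle :: "circle set \<Rightarrow> bool"
  where "open_circle U \<longleftrightarrow> open (abs_circle -` U)"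

instance
  by standard (auto simp: open_circle_def vimage_Union)

end

lift_definition linear_map :: "int \<Rightarrow> circle \<Rightarrow> circle" is "\<lambda>K x. of_int K * x"
  by (simp flip: right_diff_distrib)


section \<open>Smooth maps of the circle, through their lifts\<close>

definition is_lift :: "(real \<Rightarrow> real) \<Rightarrow> (circle \<Rightarrow> circle) \<Rightarrow> bool"
  where "is_lift F f \<longleftrightarrow> continuous_on UNIV F \<and> (\<forall>x. f (abs_circle x) = abs_circle (F x))"

definition C_real :: "nat \<Rightarrow> (real \<Rightarrow> real) \<Rightarrow> bool"
  where "C_real r F \<longleftrightarrow>
    (\<forall>i<r. \<forall>x. (deriv ^^ i) F differentiable (at x)) \<and> continuous_on UNIV ((deriv ^^ r) F)"

definition C_circle :: "nat \<Rightarrow> (circle \<Rightarrow> circle) \<Rightarrow> bool"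
  where "C_circle r f \<longleftrightarrow> (\<exists>F. is_lift F f \<and> C_real r F)"

definition circle_deriv :: "(circle \<Rightarrow> circle) \<Rightarrow> circle \<Rightarrow> real"
  where "circle_deriv f p =
    (THE D. \<exists>F x. is_lift F f \<and> abs_circle x = p \<and> (F has_real_derivative D) (at x))"

definition circle_degree :: "(circle \<Rightarrow> circle) \<Rightarrow> int"
  where "circle_degree f = (THE K. \<exists>F. is_lift F f \<and> (\<forall>x. F (x + 1) = F x + of_int K))"

text \<open>The next lemmas show that neither the derivative nor the degree depends on the lift or on
  the representative.\<close>

lemma is_lift_diff:
  assumes "is_lift F f" "is_lift G f"
  obtains m :: int where "\<And>x. G x = F x + of_int m"
proof -
  have Z: "G x - F x \<in> \<int>" for x
    using assms by (simp add: is_lift_def flip: abs_circle_eq_iff)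
  have "(\<lambda>x. G x - F x) constant_on UNIV"
  proof (rule continuous_discrete_range_constant)
    show "connected (UNIV :: real set)"
      by simp
    show "continuous_on UNIV (\<lambda>x. G x - F x)"
      using assms unfolding is_lift_def by (intro continuous_intros) auto
    show "\<exists>e>0. \<forall>y. y \<in> UNIV \<and> G y - F y \<noteq> G x - F x \<longrightarrow> e \<le> norm ((G y - F y) - (G x - F x))"
      for x
    proof (intro exI[of _ 1] conjI allI impI)
      fix y assume "y \<in> UNIV \<and> G y - F y \<noteq> G x - F x"
      then show "1 \<le> norm ((G y - F y) - (G x - F x))"
        using Ints_nonzero_abs_ge1[OF Ints_diff[OF Z Z], of y x] by auto
    qed simp
  qed
  then obtain c where c: "\<And>x. G x - F x = c"
    unfolding constant_on_def by auto
  with Z[of 0] obtain m :: int where "c = of_int m"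
    by (metis Ints_cases)
  with c show thesis
    by (intro that[of m]) (simp add: algebra_simps)
qed

lemma is_lift_shift:
  assumes "is_lift F f"
  shows "is_lift (\<lambda>x. F (x + of_int k)) f"
proof -
  have "continuous_on UNIV (\<lambda>x. F (x + of_int k))"
  proof (rule continuous_on_compose2[where f = "\<lambda>x :: real. x + of_int k" and g = F and t = UNIV])
    show "continuous_on UNIV F"
      using assms by (simp add: is_lift_def)
    show "continuous_on UNIV (\<lambda>x :: real. x + of_int k)"
      by (intro continuous_intros)
  qed simp
  moreover have "abs_circle (x + of_int k) = abs_circle x" for x
    by (simp add: abs_circle_eq_iff)
  moreover have "f (abs_circle (x + of_int k)) = abs_circle (F (x + of_int k))" for x
    using assms by (simp add: is_lift_def)
  ultimately show ?thesis
    by (simp add: is_lift_def)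
qed

lemma circle_deriv_eq:
  assumes F: "is_lift F f" and D: "(F has_real_derivative D) (at x)"
  shows "circle_deriv f (abs_circle x) = D"
  unfolding circle_deriv_def
proof (rule the_equality)
  show "\<exists>F y. is_lift F f \<and> abs_circle y = abs_circle x \<and> (F has_real_derivative D) (at y)"
    using assms by blast
next
  fix E assume "\<exists>G y. is_lift G f \<and> abs_circle y = abs_circle x \<and> (G has_real_derivative E) (at y)"
  then obtain G y where G: "is_lift G f" and y: "abs_circle y = abs_circle x"
    and E: "(G has_real_derivative E) (at y)"
    by blast
  from y have "y - x \<in> \<int>"
    by (simp only: abs_circle_eq_iff)
  then obtain k :: int where "y - x = of_int k"
    by (rule Ints_cases)
  then have k: "y = x + of_int k"
    by simp
  obtain m :: int where m: "\<And>x. G (x + of_int k) = F x + of_int m"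
    using is_lift_diff[OF F is_lift_shift[OF G]] by blast
  have "((\<lambda>x. G (x + of_int k)) has_real_derivative E) (at x)"
    using E unfolding k by (subst (asm) DERIV_shift)
  then have "((\<lambda>x. F x + of_int m) has_real_derivative E) (at x)"
    by (simp add: m)
  moreover have "((\<lambda>x. F x + of_int m) has_real_derivative D) (at x)"
    using D by (auto intro!: derivative_eq_intros)
  ultimately show "E = D"
    by (rule DERIV_unique)
qed

lemma lift_degree:
  assumes F: "is_lift F f"
  shows "F (x + 1) = F x + of_int (circle_degree f)"
proof -
  obtain K :: int where K: "\<And>x. F (x + 1) = F x + of_int K"
    using is_lift_diff[OF F is_lift_shift[OF F, of 1]] unfolding of_int_1 by blast
  have "circle_degree f = K"
    unfolding circle_degree_def
  proof (rule the_equality)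
    show "\<exists>F. is_lift F f \<and> (\<forall>x. F (x + 1) = F x + of_int K)"
      using F K by blast
  next
    fix L :: int assume "\<exists>G. is_lift G f \<and> (\<forall>x. G (x + 1) = G x + of_int L)"
    then obtain G where G: "is_lift G f" and L: "\<And>x. G (x + 1) = G x + of_int L"
      by blast
    obtain m :: int where m: "\<And>x. G x = F x + of_int m"
      using is_lift_diff[OF F G] by blast
    show "L = K"
      using L[of 0] K[of 0] by (simp add: m)
  qed
  with K show ?thesis
    by simp
qed

definition expanding :: "(circle \<Rightarrow> circle) \<Rightarrow> bool"
  where "expanding f \<longleftrightarrow> (\<forall>p. circle_deriv f p > 1)"

definition C1_diffeo :: "(circle \<Rightarrow> circle) \<Rightarrow> bool"
  where "C1_diffeo \<phi> \<longleftrightarrow> bij \<phi> \<and> C_circle 1 \<phi> \<and> C_circle 1 (inv \<phi>)"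

definition smoothly_conjugate :: "(circle \<Rightarrow> circle) \<Rightarrow> (circle \<Rightarrow> circle) \<Rightarrow> bool"
  where "smoothly_conjugate f g \<longleftrightarrow> (\<exists>\<phi>. C1_diffeo \<phi> \<and> (\<forall>p. \<phi> (f p) = g (\<phi> p)))"


section \<open>Measure-theoretic entropy\<close>

definition invariant_prob :: "(circle \<Rightarrow> circle) \<Rightarrow> circle measure \<Rightarrow> bool"
  where "invariant_prob f \<mu> \<longleftrightarrow>
    prob_space \<mu> \<and> sets \<mu> = sets borel \<and> f \<in> \<mu> \<rightarrow>\<^sub>M \<mu> \<and> distr \<mu> \<mu> f = \<mu>"

definition partition_entropy :: "'a measure \<Rightarrow> 'a set set \<Rightarrow> real"
  where "partition_entropy \<mu> P = - (\<Sum>A\<in>P. measure \<mu> A * ln (measure \<mu> A))"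

text \<open>The common refinement of the preimages of \<open>P\<close> under the first \<open>n\<close> iterates of \<open>f\<close>, starting
  with the identity. It may also contain the empty set, which has no effect on the entropy because
  \<open>0 * ln 0 = 0\<close>.\<close>

primrec iterated_join :: "('a \<Rightarrow> 'a) \<Rightarrow> 'a set set \<Rightarrow> nat \<Rightarrow> 'a set set"
  where
    "iterated_join f P 0 = {UNIV}"
  | "iterated_join f P (Suc n) = {A \<inter> f -` B | A B. A \<in> P \<and> B \<in> iterated_join f P n}"

definition entropy_wrt :: "'a measure \<Rightarrow> ('a \<Rightarrow> 'a) \<Rightarrow> 'a set set \<Rightarrow> real"
  where "entropy_wrt \<mu> f P = lim (\<lambda>n. partition_entropy \<mu> (iterated_join f P n) / real n)"

definition metric_entropy :: "'a measure \<Rightarrow> ('a \<Rightarrow> 'a) \<Rightarrow> ereal"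
  where "metric_entropy \<mu> f =
    (SUP P\<in>{P. finite P \<and> partition_on UNIV P \<and> P \<subseteq> sets \<mu>}. ereal (entropy_wrt \<mu> f P))"

definition max_entropy_measure :: "(circle \<Rightarrow> circle) \<Rightarrow> circle measure \<Rightarrow> bool"
  where "max_entropy_measure f \<mu> \<longleftrightarrow>
    invariant_prob f \<mu> \<and> (\<forall>\<nu>. invariant_prob f \<nu> \<longrightarrow> metric_entropy \<nu> f \<le> metric_entropy \<mu> f)"


section \<open>Lyapunov exponents\<close>

definition lyapunov_exponent :: "(circle \<Rightarrow> circle) \<Rightarrow> circle measure \<Rightarrow> real"
  where "lyapunov_exponent f \<mu> = (\<integral>p. ln (circle_deriv f p) \<partial>\<mu>)"

definition Fix :: "('a \<Rightarrow> 'a) \<Rightarrow> 'a set"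
  where "Fix g = {p. g p = p}"

definition periodic_exponent :: "(circle \<Rightarrow> circle) \<Rightarrow> nat \<Rightarrow> circle \<Rightarrow> real"
  where "periodic_exponent f n p = ln (circle_deriv (f ^^ n) p) / real n"

end

theory Submission
  imports Defs "HOL-Real_Asymp.Real_Asymp"
begin

text \<open>
  Why the theorem is true. Let \<open>F\<close> be a lift of \<open>f\<close> and \<open>K\<close> its degree. A homeomorphism \<open>H\<close> of
  the line with \<open>H (F x) = K * H x\<close> turns \<open>f\<close> into multiplication by \<open>K\<close>, its points of period \<open>n\<close>
  into the fractions \<open>j / (K ^ n - 1)\<close>, and \<open>ln f'\<close> into a function \<open>\<phi>\<close> which is Hoelder continuous,
  because \<open>ln F'\<close> is Lipschitz and the inverse of \<open>H\<close> is Hoelder continuous (expansion of \<open>F\<close>).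

  The centring. The image of Lebesgue measure under the inverse of \<open>H\<close> is invariant and gives
  the same mass to all \<open>K ^ n\<close> cylinders of length \<open>n\<close>, so its entropy is at least \<open>ln K\<close>, and so is that
  of \<open>\<mu>\<close>. On the other hand the cylinders generate, so for every \<open>k\<close> the entropy of \<open>\<mu>\<close> is at most
  \<open>1 / k\<close> times the entropy of the partition into cylinders of length \<open>k\<close>
  (\<open>entropy_rate_le\<close>, a form of the Kolmogorov-Sinai theorem). Since only the uniform distribution
  on \<open>K ^ k\<close> values has entropy \<open>k * ln K\<close>, the measure \<open>\<mu>\<close> gives mass \<open>1 / K ^ k\<close> to each cylinder
  (\<open>max_entropy_uniform\<close>), and the mean exponent is the limit of the averages of \<open>\<phi>\<close> over
  the points \<open>j / K ^ n\<close> (\<open>lyapunov_eq_mean\<close>).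

  The characteristic function. Averaging over the preimages under multiplication by \<open>K\<close> contracts
  Hoelder functions exponentially fast to their mean, so the Poisson equation can be solved:
  \<open>\<phi>\<close> minus its mean equals \<open>m\<close> up to a coboundary, where \<open>m\<close> averages to zero over the preimages
  of every point. Coboundaries sum to zero over periodic orbits. A second Poisson equation, for the square
  of \<open>m\<close>, yields a function \<open>u\<close> such that \<open>1 + t\<^sup>2 * u\<close> is an eigenfunction of the averaging operator
  with weight \<open>exp (\<i> * t * m)\<close>, for the eigenvalue \<open>1 - t\<^sup>2 * \<sigma>\<^sup>2 / 2\<close>, where
  \<open>\<sigma>\<^sup>2\<close> is the mean of the square of \<open>m\<close>, up to an error of order \<open>\<bar>t\<bar> ^ 3\<close>
  (\<open>twisted_eigen\<close>). Iterating, the errors are damped by powers of the eigenvalue and add up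
  to the order \<open>\<bar>t\<bar> ^ 3 / (t\<^sup>2 * \<sigma>\<^sup>2)\<close>, hence to a multiple of \<open>\<bar>t\<bar>\<close>, whatever the number of iterations
  (\<open>twist_approx\<close>). So no spectral theory is involved, and the characteristic function of the
  normalized exponents differs from that of the normal law by at most a constant times
  \<open>\<bar>t\<bar> / sqrt n\<close>, for all \<open>t\<close> (\<open>periodic_char\<close>).

  The rate. Adding an independent Gaussian variable of standard deviation \<open>e\<close> makes this error
  integrable against \<open>1 / \<bar>t\<bar>\<close>, with integral of order \<open>1 / (e * sqrt n)\<close>, and moves distribution functions
  by the order \<open>e\<close>. Taking for \<open>e\<close> the order \<open>n\<close> to the power \<open>-1/4\<close> balances the two
  (\<open>kolmogorov_distance_of_char\<close>).

  Non-degeneracy. If \<open>\<sigma> = 0\<close> then \<open>m = 0\<close>, so \<open>ln F'\<close> is a constant plus a coboundary \<open>g (F x) - g x\<close>. Then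
  the primitive of \<open>exp (- g x)\<close> is multiplied by a constant and shifted under \<open>F\<close>, and a normalization of it is
  a smooth conjugacy to the linear map (\<open>coboundary_imp_conjugate\<close>), which is excluded.
\<close>

section \<open>Periodic functions and lifts of circle homeomorphisms\<close>

lemma lift_plus_int:
  fixes u :: "real \<Rightarrow> real"
  assumes u: "\<And>x. u (x + 1) = u x + 1"
  shows "u (x + of_int k) = u x + of_int k"
proof -
  have n: "u (x + real n) = u x + real n" for n x
  proof (induction n)
    case (Suc n)
    then show ?case using u[of "x + real n"] by (simp add: ac_simps)
  qed simp
  show ?thesis
  proof (cases "k \<ge> 0")
    case True
    then show ?thesis using n[of x "nat k"] by simp
  next
    case False
    then show ?thesis using n[of "x + of_int k" "nat (-k)"] by simp
  qed
qed

lemma periodic_plus_int: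
  fixes u :: "real \<Rightarrow> real"
  assumes "\<And>x. u (x + 1) = u x"
  shows "u (x + of_int k) = u x"
  using lift_plus_int[of "\<lambda>x. u x + x" x k] assms by simp

lemma periodic_attains_inf:
  fixes u :: "real \<Rightarrow> real"
  assumes c: "continuous_on UNIV u" and p: "\<And>x. u (x + 1) = u x"
  obtains x0 where "\<And>x. u x0 \<le> u x"
proof -
  obtain x0 where x0: "\<forall>y\<in>{0..1}. u x0 \<le> u y"
    using continuous_attains_inf[of "{0..1 :: real}" u] continuous_on_subset[OF c] by auto
  have "u x0 \<le> u x" for x
  proof -
    have "u x = u (frac x)" using periodic_plus_int[of u "frac x" "\<lfloor>x\<rfloor>", OF p] by (simp add: frac_def)
    moreover have "frac x \<in> {0..1}" using frac_ge_0[of x] frac_lt_1[of x] by auto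
    ultimately show ?thesis using x0 by simp
  qed
  then show thesis by (rule that)
qed

lemma deriv_periodic:
  fixes u :: "real \<Rightarrow> real"
  assumes d: "\<And>x. (u has_real_derivative u' x) (at x)" and p: "\<And>x. u (x + 1) = u x + c"
  shows "u' (x + 1) = u' x"
proof -
  have "((\<lambda>x. u (x + 1)) has_real_derivative u' (x + 1)) (at x)" using d by (subst DERIV_shift[symmetric]) simp
  then have "((\<lambda>x. u x + c) has_real_derivative u' (x + 1)) (at x)" by (simp add: p)
  moreover have "((\<lambda>x. u x + c) has_real_derivative u' x) (at x)" using d by (auto intro!: derivative_eq_intros)
  ultimately show ?thesis by (rule DERIV_unique)
qed

text \<open>A degree one lift moves points by a bounded amount, so it is onto by the intermediate value
  theorem; the inverse is continuous because it is monotone and onto.\<close>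

lemma lift_bij:
  fixes u :: "real \<Rightarrow> real"
  assumes c: "continuous_on UNIV u" and m: "strict_mono u" and p: "\<And>x. u (x + 1) = u x + 1"
  shows "bij u" "continuous_on UNIV (inv u)" "strict_mono (inv u)" "inv u (x + 1) = inv u x + 1"
proof -
  have n: "u (x + real k) = u x + real k" for x k
    using lift_plus_int[where u = u, OF p, of x "int k"] by simp
  have inj: "inj u" using m by (rule strict_mono_imp_inj_on)
  have surj: "surj u" unfolding surj_def
  proof
    fix y
    obtain k :: nat where k: "\<bar>y - u 0\<bar> \<le> real k" using real_arch_simple by blast
    have "u (- real k) \<le> y" using n[of "- real k" k] k by simp
    moreover have "y \<le> u (real k)" using n[of 0 k] k by simp
    ultimately have "\<exists>x. - real k \<le> x \<and> x \<le> real k \<and> u x = y"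
      by (intro IVT') (auto intro: continuous_on_subset[OF c])
    then show "\<exists>x. y = u x" by blast
  qed
  show b: "bij u" using inj surj by (simp add: bij_def)
  have ui: "u (inv u y) = y" for y using surj by (rule surj_f_inv_f)
  show im: "strict_mono (inv u)"
  proof (rule strict_monoI)
    fix x y :: real assume "x < y"
    then show "inv u x < inv u y" using strict_mono_less[OF m, of "inv u x" "inv u y"] ui by simp
  qed
  have "range (inv u) = UNIV" using inj by (simp add: inj_imp_surj_inv)
  then show "continuous_on UNIV (inv u)"
    by (intro continuous_onI_mono) (auto simp: strict_mono_less_eq[OF im])
  show "inv u (x + 1) = inv u x + 1" by (rule inv_f_eq[OF inj]) (simp add: p ui)
qed

lemma antiderivative_real:
  fixes w :: "real \<Rightarrow> real"
  assumes "continuous_on UNIV w"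
  obtains W where "\<And>x. (W has_real_derivative w x) (at x)"
proof -
  have "\<exists>F. \<forall>x :: real. -\<infinity> < ereal x \<longrightarrow> ereal x < \<infinity> \<longrightarrow> (F has_vector_derivative w x) (at x)"
    by (rule einterval_antiderivative) (use assms in \<open>auto simp: continuous_on_eq_continuous_at\<close>)
  then show thesis using that by (auto simp: has_real_derivative_iff_has_vector_derivative)
qed


section \<open>From characteristic functions to the Kolmogorov distance\<close>

abbreviation Phi :: "real \<Rightarrow> real"
  where "Phi \<equiv> cdf std_normal_distribution"

interpretation stdn: real_distribution std_normal_distribution by (rule real_dist_normal_dist)

lemma Phi_diff:
  assumes "x \<le> y"
  shows "Phi y - Phi x = (LINT u|lborel. indicator {x<..y} u * std_normal_density u)"
proof -
  have "Phi y - Phi x = measure std_normal_distribution {x<..y}"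
    using assms stdn.cdf_diff_eq[of x y] by (cases "x = y") auto
  also have "\<dots> = (LINT u|std_normal_distribution. indicator {x<..y} u)" by simp
  also have "\<dots> = (LINT u|lborel. std_normal_density u *\<^sub>R indicator {x<..y} u)"
    by (subst integral_density) (auto simp: normal_density_nonneg)
  finally show ?thesis by (simp add: mult.commute)
qed

lemma Phi_diff_le:
  assumes "x \<le> y" and "\<And>u. x < u \<Longrightarrow> u \<le> y \<Longrightarrow> std_normal_density u \<le> c"
  shows "Phi y - Phi x \<le> c * (y - x)"
proof -
  have "Phi y - Phi x \<le> (LINT u|lborel. indicator {x<..y} u * c)" unfolding Phi_diff[OF assms(1)]
  proof (rule integral_mono)
    show "integrable lborel (\<lambda>u. indicator {x<..y} u * std_normal_density u)"
      using integrable_real_mult_indicator[of "{x<..y}" lborel std_normal_density]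
      by (simp add: mult.commute)
    show "integrable lborel (\<lambda>u. indicator {x<..y} u * c)"
      by (intro integrable_mult_left integrable_real_indicator) (use assms(1) in auto)
  qed (use assms(2) in \<open>auto simp: indicator_def\<close>)
  also have "\<dots> = c * (y - x)" using assms(1) by simp
  finally show ?thesis .
qed

lemma std_normal_density_le_1: "std_normal_density u \<le> 1"
proof -
  have "sqrt (2 * pi) \<ge> 1" using pi_gt3 by (simp add: real_le_rsqrt)
  moreover have "exp (- u\<^sup>2 / 2) \<le> 1" by simp
  ultimately have "exp (- u\<^sup>2 / 2) \<le> sqrt (2 * pi)" by linarith
  then show ?thesis unfolding std_normal_density_def by (simp add: divide_le_eq)
qed

lemma Phi_lipschitz: "\<bar>Phi x - Phi y\<bar> \<le> \<bar>x - y\<bar>"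
proof (cases "x \<le> y")
  case True
  then show ?thesis
    using Phi_diff_le[of x y 1] std_normal_density_le_1 stdn.cdf_nondecreasing[of x y] by auto
next
  case False
  then show ?thesis
    using Phi_diff_le[of y x 1] std_normal_density_le_1 stdn.cdf_nondecreasing[of y x] by auto
qed

lemma std_normal_density_mono:
  assumes "\<bar>v\<bar> \<le> \<bar>u\<bar>" shows "std_normal_density u \<le> std_normal_density v"
proof -
  have "v\<^sup>2 \<le> u\<^sup>2" using assms by (simp add: abs_le_square_iff)
  then show ?thesis unfolding std_normal_density_def by (simp add: divide_right_mono)
qed

text \<open>This makes the normal distribution function insensitive to a change of the standard deviation
  from \<open>1\<close> to \<open>s\<close>: the interval between \<open>x / s\<close> and \<open>x\<close> is long only where the density is small.\<close>

lemma abs_mult_std_normal_density_le: "\<bar>v\<bar> * std_normal_density v \<le> 1"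
proof -
  have "\<bar>v\<bar> \<le> 1 + v\<^sup>2 / 2"
    using zero_le_power2[of "\<bar>v\<bar> - 1"] by (simp add: power2_eq_square algebra_simps)
  also have "\<dots> \<le> exp (v\<^sup>2 / 2)" by (rule exp_ge_add_one_self)
  finally have "\<bar>v\<bar> * exp (- v\<^sup>2 / 2) \<le> exp (v\<^sup>2 / 2) * exp (- v\<^sup>2 / 2)"
    by (intro mult_right_mono) auto
  also have "\<dots> = 1" by (simp add: exp_add[symmetric])
  finally have *: "\<bar>v\<bar> * exp (- v\<^sup>2 / 2) \<le> 1" .
  have "sqrt (2 * pi) \<ge> 1" using pi_gt3 by (simp add: real_le_rsqrt)
  with * have "\<bar>v\<bar> * exp (- v\<^sup>2 / 2) \<le> sqrt (2 * pi)" by linarith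
  then show ?thesis unfolding std_normal_density_def by (simp add: divide_le_eq)
qed

lemma Phi_scale_diff:
  assumes s: "s \<ge> 1"
  shows "\<bar>Phi (x / s) - Phi x\<bar> \<le> s - 1"
proof -
  define v where "v = x / s"
  have x: "x = s * v" using s by (simp add: v_def)
  have b: "std_normal_density v * \<bar>x - v\<bar> \<le> s - 1"
  proof -
    have "\<bar>x - v\<bar> = (s - 1) * \<bar>v\<bar>"
    proof -
      have "x - v = (s - 1) * v" unfolding x by (simp add: algebra_simps)
      then show ?thesis using s by (simp add: abs_mult)
    qed
    then have "std_normal_density v * \<bar>x - v\<bar> = (s - 1) * (\<bar>v\<bar> * std_normal_density v)" by simp
    also have "\<dots> \<le> (s - 1) * 1"
      using s abs_mult_std_normal_density_le by (intro mult_left_mono) auto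
    finally show ?thesis by simp
  qed
  show ?thesis
  proof (cases "v \<ge> 0")
    case True
    then have vx: "v \<le> x" using s unfolding x by (simp add: mult_le_cancel_right1)
    have "Phi x - Phi v \<le> std_normal_density v * (x - v)"
      by (rule Phi_diff_le[OF vx]) (use True in \<open>auto intro!: std_normal_density_mono\<close>)
    then show ?thesis using b vx stdn.cdf_nondecreasing[OF vx] by (auto simp: v_def)
  next
    case False
    then have vx: "x \<le> v" using s unfolding x by (simp add: mult_le_cancel_right2)
    have "Phi v - Phi x \<le> std_normal_density v * (v - x)"
      by (rule Phi_diff_le[OF vx]) (use False in \<open>auto intro!: std_normal_density_mono\<close>)
    then show ?thesis using b vx stdn.cdf_nondecreasing[OF vx] by (auto simp: v_def)
  qed
qed

lemma Phi_affine:
  assumes s: "s > 0" and ab: "a \<le> b"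
  shows "(LINT y|lborel. indicator {a<..b} y * normal_density 0 s (y - c)) = Phi ((b - c) / s) - Phi ((a - c) / s)"
proof -
  have le: "(a - c) / s \<le> (b - c) / s" using s ab by (simp add: divide_right_mono)
  have "(LINT y|lborel. indicator {a<..b} y * normal_density 0 s (y - c))
      = \<bar>s\<bar> *\<^sub>R (LINT u|lborel. indicator {a<..b} (c + s * u) * normal_density 0 s ((c + s * u) - c))"
    using s by (intro lborel_integral_real_affine) auto
  also have "\<dots> = (LINT u|lborel. \<bar>s\<bar> * (indicator {a<..b} (c + s * u) * normal_density 0 s (s * u)))"
    by simp
  also have "\<dots> = (LINT u|lborel. indicator {(a - c) / s<..(b - c) / s} u * std_normal_density u)"
  proof (rule Bochner_Integration.integral_cong)
    fix u
    have "s * normal_density 0 s (s * u) = std_normal_density u"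
      using s by (simp add: normal_density_def power_mult_distrib real_sqrt_mult)
    moreover have "(indicator {a<..b} (c + s * u) :: real) = indicator {(a - c) / s<..(b - c) / s} u"
      using s by (auto simp: indicator_def field_simps)
    ultimately show "\<bar>s\<bar> * (indicator {a<..b} (c + s * u) * normal_density 0 s (s * u))
      = indicator {(a - c) / s<..(b - c) / s} u * std_normal_density u" using s by simp
  qed simp
  finally show ?thesis using Phi_diff[OF le] by simp
qed

text \<open>The Fourier inversion formula for Gaussian densities is the formula for the characteristic function
  of the normal law, read backwards after a change of scale.\<close>

lemma has_bochner_gauss_fourier:
  assumes s: "s > 0"
  shows "has_bochner_integral lborel (\<lambda>t. iexp (- t * y) * complex_of_real (exp (- (s\<^sup>2 * t\<^sup>2) / 2)))
     (complex_of_real (2 * pi * normal_density 0 s y))"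
proof -
  have c: "(CLINT x|std_normal_distribution. iexp ((- y / s) * x)) = exp (- ((- y / s)\<^sup>2) / 2)"
    using char_std_normal_distribution by (metis char_def)
  have i: "integrable std_normal_distribution (\<lambda>x. iexp ((- y / s) * x))"
    by (rule stdn.integrable_iexp) simp_all
  have i2: "integrable lborel (\<lambda>x. std_normal_density x *\<^sub>R iexp ((- y / s) * x))"
    using i by (subst (asm) integrable_density) (auto simp: normal_density_nonneg)
  have "(CLINT x|lborel. std_normal_density x *\<^sub>R iexp ((- y / s) * x)) = exp (- ((- y / s)\<^sup>2) / 2)"
    using c by (subst (asm) integral_density) (auto simp: normal_density_nonneg)
  then have "has_bochner_integral lborel (\<lambda>x. std_normal_density x *\<^sub>R iexp ((- y / s) * x))
     (exp (- ((- y / s)\<^sup>2) / 2))"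
    using i2 by (simp add: has_bochner_integral_iff del: of_real_exp)
  then have "has_bochner_integral lborel (\<lambda>t. std_normal_density (0 + s * t) *\<^sub>R iexp ((- y / s) * (0 + s * t)))
     (complex_of_real (exp (- ((- y / s)\<^sup>2) / 2)) /\<^sub>R \<bar>s\<bar>)"
    using s by (subst (asm) lborel_has_bochner_integral_real_affine_iff[where c=s and t=0]) auto
  then have "has_bochner_integral lborel (\<lambda>t. sqrt (2 * pi) *\<^sub>R (std_normal_density (0 + s * t) *\<^sub>R iexp ((- y / s) * (0 + s * t))))
     (sqrt (2 * pi) *\<^sub>R (complex_of_real (exp (- ((- y / s)\<^sup>2) / 2)) /\<^sub>R \<bar>s\<bar>))"
    by (rule has_bochner_integral_scaleR_right[rotated])
  moreover have "sqrt (2 * pi) *\<^sub>R (std_normal_density (0 + s * t) *\<^sub>R iexp ((- y / s) * (0 + s * t)))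
     = iexp (- t * y) * complex_of_real (exp (- (s\<^sup>2 * t\<^sup>2) / 2))" for t
  proof -
    have "sqrt (2 * pi) * std_normal_density (0 + s * t) = exp (- (s\<^sup>2 * t\<^sup>2) / 2)"
      by (simp add: std_normal_density_def power_mult_distrib)
    moreover have "(- y / s) * (0 + s * t) = - t * y" using s by simp
    ultimately show ?thesis
      by (simp only: scaleR_scaleR) (simp add: scaleR_conv_of_real mult.commute del: of_real_exp)
  qed
  moreover have "sqrt (2 * pi) *\<^sub>R (complex_of_real (exp (- ((- y / s)\<^sup>2) / 2)) /\<^sub>R \<bar>s\<bar>)
     = complex_of_real (2 * pi * normal_density 0 s y)"
  proof -
    have "sqrt (2 * pi) * (inverse s * exp (- ((- y / s)\<^sup>2) / 2)) = 2 * pi * normal_density 0 s y"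
      using s by (simp add: normal_density_def real_sqrt_mult power_divide field_simps)
    then show ?thesis using s by (simp only: scaleR_conv_of_real of_real_mult[symmetric]) simp
  qed
  ultimately show ?thesis by simp
qed

text \<open>The factor \<open>\<bar>t\<bar>\<close> gained by integrating over an interval compensates the factor \<open>\<bar>t\<bar>\<close>
  lost in the bound on the characteristic functions.\<close>

lemma cmod_interval_integral_iexp:
  assumes "a \<le> b"
  shows "cmod (CLINT y|lborel. indicator {a<..b} y *\<^sub>R iexp (- t * y)) * \<bar>t\<bar> \<le> 2"
proof (cases "t = 0")
  case False
  define F where "F y = (\<i> / t) * iexp (- t * y)" for y
  have "(CLINT y|lborel. indicator {a<..b} y *\<^sub>R iexp (- t * y)) = (LBINT y=a..b. iexp (- t * y))"
    using assms by (simp add: interval_lebesgue_integral_def einterval_eq set_lebesgue_integral_def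
      einterval_eq_Icc)
       (rule integral_cong_AE, auto intro!: AE_I[where N="{b}"] simp: indicator_def)
  also have "\<dots> = F b - F a"
  proof (rule interval_integral_FTC_finite)
    show "continuous_on {min a b..max a b} (\<lambda>y. iexp (- t * y))" by (intro continuous_intros)
    show "(F has_vector_derivative iexp (- t * x)) (at x within {min a b..max a b})" for x
    proof -
      have "((\<lambda>z. (\<i> / t) * exp (\<i> * (- of_real t * z))) has_field_derivative iexp (- t * x)) (at (of_real x))"
        using False by (auto intro!: derivative_eq_intros)
      from has_vector_derivative_real_field[OF this]
      have "((\<lambda>y. (\<i> / t) * exp (\<i> * (- of_real t * of_real y))) has_vector_derivative iexp (- t * x)) (at x)" .
      then show ?thesis unfolding F_def by (simp add: has_vector_derivative_at_within)
    qed
  qed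
  also have "cmod \<dots> \<le> cmod (F b) + cmod (F a)" by (rule norm_triangle_ineq4)
  also have "\<dots> = 2 / \<bar>t\<bar>" by (simp add: F_def norm_mult norm_divide)
  finally show ?thesis using False by (simp add: field_simps)
qed simp

text \<open>The left-hand side compares the laws of \<open>X + e * Z\<close> and \<open>Z + e * Z'\<close> on an interval, where \<open>Z\<close> and \<open>Z'\<close> are
  independent standard normal variables. Both laws have densities that are Fourier integrals of
  characteristic functions damped by a Gaussian factor, so their difference can be integrated
  over the interval under the integral sign.\<close>

lemma smoothed_interval_bound:
  fixes X :: "'a \<Rightarrow> real"
  assumes A: "finite A" "A \<noteq> {}" and e: "e > 0" and ab: "a \<le> b"
    and D: "\<And>t. cmod ((\<Sum>p\<in>A. iexp (t * X p)) / card A - exp (- t\<^sup>2 / 2)) \<le> D * \<bar>t\<bar>"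
  defines "r \<equiv> sqrt (1 + e\<^sup>2)"
  shows "\<bar>(\<Sum>p\<in>A. Phi ((b - X p) / e) - Phi ((a - X p) / e)) / card A - (Phi (b / r) - Phi (a / r))\<bar> \<le> D / e"
proof -
  have D0: "D \<ge> 0" using order_trans[OF norm_ge_zero D[of 1]] by simp
  have r: "r > 0" "r\<^sup>2 = 1 + e\<^sup>2" by (auto simp: r_def add_pos_nonneg)
  define R where "R t = (\<Sum>p\<in>A. iexp (t * X p)) / card A - exp (- t\<^sup>2 / 2)" for t
  define E where "E t = complex_of_real (exp (- (e\<^sup>2 * t\<^sup>2) / 2))" for t
  define d where "d y = (\<Sum>p\<in>A. normal_density 0 e (y - X p)) / card A - normal_density 0 r y" for y
  have Eint: "integrable lborel E"
    using has_bochner_gauss_fourier[OF e, of 0] by (simp add: has_bochner_integral_iff E_def[abs_def])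
  have Rm [measurable]: "R \<in> borel_measurable borel" "E \<in> borel_measurable borel"
    unfolding R_def[abs_def] E_def[abs_def] using A by (auto intro!: borel_measurable_continuous_onI continuous_intros)
  have dR: "has_bochner_integral lborel (\<lambda>t. iexp (- t * y) * (R t * E t)) (complex_of_real (2 * pi * d y))" for y
  proof -
    have "has_bochner_integral lborel (\<lambda>t. (\<Sum>p\<in>A. iexp (- t * (y - X p)) * E t) / card A - iexp (- t * y) * exp (- (r\<^sup>2 * t\<^sup>2) / 2))
       ((\<Sum>p\<in>A. complex_of_real (2 * pi * normal_density 0 e (y - X p))) / card A - complex_of_real (2 * pi * normal_density 0 r y))"
      unfolding E_def by (intro has_bochner_integral_diff has_bochner_integral_divide_zero has_bochner_integral_sum has_bochner_gauss_fourier e r)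
    moreover have "(\<Sum>p\<in>A. iexp (- t * (y - X p)) * E t) / card A - iexp (- t * y) * exp (- (r\<^sup>2 * t\<^sup>2) / 2)
       = iexp (- t * y) * (R t * E t)" for t
    proof -
      have "iexp (- t * (y - X p)) = iexp (- t * y) * iexp (t * X p)" for p
        by (simp add: exp_add[symmetric] algebra_simps)
      moreover have "complex_of_real (exp (- (r\<^sup>2 * t\<^sup>2) / 2)) = exp (- t\<^sup>2 / 2) * E t"
        unfolding E_def r of_real_mult[symmetric] exp_add[symmetric] by (simp add: field_simps)
      ultimately show ?thesis
        by (simp only: R_def sum_divide_distrib sum_distrib_left sum_distrib_right right_diff_distrib left_diff_distrib)
           (simp add: ac_simps)
    qed
    moreover have "(\<Sum>p\<in>A. complex_of_real (2 * pi * normal_density 0 e (y - X p))) / card A - complex_of_real (2 * pi * normal_density 0 r y)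
      = complex_of_real (2 * pi * d y)" by (simp add: d_def sum_distrib_left right_diff_distrib)
    ultimately show ?thesis by simp
  qed
  define J where "J = (LINT y|lborel. indicator {a<..b} y * d y)"
  have "J = (\<Sum>p\<in>A. Phi ((b - X p) / e) - Phi ((a - X p) / e)) / card A - (Phi (b / r) - Phi (a / r))"
  proof -
    have i: "integrable lborel (\<lambda>y. indicator {a<..b} y * normal_density 0 s (y - c))" if "s > 0" for s c
    proof -
      have "integrable lborel (\<lambda>y. normal_density 0 s (- c + 1 * y))"
        by (rule lborel_integrable_real_affine) (use that in auto)
      then show ?thesis using integrable_real_mult_indicator[of "{a<..b}" lborel "\<lambda>y. normal_density 0 s (y - c)"]
        by (simp add: mult.commute)
    qed
    have "J = (LINT y|lborel. (\<Sum>p\<in>A. indicator {a<..b} y * normal_density 0 e (y - X p)) / card A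
       - indicator {a<..b} y * normal_density 0 r (y - 0))"
      unfolding J_def d_def by (simp add: right_diff_distrib sum_distrib_left)
    also have "\<dots> = (\<Sum>p\<in>A. LINT y|lborel. indicator {a<..b} y * normal_density 0 e (y - X p)) / card A
       - (LINT y|lborel. indicator {a<..b} y * normal_density 0 r (y - 0))"
      using i[OF e] i[OF r(1), of 0] by simp
    also have "\<dots> = (\<Sum>p\<in>A. Phi ((b - X p) / e) - Phi ((a - X p) / e)) / card A - (Phi (b / r) - Phi (a / r))"
      unfolding Phi_affine[OF e ab] Phi_affine[OF r(1) ab] by simp
    finally show ?thesis .
  qed
  moreover have "\<bar>J\<bar> \<le> D / e"
  proof -
    let ?f = "\<lambda>y t. indicator {a<..b} y *\<^sub>R (iexp (- t * y) * (R t * E t))"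
    have bR: "cmod (R t) \<le> 2" for t
    proof -
      have "cmod ((\<Sum>p\<in>A. iexp (t * X p)) / card A) \<le> 1"
        using A sum_norm_le[of A "\<lambda>p. iexp (t * X p)" "\<lambda>_. 1"]
        by (simp add: norm_divide divide_le_eq card_gt_0_iff)
      moreover have "cmod (complex_of_real (exp (- t\<^sup>2 / 2))) \<le> 1"
        by (simp only: norm_of_real) simp
      ultimately show ?thesis unfolding R_def
        using norm_triangle_ineq4[of "(\<Sum>p\<in>A. iexp (t * X p)) / card A" "exp (- t\<^sup>2 / 2)"] by linarith
    qed
    have int: "integrable (lborel \<Otimes>\<^sub>M lborel) (\<lambda>(y, t). ?f y t)"
    proof (rule Bochner_Integration.integrable_bound)
      show "integrable (lborel \<Otimes>\<^sub>M lborel) (\<lambda>(y :: real, t). indicator {a<..b} y *\<^sub>R (2 * E t))"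
      proof (rule lborel_pair.Fubini_integrable)
        have "integrable lborel (\<lambda>x. indicator {a<..b} x * (LINT y|lborel. cmod (2 * E y)))"
          by (intro integrable_mult_left integrable_real_indicator) (use ab in auto)
        then show "integrable lborel (\<lambda>x. LINT y|lborel. norm (case (x, y) of (y, t) \<Rightarrow> indicator {a<..b} y *\<^sub>R (2 * E t)))"
          by (simp add: norm_mult)
      qed (use Eint in auto)
      show "AE x in lborel \<Otimes>\<^sub>M lborel. norm (case x of (y, t) \<Rightarrow> ?f y t)
         \<le> norm (case x of (y, t) \<Rightarrow> indicator {a<..b} y *\<^sub>R (2 * E t))"
        using bR by (auto intro!: AE_I2 mult_left_mono mult_right_mono simp: norm_mult)
    qed measurable
    have "complex_of_real (2 * pi * J) = (LINT y|lborel. indicator {a<..b} y *\<^sub>R complex_of_real (2 * pi * d y))"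
    proof -
      have "(LINT y|lborel. indicator {a<..b} y *\<^sub>R complex_of_real (2 * pi * d y))
         = (LINT y|lborel. complex_of_real (2 * pi * (indicator {a<..b} y * d y)))"
        by (intro Bochner_Integration.integral_cong) (auto simp: indicator_def)
      also have "\<dots> = complex_of_real (2 * pi * J)"
        unfolding J_def by (simp only: integral_complex_of_real integral_mult_right_zero)
      finally show ?thesis by simp
    qed
    also have "\<dots> = (LINT y|lborel. LINT t|lborel. ?f y t)"
      using dR by (simp add: has_bochner_integral_iff)
    also have "\<dots> = (LINT t|lborel. LINT y|lborel. ?f y t)"
      by (rule lborel_pair.Fubini_integral[symmetric, OF int])
    also have "cmod \<dots> \<le> (LINT t|lborel. 2 * D * cmod (E t))"
    proof (rule order_trans[OF integral_norm_bound integral_mono])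
      show "integrable lborel (\<lambda>t. cmod (LINT y|lborel. ?f y t))"
        using lborel_pair.integrable_snd[OF int] by (rule integrable_norm)
      show "integrable lborel (\<lambda>t. 2 * D * cmod (E t))" using Eint by simp
      fix t
      have "(LINT y|lborel. ?f y t) = (LINT y|lborel. (indicator {a<..b} y *\<^sub>R iexp (- t * y)) * (R t * E t))"
        by (simp only: mult_scaleR_left)
      also have "\<dots> = (CLINT y|lborel. indicator {a<..b} y *\<^sub>R iexp (- t * y)) * (R t * E t)"
        by (rule integral_mult_left_zero)
      also have "cmod \<dots> \<le> cmod (CLINT y|lborel. indicator {a<..b} y *\<^sub>R iexp (- t * y)) * (D * \<bar>t\<bar> * cmod (E t))"
        using D[of t] unfolding R_def[symmetric] norm_mult by (intro mult_left_mono mult_right_mono) auto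
      also have "\<dots> = D * cmod (E t) * (cmod (CLINT y|lborel. indicator {a<..b} y *\<^sub>R iexp (- t * y)) * \<bar>t\<bar>)"
        by simp
      also have "\<dots> \<le> D * cmod (E t) * 2"
        by (intro mult_left_mono cmod_interval_integral_iexp ab) (use D0 in auto)
      finally show "cmod (LINT y|lborel. ?f y t) \<le> 2 * D * cmod (E t)" by simp
    qed
    also have "\<dots> = 2 * D * (2 * pi * normal_density 0 e 0)"
    proof -
      have "(LINT t|lborel. complex_of_real (cmod (E t))) = complex_of_real (2 * pi * normal_density 0 e 0)"
        using has_bochner_gauss_fourier[OF e, of 0] by (simp add: has_bochner_integral_iff E_def)
      then show ?thesis by (simp only: integral_complex_of_real of_real_eq_iff) simp
    qed
    finally have "2 * pi * \<bar>J\<bar> \<le> 2 * D * (2 * pi * normal_density 0 e 0)"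
      by (simp add: norm_mult abs_mult)
    then have "\<bar>J\<bar> \<le> D * (2 * normal_density 0 e 0)" by simp
    also have "\<dots> \<le> D * (1 / e)"
    proof (rule mult_left_mono[OF _ D0])
      have "sqrt (2 * pi) \<ge> 2" using pi_gt3 by (intro real_le_rsqrt) simp
      then show "2 * normal_density 0 e 0 \<le> 1 / e" using e by (simp add: normal_density_def real_sqrt_mult field_simps)
    qed
    finally show ?thesis by simp
  qed
  ultimately show ?thesis by simp
qed

lemma smoothed_cdf_bound:
  fixes X :: "'a \<Rightarrow> real"
  assumes A: "finite A" "A \<noteq> {}" and e: "e > 0"
    and D: "\<And>t. cmod ((\<Sum>p\<in>A. iexp (t * X p)) / card A - exp (- t\<^sup>2 / 2)) \<le> D * \<bar>t\<bar>"
  shows "\<bar>(\<Sum>p\<in>A. Phi ((b - X p) / e)) / card A - Phi b\<bar> \<le> D / e + e"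
proof -
  define r where "r = sqrt (1 + e\<^sup>2)"
  have r: "r > 0" "r \<ge> 1" by (auto simp: r_def add_pos_nonneg)
  have "r \<le> 1 + e" unfolding r_def using e by (intro real_le_lsqrt) (auto simp: power2_eq_square algebra_simps)
  have "\<bar>(\<Sum>p\<in>A. Phi ((b - X p) / e) - 0) / card A - (Phi (b / r) - 0)\<bar> \<le> D / e"
  proof (rule tendsto_le[OF trivial_limit_at_bot_linorder])
    have lim: "((\<lambda>a. Phi ((a - c) / s)) \<longlongrightarrow> 0) at_bot" if "s > 0" for c s :: real
    proof (rule filterlim_compose[OF stdn.cdf_lim_at_bot])
      show "filterlim (\<lambda>a :: real. (a - c) / s) at_bot at_bot" using that by real_asymp
    qed
    show "((\<lambda>a. \<bar>(\<Sum>p\<in>A. Phi ((b - X p) / e) - Phi ((a - X p) / e)) / card A - (Phi (b / r) - Phi (a / r))\<bar>)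
      \<longlongrightarrow> \<bar>(\<Sum>p\<in>A. Phi ((b - X p) / e) - 0) / card A - (Phi (b / r) - 0)\<bar>) at_bot"
      using A lim[OF e] lim[OF r(1), of 0] by (intro tendsto_intros) auto
    show "((\<lambda>_. D / e) \<longlongrightarrow> D / e) at_bot" by simp
    show "\<forall>\<^sub>F a in at_bot. \<bar>(\<Sum>p\<in>A. Phi ((b - X p) / e) - Phi ((a - X p) / e)) / card A - (Phi (b / r) - Phi (a / r))\<bar> \<le> D / e"
      using smoothed_interval_bound[OF A e _ D] unfolding r_def
      by (intro eventually_mono[OF eventually_le_at_bot[of b]]) blast
  qed
  moreover have "\<bar>Phi (b / r) - Phi b\<bar> \<le> e"
    using Phi_scale_diff[OF r(2), of b] \<open>r \<le> 1 + e\<close> by linarith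
  ultimately show ?thesis by (simp; linarith)
qed

text \<open>Let \<open>S\<close> be the largest distance between the two distribution functions. Near a point where it
  is attained, monotonicity of the empirical function keeps the difference large on one side, over a
  length comparable to \<open>e\<close>. A Gaussian average shifted to that side sees this with weight
  at least \<open>3 / 4\<close>, and elsewhere loses at most \<open>S\<close> with weight at most \<open>1 / 4\<close>. Hence \<open>S\<close> is at most
  \<open>S / 3\<close> plus a multiple of \<open>d + e\<close>.\<close>

lemma unsmoothing:
  obtains C :: real where "C > 0"
    "\<And>(A :: 'a set) X e d. finite A \<Longrightarrow> A \<noteq> {} \<Longrightarrow> e > 0 \<Longrightarrow>
      (\<And>b. \<bar>(\<Sum>p\<in>A. Phi ((b - X p) / e)) / card A - Phi b\<bar> \<le> d) \<Longrightarrow>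
      (\<And>x. \<bar>real (card {p\<in>A. X p \<le> x}) / card A - Phi x\<bar> \<le> C * (d + e))"
proof -
  let ?N = "std_normal_distribution"
  have "((\<lambda>x. Phi x) \<longlongrightarrow> 1) at_top" by (rule stdn.cdf_lim_at_top_prob)
  then have e1: "\<forall>\<^sub>F x in at_top. Phi x > 3 / 4" by (rule order_tendstoD) simp
  have "((\<lambda>x. Phi x) \<longlongrightarrow> 0) at_bot" by (rule stdn.cdf_lim_at_bot)
  then have "\<forall>\<^sub>F x in at_bot. Phi x < 1 / 4" by (rule order_tendstoD) simp
  then have e2: "\<forall>\<^sub>F x in at_top. Phi (- x) < 1 / 4"
    by (rule eventually_compose_filterlim) (rule filterlim_uminus_at_bot_at_top)
  from eventually_happens[OF eventually_conj[OF e1 eventually_conj[OF e2 eventually_gt_at_top[of 0]]]]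
  obtain a where a: "a > 0" "Phi a > 3 / 4" "Phi (- a) < 1 / 4" by auto
  have m_int: "integrable ?N (\<lambda>x. x)"
    using integrable_std_normal_distribution_moment[of 1] by simp
  have i1: "integrable ?N (\<lambda>z. \<bar>z - a\<bar>)" and i2: "integrable ?N (\<lambda>z. \<bar>z + a\<bar>)"
    using m_int by auto
  define c where "c = (LINT z|?N. \<bar>z - a\<bar>) + (LINT z|?N. \<bar>z + a\<bar>)"
  have c1: "(LINT z|?N. \<bar>z - a\<bar>) \<le> c" "(LINT z|?N. \<bar>z + a\<bar>) \<le> c" and c0: "c \<ge> 0"
    unfolding c_def by auto
  define C where "C = 2 * (1 + c + a)"
  have key: "\<bar>real (card {p\<in>A. X p \<le> x}) / card A - Phi x\<bar> \<le> C * (d + e)"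
    if A: "finite A" "A \<noteq> {}" and e: "e > 0"
      and d: "\<And>b. \<bar>(\<Sum>p\<in>A. Phi ((b - X p) / e)) / card A - Phi b\<bar> \<le> d"
    for A :: "'a set" and X e d x
  proof -
    define F where "F y = real (card {p\<in>A. X p \<le> y}) / card A" for y
    have cA: "card A > 0" using A by (simp add: card_gt_0_iff)
    have F01: "0 \<le> F y" "F y \<le> 1" for y
      using A cA card_mono[of A "{p\<in>A. X p \<le> y}"] by (auto simp: F_def divide_le_eq)
    have Fmono: "F y \<le> F z" if "y \<le> z" for y z
      unfolding F_def using A that by (intro divide_right_mono) (auto intro!: card_mono)
    have Fsum: "F y = (\<Sum>p\<in>A. indicator {.. y} (X p)) / card A" for y
      using A by (simp add: F_def indicator_def sum.If_cases Int_def conj_commute)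
    have ii: "integrable ?N (\<lambda>z. indicator {..y - e * z} v :: real)" for y v
    proof (rule stdn.integrable_const_bound[where B=1])
      have "(\<lambda>z. indicator {..y - e * z} v :: real) = (\<lambda>z. if v \<le> y - e * z then 1 else 0)" by (auto simp: indicator_def)
      then show "(\<lambda>z. indicator {..y - e * z} v :: real) \<in> borel_measurable ?N" by simp
    qed (auto simp: indicator_def)
    have Fi: "integrable ?N (\<lambda>z. F (y - e * z))" for y
      unfolding Fsum by (intro integrable_divide_zero Bochner_Integration.integrable_sum ii)
    have conv: "(LINT z|?N. F (y - e * z)) = (\<Sum>p\<in>A. Phi ((y - X p) / e)) / card A" for y
    proof -
      have "(LINT z|?N. indicator {..y - e * z} (X p) :: real) = Phi ((y - X p) / e)" for p
      proof -
        have "(LINT z|?N. indicator {..y - e * z} (X p) :: real) = (LINT z|?N. indicator {.. (y - X p) / e} z)"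
          using e by (intro Bochner_Integration.integral_cong) (auto simp: indicator_def field_simps)
        then show ?thesis by (simp add: cdf_def)
      qed
      then show ?thesis unfolding Fsum using ii by simp
    qed
    define S where "S = (SUP y. \<bar>F y - Phi y\<bar>)"
    have P01: "0 \<le> Phi y" "Phi y \<le> 1" for y using stdn.cdf_nonneg stdn.cdf_bounded_prob by auto
    have bdd: "bdd_above (range (\<lambda>y. \<bar>F y - Phi y\<bar>))"
    proof (rule bdd_aboveI2)
      show "\<bar>F y - Phi y\<bar> \<le> 1" for y using F01[of y] P01[of y] by linarith
    qed
    have S: "\<bar>F y - Phi y\<bar> \<le> S" for y unfolding S_def by (rule cSUP_upper[OF _ bdd]) simp
    have S0: "S \<ge> 0" using S[of 0] by linarith
    define g where "g = d + (a + c) * e"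
    \<comment> \<open>the average is taken around \<open>y + a * e\<close>, so that \<open>F\<close> exceeds \<open>F y\<close> wherever \<open>z \<le> a\<close>\<close>
    have up: "F y - Phi y \<le> S / 3 + 4 / 3 * g" for y
    proof -
      let ?h = "\<lambda>z. (Phi y - S) - e * \<bar>z - a\<bar> + indicator {..a} z * (F y - Phi y + S)"
      have iind: "integrable ?N (\<lambda>z. indicator {..a} z * k)" for k :: real
        by (intro integrable_mult_left integrable_real_indicator) (auto simp: stdn.emeasure_finite less_top[symmetric])
      have "(LINT z|?N. ?h z) \<le> (LINT z|?N. F (y + a * e - e * z))"
      proof (rule integral_mono)
        show "integrable ?N ?h" using i1 iind by auto
        show "integrable ?N (\<lambda>z. F (y + a * e - e * z))" by (rule Fi)
        fix z
        show "?h z \<le> F (y + a * e - e * z)"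
        proof (cases "z \<le> a")
          case True
          have "e * z \<le> e * a" using True e by simp
          then have "F y \<le> F (y + a * e - e * z)" by (intro Fmono) (simp add: mult.commute)
          moreover have "0 \<le> e * \<bar>z - a\<bar>" using e by simp
          ultimately show ?thesis using True by simp
        next
          case False
          have "\<bar>Phi (y + a * e - e * z) - Phi y\<bar> \<le> \<bar>(y + a * e - e * z) - y\<bar>" by (rule Phi_lipschitz)
          also have "(y + a * e - e * z) - y = - (e * (z - a))" by (simp add: algebra_simps)
          also have "\<bar>- (e * (z - a))\<bar> = e * \<bar>z - a\<bar>" using e by (simp add: abs_mult)
          finally show ?thesis using S[of "y + a * e - e * z"] False by (simp; linarith)
        qed
      qed
      moreover have "(LINT z|?N. ?h z) = (Phi y - S) - e * (LINT z|?N. \<bar>z - a\<bar>) + Phi a * (F y - Phi y + S)"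
        using i1 iind stdn.prob_space by (simp add: cdf_def)
      moreover have "e * (LINT z|?N. \<bar>z - a\<bar>) \<le> c * e" using c1(1) e by (simp add: mult.commute)
      moreover have "(LINT z|?N. F (y + a * e - e * z)) \<le> Phi (y + a * e) + d"
        using d[of "y + a * e"] unfolding conv by linarith
      moreover have "Phi (y + a * e) \<le> Phi y + a * e" using Phi_lipschitz[of "y + a * e" y] a e by simp
      ultimately have *: "Phi a * (F y - Phi y + S) \<le> S + g"
        unfolding g_def by (simp add: algebra_simps)
      have "3 / 4 * (F y - Phi y + S) \<le> Phi a * (F y - Phi y + S)"
        using a S[of y] by (intro mult_right_mono) auto
      with * show ?thesis by (simp add: field_simps)
    qed
    \<comment> \<open>the mirror image, around \<open>y - a * e\<close>\<close>
    have low: "Phi y - F y \<le> S / 3 + 4 / 3 * g" for y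
    proof -
      let ?h = "\<lambda>z. F y + e * \<bar>z + a\<bar> + indicator {..-a} z * (Phi y - F y + S)"
      have iind: "integrable ?N (\<lambda>z. indicator {..-a} z * k)" for k :: real
        by (intro integrable_mult_left integrable_real_indicator) (auto simp: stdn.emeasure_finite less_top[symmetric])
      have "(LINT z|?N. F (y - a * e - e * z)) \<le> (LINT z|?N. ?h z)"
      proof (rule integral_mono)
        show "integrable ?N ?h" using i2 iind by auto
        show "integrable ?N (\<lambda>z. F (y - a * e - e * z))" by (rule Fi)
        fix z
        show "F (y - a * e - e * z) \<le> ?h z"
        proof (cases "z \<le> - a")
          case False
          have "e * (- a) \<le> e * z" using False e by (intro mult_left_mono) auto
          then have "F (y - a * e - e * z) \<le> F y" by (intro Fmono) (simp add: mult.commute)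
          moreover have "0 \<le> e * \<bar>z + a\<bar>" using e by simp
          ultimately show ?thesis using False by simp
        next
          case True
          have "\<bar>Phi (y - a * e - e * z) - Phi y\<bar> \<le> \<bar>(y - a * e - e * z) - y\<bar>" by (rule Phi_lipschitz)
          also have "(y - a * e - e * z) - y = - (e * (z + a))" by (simp add: algebra_simps)
          also have "\<bar>- (e * (z + a))\<bar> = e * \<bar>z + a\<bar>" using e by (simp add: abs_mult)
          finally show ?thesis using S[of "y - a * e - e * z"] True by (simp; linarith)
        qed
      qed
      moreover have "(LINT z|?N. ?h z) = F y + e * (LINT z|?N. \<bar>z + a\<bar>) + Phi (-a) * (Phi y - F y + S)"
        using i2 iind stdn.prob_space by (simp add: cdf_def)
      moreover have "e * (LINT z|?N. \<bar>z + a\<bar>) \<le> c * e" using c1(2) e by (simp add: mult.commute)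
      moreover have "(LINT z|?N. F (y - a * e - e * z)) \<ge> Phi (y - a * e) - d"
        using d[of "y - a * e"] unfolding conv by linarith
      moreover have "Phi (y - a * e) \<ge> Phi y - a * e" using Phi_lipschitz[of "y - a * e" y] a e by simp
      ultimately have *: "Phi y - F y \<le> g + Phi (-a) * (Phi y - F y + S)"
        unfolding g_def by (simp add: algebra_simps)
      have "Phi (-a) * (Phi y - F y + S) \<le> 1 / 4 * (Phi y - F y + S)"
        using a S[of y] by (intro mult_right_mono) auto
      with * show ?thesis by (simp add: field_simps)
    qed
    have "S \<le> S / 3 + 4 / 3 * g"
      unfolding S_def by (rule cSUP_least) (use up low in \<open>auto simp: S_def[symmetric] abs_le_iff\<close>)
    then have "S \<le> 2 * g" by simp
    also have "\<dots> \<le> C * (d + e)"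
    proof -
      have "d \<ge> 0" using d[of 0] by linarith
      then have "0 \<le> (c + a) * d" "0 \<le> e" using c0 a e by auto
      then show ?thesis unfolding g_def C_def by (simp add: algebra_simps)
    qed
    finally show ?thesis using S[of x] unfolding F_def by linarith
  qed
  show thesis by (rule that[of C, OF _ key]) (use c0 a in \<open>auto simp: C_def add_nonneg_pos\<close>)
qed

text \<open>The choice \<open>e = sqrt D\<close> balances the smoothing error \<open>D / e\<close> and the displacement \<open>e\<close>.\<close>

theorem kolmogorov_distance_of_char:
  obtains C :: real where "C > 0"
    "\<And>(A :: 'a set) X D. finite A \<Longrightarrow> A \<noteq> {} \<Longrightarrow> D > 0 \<Longrightarrow>
      (\<And>t. cmod ((\<Sum>p\<in>A. iexp (t * X p)) / card A - exp (- t\<^sup>2 / 2)) \<le> D * \<bar>t\<bar>) \<Longrightarrow>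
      (\<And>x. \<bar>real (card {p\<in>A. X p \<le> x}) / card A - Phi x\<bar> \<le> C * sqrt D)"
proof (rule unsmoothing)
  fix C :: real
  assume C: "C > 0" "\<And>(A :: 'a set) X e d x. finite A \<Longrightarrow> A \<noteq> {} \<Longrightarrow> e > 0 \<Longrightarrow>
      (\<And>b. \<bar>(\<Sum>p\<in>A. Phi ((b - X p) / e)) / card A - Phi b\<bar> \<le> d) \<Longrightarrow>
      \<bar>real (card {p\<in>A. X p \<le> x}) / card A - Phi x\<bar> \<le> C * (d + e)"
  show thesis
  proof (rule that[of "3 * C"])
    fix A :: "'a set" and X D x
    assume A: "finite A" "A \<noteq> {}" and D: "D > 0"
      "\<And>t. cmod ((\<Sum>p\<in>A. iexp (t * X p)) / card A - exp (- t\<^sup>2 / 2)) \<le> D * \<bar>t\<bar>"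
    have s: "sqrt D > 0" using D by simp
    have "\<bar>real (card {p\<in>A. X p \<le> x}) / card A - Phi x\<bar> \<le> C * ((D / sqrt D + sqrt D) + sqrt D)"
      by (rule C(2)[OF A s smoothed_cdf_bound[OF A s D(2)]])
    also have "D / sqrt D = sqrt D" using D by (simp add: real_div_sqrt)
    finally show "\<bar>real (card {p\<in>A. X p \<le> x}) / card A - Phi x\<bar> \<le> 3 * C * sqrt D" by (simp add: algebra_simps)
  qed (use C in auto)
qed

section \<open>The transfer operator of multiplication by \<open>K\<close>\<close>

locale transfer =
  fixes K :: nat and \<theta> :: real
  assumes K2: "K \<ge> 2" and \<theta>: "0 < \<theta>" "\<theta> < 1"
begin

text \<open>The \<open>n\<close>-th iterate of the transfer operator of multiplication by \<open>K\<close>, which averages over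
  the \<open>K ^ n\<close> preimages of a point.\<close>

definition avg :: "nat \<Rightarrow> (real \<Rightarrow> 'a :: real_normed_field) \<Rightarrow> real \<Rightarrow> 'a"
  where "avg n u x = (\<Sum>j<K ^ n. u ((x + real j) / real K ^ n)) / of_nat (K ^ n)"

text \<open>Hoelder continuity of a function of period \<open>1\<close>, with exponent \<open>- ln \<theta> / ln K\<close>. Stating it only
  on the scales \<open>1 / K ^ n\<close> keeps real powers out of the estimates and fits the transfer operator, which
  passes from one scale to the next.\<close>

definition hoelder :: "real \<Rightarrow> (real \<Rightarrow> real) \<Rightarrow> bool"
  where "hoelder A u \<longleftrightarrow> (\<forall>x. u (x + 1) = u x) \<and>
    (\<forall>n x y. \<bar>x - y\<bar> \<le> 1 / real K ^ n \<longrightarrow> \<bar>u x - u y\<bar> \<le> A * \<theta> ^ n)"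

text \<open>For a Hoelder function this is the integral over a period, obtained as a limit of Riemann sums.\<close>

definition mean :: "(real \<Rightarrow> real) \<Rightarrow> real"
  where "mean u = lim (\<lambda>n. avg n u 0)"

definition birkhoff :: "(real \<Rightarrow> real) \<Rightarrow> nat \<Rightarrow> real \<Rightarrow> real"
  where "birkhoff u n x = (\<Sum>i<n. u (real K ^ i * x))"

lemma K_pos [simp]: "real K > 0" "K > 0" "K \<noteq> 0"
  using K2 by auto

lemma avg_1: "avg 1 u x = (\<Sum>i<K. u ((x + real i) / real K)) / of_nat K"
  by (simp add: avg_def)

lemma sum_digits:
  fixes f :: "nat \<Rightarrow> 'a :: comm_monoid_add"
  shows "(\<Sum>l<K * N. f l) = (\<Sum>i<K. \<Sum>j<N. f (i + K * j))"
proof -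
  have "(\<Sum>i<K. \<Sum>j<N. f (i + K * j)) = (\<Sum>(i, j)\<in>{..<K} \<times> {..<N}. f (i + K * j))"
    by (simp add: sum.cartesian_product)
  also have "\<dots> = (\<Sum>l<K * N. f l)"
  proof (rule sum.reindex_bij_witness[where i = "\<lambda>l. (l mod K, l div K)" and j = "\<lambda>(i, j). i + K * j"])
    fix a assume a: "a \<in> {..<K} \<times> {..<N}"
    then obtain i j where ij: "a = (i, j)" "i < K" "j < N" by auto
    have "i + K * j < K * Suc j" using ij by simp
    also have "\<dots> \<le> K * N" using ij by (intro mult_left_mono) auto
    finally show "(case a of (i, j) \<Rightarrow> i + K * j) \<in> {..<K * N}" using ij by simp
  qed (auto simp: less_mult_imp_div_less mult.commute)
  finally show ?thesis by simp
qed

lemma avg_Suc: "avg (Suc n) u x = avg 1 (avg n u) x"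
proof -
  have "((x + real i) / real K + real j) / real K ^ n = (x + real (i + K * j)) / real K ^ Suc n" for i j
    by (simp add: field_simps)
  then have "avg 1 (avg n u) x = (\<Sum>i<K. \<Sum>j<K ^ n. u ((x + real (i + K * j)) / real K ^ Suc n)) / of_nat (K ^ Suc n)"
    unfolding avg_1 unfolding avg_def
    by (simp add: sum_divide_distrib[symmetric] mult.commute del: of_nat_add)
  then show ?thesis unfolding avg_def by (simp add: sum_digits del: of_nat_add of_nat_mult)
qed

lemma avg_add: "avg n (\<lambda>x. u x + v x) x = avg n u x + avg n v x"
  by (simp add: avg_def sum.distrib add_divide_distrib)

lemma avg_diff: "avg n (\<lambda>x. u x - v x) x = avg n u x - avg n v x"
  by (simp add: avg_def sum_subtractf diff_divide_distrib)

lemma avg_cmult: "avg n (\<lambda>x. c * u x) x = c * avg n u x"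
  by (simp add: avg_def sum_distrib_left)

lemma avg_const [simp]: "avg n (\<lambda>x. c) x = c"
  by (simp add: avg_def)

lemma norm_avg_le:
  assumes "\<And>x. norm (u x) \<le> B"
  shows "norm (avg n u x) \<le> B"
proof -
  have "norm (\<Sum>j<K ^ n. u ((x + real j) / real K ^ n)) \<le> (\<Sum>j<K ^ n. B)"
    by (intro sum_norm_le) (use assms in auto)
  then show ?thesis by (simp add: avg_def norm_divide norm_power field_simps)
qed

lemma avg_mono:
  fixes u v :: "real \<Rightarrow> real"
  assumes "\<And>x. u x \<le> v x"
  shows "avg n u x \<le> avg n v x"
  unfolding avg_def by (intro divide_right_mono sum_mono assms) auto

lemma geometric_null: "(\<lambda>n. A * \<theta> ^ n) \<longlonglongrightarrow> 0"
  using \<theta> by (intro tendsto_mult_right_zero LIMSEQ_power_zero) auto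

lemma geometric_small:
  assumes "e > 0" obtains n where "A * \<theta> ^ n < e"
  using eventually_happens'[OF sequentially_bot order_tendstoD(2)[OF geometric_null assms]] by blast

lemma le_geometric_imp_nonpos:
  assumes "\<And>n. x \<le> A * \<theta> ^ n" shows "x \<le> 0"
  by (rule LIMSEQ_le_const[OF geometric_null]) (use assms in blast)

lemma hoelder_periodic_int:
  assumes "hoelder A u"
  shows "u (x + of_int k) = u x"
  using assms by (intro periodic_plus_int) (simp add: hoelder_def)

lemma hoelder_periodic_nat: "hoelder A u \<Longrightarrow> u (x + real k) = u x"
  using hoelder_periodic_int[of A u x "int k"] by simp

lemma hoelder_modulus: "hoelder A u \<Longrightarrow> \<bar>x - y\<bar> \<le> 1 / real K ^ n \<Longrightarrow> \<bar>u x - u y\<bar> \<le> A * \<theta> ^ n"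
  by (simp add: hoelder_def)

lemma hoelder_osc:
  assumes "hoelder A u"
  shows "\<bar>u x - u y\<bar> \<le> A"
proof -
  have "u x = u (frac x)" "u y = u (frac y)"
    using hoelder_periodic_int[OF assms, of "frac x" "\<lfloor>x\<rfloor>"] hoelder_periodic_int[OF assms, of "frac y" "\<lfloor>y\<rfloor>"]
    by (simp_all add: frac_def)
  moreover have "\<bar>frac x - frac y\<bar> \<le> 1"
    using frac_ge_0[of x] frac_ge_0[of y] frac_lt_1[of x] frac_lt_1[of y] by linarith
  ultimately show ?thesis using hoelder_modulus[OF assms, of "frac x" "frac y" 0] by simp
qed

lemma hoelder_nonneg: "hoelder A u \<Longrightarrow> A \<ge> 0"
  using hoelder_osc[of A u 0 0] by simp

lemma hoelder_bounded: "hoelder A u \<Longrightarrow> \<bar>u x\<bar> \<le> \<bar>u 0\<bar> + A"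
  using hoelder_osc[of A u x 0] by linarith

lemma hoelder_mono: "hoelder A u \<Longrightarrow> A \<le> B \<Longrightarrow> hoelder B u"
  unfolding hoelder_def using \<theta> by (meson mult_right_mono order_trans zero_le_power less_imp_le)

lemma hoelder_continuous:
  assumes "hoelder A u" shows "continuous_on UNIV u" unfolding continuous_on_iff dist_real_def
proof (intro ballI allI impI)
  fix x e :: real assume "e > 0"
  then obtain k where k: "A * \<theta> ^ k < e" by (rule geometric_small)
  show "\<exists>d>0. \<forall>y\<in>UNIV. \<bar>y - x\<bar> < d \<longrightarrow> \<bar>u y - u x\<bar> < e"
  proof (intro exI[of _ "1 / real K ^ k"] conjI ballI impI)
    fix y assume "\<bar>y - x\<bar> < 1 / real K ^ k"
    then have "\<bar>u y - u x\<bar> \<le> A * \<theta> ^ k" by (intro hoelder_modulus[OF assms]) simp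
    then show "\<bar>u y - u x\<bar> < e" using k by linarith
  qed simp
qed

lemma hoelder_add:
  assumes "hoelder A u" "hoelder B v" shows "hoelder (A + B) (\<lambda>x. u x + v x)"
  unfolding hoelder_def
proof (intro conjI allI impI)
  fix n x y assume "\<bar>x - y\<bar> \<le> 1 / real K ^ n"
  then show "\<bar>u x + v x - (u y + v y)\<bar> \<le> (A + B) * \<theta> ^ n"
    using hoelder_modulus[OF assms(1), of x y n] hoelder_modulus[OF assms(2), of x y n] by (simp add: distrib_right)
qed (use assms in \<open>auto simp: hoelder_def\<close>)

lemma hoelder_cmult:
  assumes "hoelder A u" shows "hoelder (\<bar>c\<bar> * A) (\<lambda>x. c * u x)" unfolding hoelder_def
proof (intro conjI allI impI)
  fix n x y assume "\<bar>x - y\<bar> \<le> 1 / real K ^ n"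
  then have "\<bar>c\<bar> * \<bar>u x - u y\<bar> \<le> \<bar>c\<bar> * (A * \<theta> ^ n)"
    using hoelder_modulus[OF assms] by (intro mult_left_mono) auto
  then show "\<bar>c * u x - c * u y\<bar> \<le> \<bar>c\<bar> * A * \<theta> ^ n"
    by (simp add: abs_mult[symmetric] right_diff_distrib mult.assoc)
qed (use assms in \<open>auto simp: hoelder_def\<close>)

lemma hoelder_const: "hoelder 0 (\<lambda>x. c)"
  by (simp add: hoelder_def)

lemma hoelder_square:
  assumes "hoelder A u" shows "hoelder (2 * (\<bar>u 0\<bar> + A) * A) (\<lambda>x. (u x)\<^sup>2)"
  unfolding hoelder_def
proof (intro conjI allI impI)
  fix n x y assume "\<bar>x - y\<bar> \<le> 1 / real K ^ n"
  then have d: "\<bar>u x - u y\<bar> \<le> A * \<theta> ^ n" using hoelder_modulus[OF assms] by auto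
  have "\<bar>u x + u y\<bar> \<le> 2 * (\<bar>u 0\<bar> + A)" using hoelder_bounded[OF assms, of x] hoelder_bounded[OF assms, of y] abs_triangle_ineq[of "u x" "u y"] by argo
  with d have "\<bar>u x + u y\<bar> * \<bar>u x - u y\<bar> \<le> 2 * (\<bar>u 0\<bar> + A) * (A * \<theta> ^ n)"
    using hoelder_nonneg[OF assms] by (intro mult_mono) auto
  moreover have "(u x)\<^sup>2 - (u y)\<^sup>2 = (u x + u y) * (u x - u y)" by (simp add: power2_eq_square algebra_simps)
  ultimately show "\<bar>(u x)\<^sup>2 - (u y)\<^sup>2\<bar> \<le> 2 * (\<bar>u 0\<bar> + A) * A * \<theta> ^ n" by (simp add: abs_mult)
qed (use assms in \<open>auto simp: hoelder_def\<close>)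

lemma hoelder_comp_mult:
  assumes "hoelder A u" shows "hoelder (A / \<theta>) (\<lambda>x. u (real K * x))"
  unfolding hoelder_def
proof (intro conjI allI impI)
  fix n x y assume xy: "\<bar>x - y\<bar> \<le> 1 / real K ^ n"
  show "\<bar>u (real K * x) - u (real K * y)\<bar> \<le> A / \<theta> * \<theta> ^ n"
  proof (cases n)
    case 0
    have "A \<le> A / \<theta>" using \<theta> hoelder_nonneg[OF assms] by (simp add: field_simps mult_left_le)
    then show ?thesis using hoelder_osc[OF assms, of "real K * x" "real K * y"] 0 by simp
  next
    case (Suc k)
    have "\<bar>real K * x - real K * y\<bar> = real K * \<bar>x - y\<bar>" by (simp add: abs_mult flip: right_diff_distrib)
    also have "\<dots> \<le> real K * (1 / real K ^ n)" using xy by (intro mult_left_mono) auto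
    also have "\<dots> = 1 / real K ^ k" using Suc by simp
    finally show ?thesis using hoelder_modulus[OF assms, of "real K * x" "real K * y" k] Suc \<theta> by simp
  qed
next
  fix x show "u (real K * (x + 1)) = u (real K * x)"
    using hoelder_periodic_nat[OF assms, of "real K * x" K] by (simp add: algebra_simps)
qed

text \<open>The preimages of nearby points are closer by the factor \<open>1 / K\<close>; this is the exponential
  contraction from which everything else in this section follows.\<close>

lemma hoelder_avg:
  assumes "hoelder A u" shows "hoelder (A * \<theta> ^ n) (avg n u)" unfolding hoelder_def
proof (intro conjI allI impI)
  fix k x y assume xy: "\<bar>x - y\<bar> \<le> 1 / real K ^ k"
  have "avg n u x - avg n u y = (\<Sum>j<K ^ n. u ((x + real j) / real K ^ n) - u ((y + real j) / real K ^ n)) / of_nat (K ^ n)"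
    by (simp add: avg_def sum_subtractf diff_divide_distrib)
  moreover have "\<bar>\<Sum>j<K ^ n. u ((x + real j) / real K ^ n) - u ((y + real j) / real K ^ n)\<bar> \<le> (\<Sum>j<K ^ n. A * \<theta> ^ (n + k))"
  proof (rule order_trans[OF sum_abs sum_mono])
    fix j
    have "\<bar>(x + real j) / real K ^ n - (y + real j) / real K ^ n\<bar> = \<bar>x - y\<bar> / real K ^ n"
      by (simp add: abs_divide diff_divide_distrib[symmetric])
    also have "\<dots> \<le> (1 / real K ^ k) / real K ^ n" using xy by (intro divide_right_mono) auto
    finally have "\<bar>(x + real j) / real K ^ n - (y + real j) / real K ^ n\<bar> \<le> 1 / real K ^ (n + k)"
      by (simp add: power_add mult.commute)
    then show "\<bar>u ((x + real j) / real K ^ n) - u ((y + real j) / real K ^ n)\<bar> \<le> A * \<theta> ^ (n + k)"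
      by (rule hoelder_modulus[OF assms])
  qed
  ultimately show "\<bar>avg n u x - avg n u y\<bar> \<le> A * \<theta> ^ n * \<theta> ^ k"
    by (simp only: abs_divide) (simp add: divide_le_eq power_add mult.assoc mult.commute mult.left_commute)
next
  fix x
  define f where "f j = u ((x + real j) / real K ^ n)" for j
  have "(\<Sum>j<K ^ n. f (Suc j)) = (\<Sum>j<K ^ n. f j) + f (K ^ n) - f 0"
    by (metis add_diff_cancel_left' sum.lessThan_Suc sum.lessThan_Suc_shift)
  moreover have "f (K ^ n) = f 0"
    using hoelder_periodic_nat[OF assms, of "x / real K ^ n" 1] by (simp add: f_def add_divide_distrib)
  moreover have "u ((x + 1 + real j) / real K ^ n) = f (Suc j)" for j by (simp add: f_def ac_simps)
  ultimately show "avg n u (x + 1) = avg n u x" by (simp add: avg_def f_def)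
qed

lemma avg_near:
  assumes "hoelder A u" shows "\<bar>avg (n + m) u x - avg n u y\<bar> \<le> A * \<theta> ^ n"
proof (induction m arbitrary: x)
  case 0
  then show ?case using hoelder_osc[OF hoelder_avg[OF assms]] by simp
next
  case (Suc m)
  have "avg (n + Suc m) u x - avg n u y = avg 1 (\<lambda>x. avg (n + m) u x - avg n u y) x"
    unfolding avg_diff avg_const add_Suc_right by (subst avg_Suc) simp
  then show ?case using norm_avg_le[of "\<lambda>x. avg (n + m) u x - avg n u y" "A * \<theta> ^ n" 1 x] Suc.IH by simp
qed

lemma avg_mean:
  assumes u: "hoelder A u" shows "\<bar>avg n u x - mean u\<bar> \<le> A * \<theta> ^ n"
proof -
  have "Cauchy (\<lambda>n. avg n u 0)"
  proof (rule CauchyI')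
    fix e :: real assume "e > 0"
    then have "\<forall>\<^sub>F n in sequentially. A * \<theta> ^ n < e" by (rule order_tendstoD(2)[OF geometric_null])
    then obtain N where N: "A * \<theta> ^ n < e" if "n \<ge> N" for n by (auto simp: eventually_sequentially)
    have "dist (avg m u 0) (avg n u 0) < e" if "m \<ge> N" "n > m" for m n
      using avg_near[OF u, of m "n - m" 0 0] N[OF that(1)] that by (simp add: dist_real_def)
    then show "\<exists>M. \<forall>m\<ge>M. \<forall>n>m. dist (avg m u 0) (avg n u 0) < e" by blast
  qed
  then have lim: "(\<lambda>n. avg n u 0) \<longlonglongrightarrow> mean u"
    unfolding mean_def using Cauchy_convergent convergent_LIMSEQ_iff by blast
  have "(\<lambda>m. \<bar>avg n u x - avg (n + m) u 0\<bar>) \<longlonglongrightarrow> \<bar>avg n u x - mean u\<bar>"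
    by (intro tendsto_intros) (use LIMSEQ_ignore_initial_segment[OF lim, of n] in \<open>simp add: add.commute\<close>)
  then show ?thesis
    by (rule LIMSEQ_le_const2) (use avg_near[OF u, of n _ 0 x] in \<open>auto simp: abs_minus_commute\<close>)
qed

lemma mean_nonneg:
  assumes u: "hoelder A u" and "\<And>x. 0 \<le> u x"
  shows "0 \<le> mean u"
proof -
  have "0 \<le> avg n u 0" for n using assms(2) by (simp add: avg_def sum_nonneg)
  then have "- mean u \<le> A * \<theta> ^ n" for n using avg_mean[OF u, of n 0] by (smt (verit))
  then show ?thesis using le_geometric_imp_nonpos[of "- mean u" A] by simp
qed

text \<open>The solution of the Poisson equation is the sum of \<open>avg n u x - mean u\<close> over \<open>n \<ge> 1\<close>.\<close>

lemma poisson: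
  assumes u: "hoelder A u"
  obtains g where "hoelder (A * \<theta> / (1 - \<theta>)) g" "\<And>x. avg 1 g x = g x - (avg 1 u x - mean u)"
proof -
  define a where "a n x = avg (Suc n) u x - mean u" for n x
  have ab: "norm (a n x) \<le> A * \<theta> * \<theta> ^ n" for n x
    using avg_mean[OF u, of "Suc n" x] by (simp add: a_def mult.assoc)
  have geo: "summable (\<lambda>n. A * \<theta> * \<theta> ^ n)" "(\<Sum>n. A * \<theta> * \<theta> ^ n) = A * \<theta> / (1 - \<theta>)"
    using \<theta> by (auto simp: suminf_mult summable_geometric suminf_geometric)
  have sa: "summable (\<lambda>n. a n x)" for x by (rule summable_comparison_test'[OF geo(1) ab])
  define g where "g x = (\<Sum>n. a n x)" for x
  have "hoelder (A * \<theta> / (1 - \<theta>)) g" unfolding hoelder_def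
  proof (intro conjI allI impI)
    fix x show "g (x + 1) = g x" using hoelder_avg[OF u] by (simp add: g_def a_def hoelder_def)
  next
    fix k x y assume xy: "\<bar>x - y\<bar> \<le> 1 / real K ^ k"
    have b: "norm (a n x - a n y) \<le> A * \<theta> * \<theta> ^ n * \<theta> ^ k" for n
      using hoelder_modulus[OF hoelder_avg[OF u] xy, of "Suc n"] by (simp add: a_def mult.assoc)
    have s: "summable (\<lambda>n. A * \<theta> * \<theta> ^ n * \<theta> ^ k)" using geo(1) by (rule summable_mult2)
    have "g x - g y = (\<Sum>n. a n x - a n y)" unfolding g_def by (rule suminf_diff[OF sa sa])
    also have "norm \<dots> \<le> (\<Sum>n. A * \<theta> * \<theta> ^ n * \<theta> ^ k)"
      by (rule norm_suminf_le[OF b s])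
    also have "\<dots> = A * \<theta> / (1 - \<theta>) * \<theta> ^ k" using suminf_mult2[OF geo(1)] geo(2) by simp
    finally show "\<bar>g x - g y\<bar> \<le> A * \<theta> / (1 - \<theta>) * \<theta> ^ k" by simp
  qed
  moreover have "avg 1 g x = g x - (avg 1 u x - mean u)" for x
  proof -
    have "avg 1 g x = (\<Sum>n. avg 1 (a n) x)"
      unfolding avg_1 g_def by (simp add: suminf_sum sa suminf_divide summable_sum)
    also have "(\<lambda>n. avg 1 (a n) x) = (\<lambda>n. a (Suc n) x)"
      unfolding a_def by (simp only: avg_diff avg_const avg_Suc[of "Suc _" u])
    also have "(\<Sum>n. a (Suc n) x) = g x - a 0 x" unfolding g_def by (rule suminf_split_head[OF sa])
    finally show ?thesis by (simp add: a_def)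
  qed
  ultimately show thesis by (rule that)
qed

lemma avg_1_comp_mult:
  assumes "hoelder A g" shows "avg 1 (\<lambda>x. g (real K * x)) x = g x"
  unfolding avg_1 using hoelder_periodic_nat[OF assms, of x] by simp

text \<open>Gordin's decomposition. That \<open>avg 1 m\<close> vanishes says that the values of \<open>m\<close> along an orbit form a
  reversed martingale difference sequence.\<close>

lemma martingale_decomposition:
  assumes u: "hoelder A u"
  obtains B m g where "hoelder B m" "hoelder B g" "\<And>x. avg 1 m x = 0" "\<And>x. m x = u x - mean u + g x - g (real K * x)"
proof -
  from poisson[OF u] obtain g where g: "hoelder (A * \<theta> / (1 - \<theta>)) g" "\<And>x. avg 1 g x = g x - (avg 1 u x - mean u)" by blast
  let ?B = "A * \<theta> / (1 - \<theta>)"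
  define m where "m x = u x - mean u + g x - g (real K * x)" for x
  have "hoelder (((A + 0) + ?B) + \<bar>-1\<bar> * (?B / \<theta>)) (\<lambda>x. ((u x + - mean u) + g x) + -1 * g (real K * x))"
    by (intro hoelder_add hoelder_cmult hoelder_comp_mult u g hoelder_const)
  then obtain B' where "hoelder B' m" unfolding m_def by auto
  moreover have "avg 1 m x = 0" for x
    unfolding m_def by (simp only: avg_add avg_diff avg_const g avg_1_comp_mult[OF g(1)])
  ultimately show thesis
    using that[of "max B' ?B" m g] g(1) hoelder_mono by (metis m_def max.cobounded1 max.cobounded2)
qed

text \<open>Among the preimages of any point some is close to \<open>x\<close>, so a positive value \<open>v x\<close> would bound
  the averages of \<open>v\<close> away from zero.\<close>

lemma mean_zero_imp_zero:
  assumes v: "hoelder A v" "\<And>x. v x \<ge> 0" and "mean v = 0"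
  shows "v x = 0"
proof (rule ccontr)
  assume "v x \<noteq> 0"
  with v(2)[of x] have d: "v x > 0" by simp
  then obtain k where k: "A * \<theta> ^ k < v x / 2" using geometric_small[of "v x / 2"] by auto
  have low: "v x / 2 / real (K ^ k) \<le> avg k v y" for y
  proof -
    \<comment> \<open>the preimage of \<open>y\<close> closest to \<open>x\<close> from the left has index \<open>q\<close>, up to a multiple of \<open>K ^ n\<close>\<close>
    define q where "q = \<lfloor>real K ^ k * x - y\<rfloor>"
    define j where "j = nat (q mod int (K ^ k))"
    have j: "j < K ^ k" unfolding j_def
      by (metis K_pos(2) nat_less_iff of_nat_0_less_iff pos_mod_bound pos_mod_sign zero_less_power)
    have jq: "real_of_int q = real j + real K ^ k * of_int (q div int (K ^ k))"
    proof -
      have "q = int j + int (K ^ k) * (q div int (K ^ k))" unfolding j_def by simp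
      then have "real_of_int q = of_int (int j + int (K ^ k) * (q div int (K ^ k)))" by presburger
      then show ?thesis by simp
    qed
    have "(y + real_of_int q) / real K ^ k = (y + real j) / real K ^ k + of_int (q div int (K ^ k))"
      unfolding jq by (simp add: field_simps)
    then have e: "v ((y + real_of_int q) / real K ^ k) = v ((y + real j) / real K ^ k)"
      using hoelder_periodic_int[OF v(1)] by metis
    have "real_of_int q \<le> real K ^ k * x - y" "real K ^ k * x - y < real_of_int q + 1" unfolding q_def by linarith+
    then have "\<bar>(y + real_of_int q) / real K ^ k - x\<bar> \<le> 1 / real K ^ k"
    proof -
      have "(y + real_of_int q) / real K ^ k - x = (y + real_of_int q - real K ^ k * x) / real K ^ k"
        by (simp add: field_simps)
      moreover have "\<bar>y + real_of_int q - real K ^ k * x\<bar> \<le> 1"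
        using \<open>real_of_int q \<le> _\<close> \<open>_ < real_of_int q + 1\<close> by linarith
      ultimately show ?thesis by (simp add: abs_divide divide_right_mono)
    qed
    from hoelder_modulus[OF v(1) this] k e have "v ((y + real j) / real K ^ k) \<ge> v x / 2" by linarith
    also have "v ((y + real j) / real K ^ k) \<le> (\<Sum>j<K ^ k. v ((y + real j) / real K ^ k))"
      using j v(2) by (intro member_le_sum) auto
    finally show ?thesis unfolding avg_def by (intro divide_right_mono) auto
  qed
  let ?e = "v x / 2 / real (K ^ k)"
  have "?e \<le> avg (k + l) v y" for l y
  proof (induction l arbitrary: y)
    case (Suc l)
    have "avg 1 (\<lambda>_. ?e) y \<le> avg 1 (avg (k + l) v) y" by (rule avg_mono) (rule Suc)
    then show ?case unfolding add_Suc_right by (subst avg_Suc) simp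
  qed (use low in simp)
  moreover have "?e > 0" using d by simp
  then obtain l where "A * \<theta> ^ k * \<theta> ^ l < ?e" using geometric_small[of ?e "A * \<theta> ^ k"] by blast
  then have "A * \<theta> ^ (k + l) < ?e" by (simp add: power_add mult.assoc)
  ultimately show False using avg_mean[OF v(1), of "k + l" 0] \<open>mean v = 0\<close> by (smt (verit))
qed

text \<open>The iterates of the transfer operator with weight \<open>exp (\<i> * t * m)\<close>, applied to the
  constant \<open>1\<close>. At \<open>0\<close> they are the characteristic functions of the Birkhoff sums of \<open>m\<close> over the
  points \<open>j / K ^ n\<close>.\<close>

primrec twist :: "(real \<Rightarrow> real) \<Rightarrow> real \<Rightarrow> nat \<Rightarrow> real \<Rightarrow> complex"
  where "twist m t 0 x = 1"
  | "twist m t (Suc n) x = avg 1 (\<lambda>z. iexp (t * m z) * twist m t n z) x"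

lemma birkhoff_Suc: "birkhoff m (Suc n) x = birkhoff m n x + m (real K ^ n * x)"
  by (simp add: birkhoff_def)

lemma twist_eq:
  assumes m: "hoelder B m"
  shows "twist m t n x = avg n (\<lambda>z. iexp (t * birkhoff m n z)) x"
proof (induction n arbitrary: x)
  case (Suc n)
  have *: "avg n (\<lambda>z. iexp (t * birkhoff m (Suc n) z)) y = iexp (t * m y) * avg n (\<lambda>z. iexp (t * birkhoff m n z)) y" for y
  proof -
    have "m (real K ^ n * ((y + real j) / real K ^ n)) = m y" for j
      using hoelder_periodic_nat[OF m, of y j] by simp
    then show ?thesis
      by (simp add: avg_def birkhoff_Suc distrib_left exp_add sum_distrib_left mult.commute)
  qed
  have "twist m t (Suc n) x = avg 1 (\<lambda>z. iexp (t * m z) * avg n (\<lambda>z. iexp (t * birkhoff m n z)) z) x"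
    by (simp add: Suc.IH)
  also have "\<dots> = avg 1 (avg n (\<lambda>z. iexp (t * birkhoff m (Suc n) z))) x"
    unfolding ext[of "avg n (\<lambda>z. iexp (t * birkhoff m (Suc n) z))", OF *] ..
  finally show ?case by (simp only: avg_Suc)
qed (simp add: birkhoff_def)

lemma power_exp_diff:
  fixes z :: real
  assumes z: "0 \<le> z" "z \<le> 1"
  shows "\<bar>(1 - z) ^ n - exp (- real n * z)\<bar> \<le> z"
proof (induction n)
  case (Suc n)
  have e1: "1 - z \<le> exp (- z)" using exp_ge_add_one_self[of "- z"] by simp
  have "exp (- z) * (1 + z) \<le> exp (- z) * exp z" by (intro mult_left_mono exp_ge_add_one_self) auto
  then have "exp (- z) * (1 + z) \<le> 1" by (simp add: exp_minus)
  moreover have "1 \<le> (1 - z + z\<^sup>2) * (1 + z)" using z by (simp add: power2_eq_square algebra_simps)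
  ultimately have "exp (- z) * (1 + z) \<le> (1 - z + z\<^sup>2) * (1 + z)" by linarith
  then have e2: "exp (- z) \<le> 1 - z + z\<^sup>2" by (rule mult_right_le_imp_le) (use z in auto)
  have "exp (- real (Suc n) * z) = exp (- real n * z) * exp (- z)"
    by (simp add: exp_add[symmetric] algebra_simps)
  then have "(1 - z) ^ Suc n - exp (- real (Suc n) * z)
      = (1 - z) * ((1 - z) ^ n - exp (- real n * z)) - exp (- real n * z) * (exp (- z) - (1 - z))"
    by (simp add: algebra_simps)
  also have "\<bar>\<dots>\<bar> \<le> \<bar>(1 - z) * ((1 - z) ^ n - exp (- real n * z))\<bar> + \<bar>exp (- real n * z) * (exp (- z) - (1 - z))\<bar>"
    by (rule abs_triangle_ineq4)
  also have "\<bar>(1 - z) * ((1 - z) ^ n - exp (- real n * z))\<bar> \<le> (1 - z) * z"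
    unfolding abs_mult using z Suc by (intro mult_mono) auto
  also have "\<bar>exp (- real n * z) * (exp (- z) - (1 - z))\<bar> \<le> 1 * z\<^sup>2"
    unfolding abs_mult using z e1 e2 by (intro mult_mono) auto
  finally show ?case by (simp add: power2_eq_square algebra_simps)
qed (use z in auto)

lemma iexp_taylor2: "cmod (iexp x - (1 + \<i> * x - x\<^sup>2 / 2)) \<le> \<bar>x\<bar> ^ 3 / 6"
  using iexp_approx1[of x 2] by (simp add: eval_nat_numeral power2_eq_square algebra_simps)

lemma iexp_taylor0: "cmod (iexp x - 1) \<le> \<bar>x\<bar>"
  using iexp_approx1[of x 0] by simp

text \<open>In the expansion in powers of \<open>t\<close> the linear term vanishes because \<open>avg 1 m\<close> does, and the
  equation for \<open>u\<close> is what makes the quadratic terms agree.\<close>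

lemma twisted_eigen:
  assumes M: "\<And>x. \<bar>m x\<bar> \<le> M" and U: "\<And>x. \<bar>u x\<bar> \<le> U" and m0: "\<And>x. avg 1 m x = 0"
    and u: "\<And>x. avg 1 u x = u x + (avg 1 (\<lambda>x. (m x)\<^sup>2) x - c) / 2" and c: "c \<ge> 0" and t: "\<bar>t\<bar> \<le> 1"
  shows "cmod (avg 1 (\<lambda>z. iexp (t * m z) * of_real (1 + t\<^sup>2 * u z)) x - of_real ((1 - t\<^sup>2 * c / 2) * (1 + t\<^sup>2 * u x)))
    \<le> (M ^ 3 / 6 + M * U + c * U / 2) * \<bar>t\<bar> ^ 3"
proof -
  have M0: "M \<ge> 0" using M[of 0] by linarith
  have U0: "U \<ge> 0" using U[of 0] by linarith
  define p where "p z = 1 + \<i> * of_real (t * m z) - of_real ((t * m z)\<^sup>2 / 2) + of_real (t\<^sup>2 * u z)" for z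
  define e where "e z = iexp (t * m z) * of_real (1 + t\<^sup>2 * u z) - p z" for z
  have e: "cmod (e z) \<le> (M ^ 3 / 6 + M * U) * \<bar>t\<bar> ^ 3" for z
  proof -
    have "e z = (iexp (t * m z) - (1 + \<i> * (t * m z) - (t * m z)\<^sup>2 / 2)) + (iexp (t * m z) - 1) * of_real (t\<^sup>2 * u z)"
      by (simp add: e_def p_def algebra_simps)
    also have "cmod \<dots> \<le> cmod (iexp (t * m z) - (1 + \<i> * (t * m z) - (t * m z)\<^sup>2 / 2)) + cmod (iexp (t * m z) - 1) * (t\<^sup>2 * \<bar>u z\<bar>)"
      by (rule order_trans[OF norm_triangle_ineq]) (simp add: norm_mult norm_power)
    also have "\<dots> \<le> \<bar>t * m z\<bar> ^ 3 / 6 + \<bar>t * m z\<bar> * (t\<^sup>2 * \<bar>u z\<bar>)"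
      using iexp_taylor2[of "t * m z"] iexp_taylor0[of "t * m z"]
      by (intro add_mono mult_right_mono) auto
    also have "\<dots> \<le> (\<bar>t\<bar> * M) ^ 3 / 6 + \<bar>t\<bar> * M * (t\<^sup>2 * U)"
    proof -
      have "\<bar>t * m z\<bar> \<le> \<bar>t\<bar> * M" unfolding abs_mult by (intro mult_left_mono M) auto
      moreover have "0 \<le> \<bar>t\<bar> * M" using M0 by simp
      moreover have "t\<^sup>2 * \<bar>u z\<bar> \<le> t\<^sup>2 * U" using U by (intro mult_left_mono) auto
      ultimately show ?thesis by (intro add_mono divide_right_mono power_mono mult_mono[of "\<bar>t * m z\<bar>" "\<bar>t\<bar> * M"]) auto
    qed
    also have "\<dots> = (M ^ 3 / 6 + M * U) * \<bar>t\<bar> ^ 3"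
      by (simp add: power_mult_distrib algebra_simps power3_eq_cube power2_eq_square)
    finally show ?thesis .
  qed
  have ap: "avg 1 p x = of_real (1 + t\<^sup>2 * (u x - c / 2))"
  proof -
    have "avg 1 p x = 1 + \<i> * of_real (t * avg 1 m x) + of_real (t\<^sup>2 * avg 1 u x - t\<^sup>2 / 2 * avg 1 (\<lambda>x. (m x)\<^sup>2) x)"
      unfolding p_def avg_def
      by (simp add: sum.distrib sum_subtractf add_divide_distrib diff_divide_distrib sum_distrib_left sum_divide_distrib
          power_mult_distrib mult.assoc)
    moreover have "t\<^sup>2 * avg 1 u x - t\<^sup>2 / 2 * avg 1 (\<lambda>x. (m x)\<^sup>2) x = t\<^sup>2 * (u x - c / 2)"
      unfolding u by (simp add: field_simps)
    ultimately show ?thesis by (simp only: m0) simp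
  qed
  have "avg 1 (\<lambda>z. iexp (t * m z) * of_real (1 + t\<^sup>2 * u z)) x = avg 1 (\<lambda>z. p z + e z) x"
    by (simp add: e_def)
  also have "\<dots> = of_real (1 + t\<^sup>2 * (u x - c / 2)) + avg 1 e x" by (simp only: avg_add ap)
  finally have l: "avg 1 (\<lambda>z. iexp (t * m z) * of_real (1 + t\<^sup>2 * u z)) x = complex_of_real (1 + t\<^sup>2 * (u x - c / 2)) + avg 1 e x" .
  have "avg 1 (\<lambda>z. iexp (t * m z) * of_real (1 + t\<^sup>2 * u z)) x - of_real ((1 - t\<^sup>2 * c / 2) * (1 + t\<^sup>2 * u x))
     = avg 1 e x + of_real (t ^ 4 * c * u x / 2)"
  proof -
    have "1 + t\<^sup>2 * (u x - c / 2) - (1 - t\<^sup>2 * c / 2) * (1 + t\<^sup>2 * u x) = t ^ 4 * c * u x / 2"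
      by (simp add: field_simps eval_nat_numeral)
    then have "complex_of_real (1 + t\<^sup>2 * (u x - c / 2)) - of_real ((1 - t\<^sup>2 * c / 2) * (1 + t\<^sup>2 * u x)) = of_real (t ^ 4 * c * u x / 2)"
      by (simp only: of_real_diff[symmetric])
    then show ?thesis unfolding l add.commute[of _ "avg 1 e x"] add_diff_eq[symmetric] by (simp only:)
  qed
  also have "cmod \<dots> \<le> cmod (avg 1 e x) + \<bar>t ^ 4 * c * u x / 2\<bar>"
    by (rule order_trans[OF norm_triangle_ineq]) (simp only: norm_of_real order_refl)
  also have "cmod (avg 1 e x) \<le> (M ^ 3 / 6 + M * U) * \<bar>t\<bar> ^ 3" by (rule norm_avg_le[OF e])
  also have "\<bar>t ^ 4 * c * u x / 2\<bar> = \<bar>t\<bar> ^ 3 * (\<bar>t\<bar> * (c * \<bar>u x\<bar>)) / 2"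
    using c by (simp add: abs_mult power_abs eval_nat_numeral)
  also have "\<dots> \<le> \<bar>t\<bar> ^ 3 * (1 * (c * U)) / 2"
    using t c U U0 by (intro divide_right_mono mult_left_mono mult_mono) auto
  finally show ?thesis by (simp add: algebra_simps)
qed

text \<open>Each iteration contributes an error of order \<open>\<bar>t\<bar> ^ 3\<close> times a power of the eigenvalue. The sum of
  these powers is at most \<open>2 / (t\<^sup>2 * c)\<close>, so the total error is of order \<open>\<bar>t\<bar>\<close> uniformly in \<open>n\<close>. The
  bound on \<open>t\<close> keeps the eigenvalue between \<open>0\<close> and \<open>1\<close>.\<close>

lemma twist_approx:
  assumes M: "\<And>x. \<bar>m x\<bar> \<le> M" and U: "\<And>x. \<bar>u x\<bar> \<le> U" and m0: "\<And>x. avg 1 m x = 0"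
    and u: "\<And>x. avg 1 u x = u x + (avg 1 (\<lambda>x. (m x)\<^sup>2) x - c) / 2" and c: "c > 0" and t: "\<bar>t\<bar> \<le> 1 / (1 + c)"
  shows "cmod (twist m t n x - exp (- real n * (t\<^sup>2 * c / 2))) \<le> (2 * U + 2 * (M ^ 3 / 6 + M * U + c * U / 2) / c + 1) * \<bar>t\<bar>"
proof (cases "t = 0")
  case True
  have "twist m 0 n x = 1" for n x by (induction n arbitrary: x) auto
  then show ?thesis using True by simp
next
  case False
  define C where "C = M ^ 3 / 6 + M * U + c * U / 2"
  have M0: "M \<ge> 0" using M[of 0] by linarith
  have U0: "U \<ge> 0" using U[of 0] by linarith
  have C0: "C \<ge> 0" using M0 U0 c by (simp add: C_def)
  have t1: "\<bar>t\<bar> \<le> 1" using t c by (smt (verit) divide_le_eq_1)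
  have tc: "\<bar>t\<bar> * c \<le> 1"
  proof -
    have "\<bar>t\<bar> * c \<le> 1 / (1 + c) * c" using t c by (intro mult_right_mono) auto
    also have "\<dots> \<le> 1" using c by simp
    finally show ?thesis .
  qed
  define z where "z = t\<^sup>2 * c / 2"
  have tt: "t\<^sup>2 = \<bar>t\<bar> * \<bar>t\<bar>" by (simp add: power2_eq_square)
  have t2: "t\<^sup>2 \<le> \<bar>t\<bar>" unfolding tt using mult_left_mono[OF t1 abs_ge_zero[of t]] by (simp only: mult_1_right)
  have zt: "z \<le> \<bar>t\<bar> / 2"
  proof -
    have "\<bar>t\<bar> * (\<bar>t\<bar> * c) \<le> \<bar>t\<bar> * 1" using tc by (intro mult_left_mono) auto
    then show ?thesis unfolding z_def tt by simp
  qed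
  have z: "0 < z" "z < 1" using zt t1 c False by (auto simp: z_def)
  define h where "h x = complex_of_real (1 + t\<^sup>2 * u x)" for x
  have tu: "cmod (1 - h x) \<le> t\<^sup>2 * U" for x
  proof -
    have "1 - h x = of_real (- (t\<^sup>2 * u x))" by (simp add: h_def)
    then have "cmod (1 - h x) = t\<^sup>2 * \<bar>u x\<bar>" by (simp only: norm_of_real) (simp add: abs_mult)
    then show ?thesis using U[of x] by (simp add: mult_left_mono)
  qed
  have main: "cmod (twist m t n x - (1 - z) ^ n * h x) \<le> t\<^sup>2 * U + (\<Sum>k<n. (1 - z) ^ k) * (C * \<bar>t\<bar> ^ 3)" for n
  proof (induction n arbitrary: x)
    case 0
    then show ?case using tu[of x] by simp
  next
    case (Suc n)
    let ?A = "avg 1 (\<lambda>y. iexp (t * m y) * (twist m t n y - (1 - z) ^ n * h y)) x"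
    let ?B = "avg 1 (\<lambda>y. iexp (t * m y) * h y) x - of_real ((1 - z) * (1 + t\<^sup>2 * u x))"
    have "avg 1 (\<lambda>y. iexp (t * m y) * (twist m t n y - (1 - z) ^ n * h y)) x
      = twist m t (Suc n) x - (1 - z) ^ n * avg 1 (\<lambda>y. iexp (t * m y) * h y) x"
      unfolding avg_cmult[symmetric] twist.simps avg_diff[symmetric] by (simp add: algebra_simps)
    then have eq: "twist m t (Suc n) x - (1 - z) ^ Suc n * h x = ?A + of_real ((1 - z) ^ n) * ?B"
      by (simp add: h_def algebra_simps)
    then have tri: "cmod (twist m t (Suc n) x - (1 - z) ^ Suc n * h x) \<le> cmod ?A + (1 - z) ^ n * cmod ?B"
    proof -
      have "cmod (complex_of_real ((1 - z) ^ n) * ?B) = (1 - z) ^ n * cmod ?B"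
        unfolding norm_mult norm_of_real using z by simp
      with eq show ?thesis using norm_triangle_ineq[of ?A "of_real ((1 - z) ^ n) * ?B"] by simp
    qed
    have A: "cmod ?A \<le> t\<^sup>2 * U + (\<Sum>k<n. (1 - z) ^ k) * (C * \<bar>t\<bar> ^ 3)"
    proof (rule norm_avg_le)
      fix y
      show "cmod (iexp (t * m y) * (twist m t n y - (1 - z) ^ n * h y)) \<le> t\<^sup>2 * U + (\<Sum>k<n. (1 - z) ^ k) * (C * \<bar>t\<bar> ^ 3)"
        unfolding norm_mult norm_exp_i_times mult_1_left by (rule Suc.IH)
    qed
    have "cmod ?B \<le> C * \<bar>t\<bar> ^ 3"
      unfolding C_def h_def z_def by (rule twisted_eigen[OF M U m0 u less_imp_le[OF c] t1])
    then have B: "(1 - z) ^ n * cmod ?B \<le> (1 - z) ^ n * (C * \<bar>t\<bar> ^ 3)"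
      using z by (intro mult_left_mono) auto
    have S: "t\<^sup>2 * U + (\<Sum>k<Suc n. (1 - z) ^ k) * (C * \<bar>t\<bar> ^ 3)
      = (t\<^sup>2 * U + (\<Sum>k<n. (1 - z) ^ k) * (C * \<bar>t\<bar> ^ 3)) + (1 - z) ^ n * (C * \<bar>t\<bar> ^ 3)"
      by (simp only: sum.lessThan_Suc distrib_right add.assoc)
    show ?case unfolding S by (rule order_trans[OF tri add_mono[OF A B]])
  qed
  have "(\<Sum>k<n. (1 - z) ^ k) \<le> 1 / z"
  proof -
    have "(\<Sum>k<n. (1 - z) ^ k) = (1 - (1 - z) ^ n) / z" using z by (subst sum_gp_strict) auto
    also have "\<dots> \<le> 1 / z" using z by (intro divide_right_mono) auto
    finally show ?thesis .
  qed
  then have "(\<Sum>k<n. (1 - z) ^ k) * (C * \<bar>t\<bar> ^ 3) \<le> 1 / z * (C * \<bar>t\<bar> ^ 3)"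
    using C0 by (intro mult_right_mono) auto
  also have "\<dots> = 2 * C / c * \<bar>t\<bar>"
    using False c by (simp add: z_def tt field_simps power3_eq_cube)
  finally have 1: "cmod (twist m t n x - (1 - z) ^ n * h x) \<le> \<bar>t\<bar> * U + 2 * C / c * \<bar>t\<bar>"
    using main[of n] mult_right_mono[OF t2 U0] by linarith
  have pz: "cmod ((1 - complex_of_real z) ^ n) \<le> 1"
  proof -
    have "cmod (1 - complex_of_real z) = 1 - z"
      using z by (metis abs_of_nonneg diff_ge_0_iff_ge less_imp_le norm_of_real of_real_1 of_real_diff)
    then show ?thesis using z by (simp add: norm_power power_le_one)
  qed
  have "cmod ((1 - z) ^ n * h x - (1 - z) ^ n) = cmod ((1 - complex_of_real z) ^ n) * cmod (1 - h x)"
    by (simp add: norm_mult[symmetric] norm_minus_commute[of 1] right_diff_distrib)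
  also have "\<dots> \<le> 1 * (t\<^sup>2 * U)" using pz tu by (intro mult_mono) auto
  also have "\<dots> \<le> \<bar>t\<bar> * U" using mult_right_mono[OF t2 U0] by simp
  finally have 2: "cmod ((1 - z) ^ n * h x - (1 - z) ^ n) \<le> \<bar>t\<bar> * U" .
  have "cmod (complex_of_real ((1 - z) ^ n - exp (- real n * z))) \<le> z"
    unfolding norm_of_real using power_exp_diff[of z n] z by simp
  then have 3: "cmod ((1 - z) ^ n - exp (- real n * z)) \<le> \<bar>t\<bar>" using zt by simp
  have "cmod (twist m t n x - exp (- real n * z)) \<le> (\<bar>t\<bar> * U + 2 * C / c * \<bar>t\<bar>) + \<bar>t\<bar> * U + \<bar>t\<bar>"
    using norm_triangle_mono[OF norm_triangle_mono[OF 1 2] 3] by (simp add: algebra_simps)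
  then show ?thesis unfolding z_def C_def by (simp add: algebra_simps)
qed

text \<open>For \<open>t\<close> bounded away from zero the bound holds trivially, since the left-hand side is at most \<open>2\<close>.\<close>

lemma martingale_char:
  assumes m: "hoelder B m" and m0: "\<And>x. avg 1 m x = 0" and pos: "mean (\<lambda>x. (m x)\<^sup>2) > 0"
  obtains C where "C > 0" "\<And>t n x. cmod (twist m t n x - exp (- real n * (t\<^sup>2 * mean (\<lambda>x. (m x)\<^sup>2) / 2))) \<le> C * \<bar>t\<bar>"
proof -
  define c where "c = mean (\<lambda>x. (m x)\<^sup>2)"
  from poisson[OF hoelder_square[OF m]] obtain g D where g: "hoelder D g"
    "\<And>x. avg 1 g x = g x - (avg 1 (\<lambda>x. (m x)\<^sup>2) x - c)" unfolding c_def by metis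
  define u where "u x = - g x / 2" for x
  have u: "avg 1 u x = u x + (avg 1 (\<lambda>x. (m x)\<^sup>2) x - c) / 2" for x
    unfolding u_def using avg_cmult[of 1 "-1/2" g x] g(2)[of x] by (simp add: field_simps)
  have U: "\<bar>u x\<bar> \<le> \<bar>g 0\<bar> + D" for x
    using hoelder_bounded[OF g(1), of x] hoelder_nonneg[OF g(1)] unfolding u_def by simp
  have M: "\<bar>m x\<bar> \<le> \<bar>m 0\<bar> + B" for x by (rule hoelder_bounded[OF m])
  define U where "U = \<bar>g 0\<bar> + D"
  define M where "M = \<bar>m 0\<bar> + B"
  have UM: "U \<ge> 0" "M \<ge> 0" using hoelder_nonneg[OF g(1)] hoelder_nonneg[OF m] by (auto simp: U_def M_def)
  define C where "C = 2 * U + 2 * (M ^ 3 / 6 + M * U + c * U / 2) / c + 1"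
  have c: "c > 0" using pos by (simp add: c_def)
  have C: "C > 0" unfolding C_def using UM c by (intro add_nonneg_pos) auto
  have "cmod (twist m t n x - exp (- real n * (t\<^sup>2 * c / 2))) \<le> (C + 2 * (1 + c)) * \<bar>t\<bar>" for t n x
  proof (cases "\<bar>t\<bar> \<le> 1 / (1 + c)")
    case True
    have "cmod (twist m t n x - exp (- real n * (t\<^sup>2 * c / 2))) \<le> C * \<bar>t\<bar>"
      unfolding C_def by (rule twist_approx[OF _ _ m0 u c True]) (use M U in \<open>auto simp: U_def M_def\<close>)
    also have "\<dots> \<le> (C + 2 * (1 + c)) * \<bar>t\<bar>" using c by (intro mult_right_mono) auto
    finally show ?thesis .
  next
    case False
    have "cmod (twist m t n x) \<le> 1" unfolding twist_eq[OF m] by (rule norm_avg_le) simp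
    moreover have "cmod (complex_of_real (exp (- real n * (t\<^sup>2 * c / 2)))) \<le> 1"
      unfolding norm_of_real using c by simp
    ultimately have "cmod (twist m t n x - exp (- real n * (t\<^sup>2 * c / 2))) \<le> 1 + 1"
      by (intro order_trans[OF norm_triangle_ineq4] add_mono)
    also have "\<dots> \<le> 2 * ((1 + c) * \<bar>t\<bar>)" using False c by (simp add: field_simps)
    also have "\<dots> \<le> (C + 2 * (1 + c)) * \<bar>t\<bar>" using C by (simp add: algebra_simps)
    finally show ?thesis .
  qed
  then show thesis using C c by (intro that[of "C + 2 * (1 + c)"]) (auto simp: c_def)
qed

text \<open>The orbits of \<open>j / (K ^ n - 1)\<close> and \<open>j / K ^ n\<close> stay so close to each other that the differences of
  a Hoelder function along them are dominated by a geometric series. This transfers estimates from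
  the preimages of \<open>0\<close> to the periodic points.\<close>

lemma birkhoff_periodic_close:
  assumes m: "hoelder B m" and n: "n \<ge> 1" and j: "j < K ^ n"
  shows "\<bar>birkhoff m n (real j / (real K ^ n - 1)) - birkhoff m n (real j / real K ^ n)\<bar> \<le> B * \<theta> / (1 - \<theta>)"
proof -
  have K1: "real K ^ n > 1" using K2 n by (intro one_less_power) auto
  have jl: "real j \<le> real K ^ n - 1"
  proof -
    have "j + 1 \<le> K ^ n" using j by simp
    then have "real (j + 1) \<le> real (K ^ n)" by (rule of_nat_mono)
    then show ?thesis by simp
  qed
  have B0: "B \<ge> 0" by (rule hoelder_nonneg[OF m])
  have "\<bar>birkhoff m n (real j / (real K ^ n - 1)) - birkhoff m n (real j / real K ^ n)\<bar>
      \<le> (\<Sum>i<n. \<bar>m (real K ^ i * (real j / (real K ^ n - 1))) - m (real K ^ i * (real j / real K ^ n))\<bar>)"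
    unfolding birkhoff_def sum_subtractf[symmetric] by (rule sum_abs)
  also have "\<dots> \<le> (\<Sum>i<n. B * \<theta> ^ (n - i))"
  proof (rule sum_mono)
    fix i assume i: "i \<in> {..<n}"
    let ?d = "real K ^ i / real K ^ n * (real j / (real K ^ n - 1))"
    have "real K ^ i * (real j / (real K ^ n - 1)) - real K ^ i * (real j / real K ^ n) = ?d"
      using K1 by (simp add: divide_simps) (simp add: algebra_simps)
    then have "\<bar>real K ^ i * (real j / (real K ^ n - 1)) - real K ^ i * (real j / real K ^ n)\<bar> = ?d"
      using K1 by simp
    also have "?d \<le> real K ^ i / real K ^ n * 1" using K1 jl by (intro mult_left_mono) auto
    also have "\<dots> = 1 / real K ^ (n - i)" using i by (simp add: power_diff)
    finally show "\<bar>m (real K ^ i * (real j / (real K ^ n - 1))) - m (real K ^ i * (real j / real K ^ n))\<bar> \<le> B * \<theta> ^ (n - i)"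
      by (rule hoelder_modulus[OF m])
  qed
  also have "\<dots> = (\<Sum>i<n. B * \<theta> ^ Suc i)"
    by (rule sum.reindex_bij_witness[where i = "\<lambda>i. n - Suc i" and j = "\<lambda>i. n - Suc i"]) (auto simp: Suc_diff_Suc)
  also have "\<dots> = B * \<theta> * (\<Sum>i<n. \<theta> ^ i)" by (simp add: sum_distrib_left mult.assoc)
  also have "\<dots> \<le> B * \<theta> * (1 / (1 - \<theta>))"
  proof (rule mult_left_mono)
    have "(\<Sum>i<n. \<theta> ^ i) = (1 - \<theta> ^ n) / (1 - \<theta>)" using \<theta> by (subst sum_gp_strict) auto
    also have "\<dots> \<le> 1 / (1 - \<theta>)" using \<theta> by (intro divide_right_mono) auto
    finally show "(\<Sum>i<n. \<theta> ^ i) \<le> 1 / (1 - \<theta>)" .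
  qed (use B0 \<theta> in auto)
  finally show ?thesis by simp
qed

text \<open>On the orbit of \<open>j / (K ^ n - 1)\<close> the coboundary in the martingale decomposition sums to zero, so the
  Birkhoff sums of \<open>u\<close> and \<open>m\<close> agree up to the centring. The index runs up to \<open>K ^ n - 1\<close> included, so
  the fixed point \<open>0\<close> is counted twice.\<close>

theorem periodic_char:
  assumes u: "hoelder A u"
  obtains (coboundary) B g where "hoelder B g" "\<And>x. u x = mean u + g (real K * x) - g x"
  | (clt) \<sigma> C where "\<sigma> > 0" "C > 0"
    "\<And>t n. n \<ge> 1 \<Longrightarrow> cmod ((\<Sum>j<K ^ n. iexp (t * (birkhoff u n (real j / (real K ^ n - 1)) - real n * mean u))) / of_nat (K ^ n)
        - exp (- real n * (t * \<sigma>)\<^sup>2 / 2)) \<le> C * \<bar>t\<bar>"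
proof -
  from martingale_decomposition[OF u] obtain B m g where m: "hoelder B m" and g: "hoelder B g"
    and m0: "\<And>x. avg 1 m x = 0" and mu: "\<And>x. m x = u x - mean u + g x - g (real K * x)" by blast
  define c where "c = mean (\<lambda>x. (m x)\<^sup>2)"
  have c0: "c \<ge> 0" unfolding c_def by (rule mean_nonneg[OF hoelder_square[OF m]]) simp
  show thesis
  proof (cases "c = 0")
    case True
    have "(m x)\<^sup>2 = 0" for x
      by (rule mean_zero_imp_zero[OF hoelder_square[OF m]]) (use True in \<open>auto simp: c_def\<close>)
    then have "u x = mean u + g (real K * x) - g x" for x using mu[of x] by simp
    then show thesis using g by (intro coboundary)
  next
    case False
    with c0 have c: "c > 0" by simp
    then obtain C where C: "C > 0" "\<And>t n x. cmod (twist m t n x - exp (- real n * (t\<^sup>2 * c / 2))) \<le> C * \<bar>t\<bar>"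
      using martingale_char[OF m m0] unfolding c_def by blast
    define D where "D = B * \<theta> / (1 - \<theta>)"
    have D0: "D \<ge> 0" using \<theta> hoelder_nonneg[OF m] by (simp add: D_def)
    show thesis
    proof (rule clt[of "sqrt c" "C + D"])
      show "sqrt c > 0" "C + D > 0" using c C D0 by auto
      fix t :: real and n :: nat assume n: "n \<ge> 1"
      have K1: "real K ^ n > 1" using K2 n by (intro one_less_power) auto
      have tel: "birkhoff m n x = birkhoff u n x - real n * mean u + g x - g (real K ^ n * x)" for n x
        by (induction n) (auto simp: birkhoff_def mu algebra_simps)
      let ?x = "\<lambda>j. real j / (real K ^ n - 1)"
      have per: "birkhoff u n (?x j) - real n * mean u = birkhoff m n (?x j)" for j
      proof -
        have "real K ^ n * ?x j = ?x j + real j" using K1 by (simp add: field_simps)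
        then show ?thesis using tel[of n "?x j"] hoelder_periodic_nat[OF g, of "?x j" j] by simp
      qed
      have d: "cmod (iexp (t * birkhoff m n (?x j)) - iexp (t * birkhoff m n (real j / real K ^ n))) \<le> \<bar>t\<bar> * D" if "j < K ^ n" for j
      proof -
        have "iexp (t * birkhoff m n (?x j)) - iexp (t * birkhoff m n (real j / real K ^ n))
          = iexp (t * birkhoff m n (real j / real K ^ n)) * (iexp (t * (birkhoff m n (?x j) - birkhoff m n (real j / real K ^ n))) - 1)"
          by (simp add: right_diff_distrib exp_add[symmetric])
        also have "cmod \<dots> = cmod (iexp (t * (birkhoff m n (?x j) - birkhoff m n (real j / real K ^ n))) - 1)"
          by (simp add: norm_mult)
        also have "\<dots> \<le> \<bar>t * (birkhoff m n (?x j) - birkhoff m n (real j / real K ^ n))\<bar>" by (rule iexp_taylor0)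
        also have "\<dots> \<le> \<bar>t\<bar> * D"
          unfolding abs_mult D_def by (intro mult_left_mono birkhoff_periodic_close[OF m n that]) auto
        finally show ?thesis .
      qed
      let ?S = "(\<Sum>j<K ^ n. iexp (t * birkhoff m n (?x j))) / of_nat (K ^ n)"
      have tw: "twist m t n 0 = (\<Sum>j<K ^ n. iexp (t * birkhoff m n (real j / real K ^ n))) / of_nat (K ^ n)"
        by (simp add: twist_eq[OF m] avg_def)
      have "cmod (?S - twist m t n 0) = cmod (\<Sum>j<K ^ n. iexp (t * birkhoff m n (?x j)) - iexp (t * birkhoff m n (real j / real K ^ n))) / real (K ^ n)"
        unfolding tw sum_subtractf diff_divide_distrib[symmetric] by (simp add: norm_divide norm_power)
      also have "\<dots> \<le> (\<Sum>j<K ^ n. \<bar>t\<bar> * D) / real (K ^ n)"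
        using d by (intro divide_right_mono sum_norm_le) auto
      also have "\<dots> = \<bar>t\<bar> * D" by simp
      finally have "cmod (?S - twist m t n 0) \<le> \<bar>t\<bar> * D" .
      from norm_triangle_mono[OF this C(2)[of t n 0]]
      have "cmod (?S - exp (- real n * (t\<^sup>2 * c / 2))) \<le> (C + D) * \<bar>t\<bar>" by (simp add: algebra_simps)
      moreover have "- real n * (t\<^sup>2 * c / 2) = - real n * (t * sqrt c)\<^sup>2 / 2" using c by (simp add: power_mult_distrib)
      ultimately show "cmod ((\<Sum>j<K ^ n. iexp (t * (birkhoff u n (?x j) - real n * mean u))) / of_nat (K ^ n)
        - exp (- real n * (t * sqrt c)\<^sup>2 / 2)) \<le> (C + D) * \<bar>t\<bar>" by (simp only: per)
    qed
  qed
qed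

end

section \<open>Entropy of random variables and of measure-preserving maps\<close>

definition \<eta> :: "real \<Rightarrow> real" where "\<eta> x = - (x * ln x)"

lemma eta_uniform:
  assumes "e > 0"
  obtains d where "d > 0" "\<And>a b. 0 \<le> a \<Longrightarrow> a \<le> 1 \<Longrightarrow> 0 \<le> b \<Longrightarrow> b \<le> 1 \<Longrightarrow> \<bar>a - b\<bar> < d \<Longrightarrow> \<bar>\<eta> a - \<eta> b\<bar> < e"
proof -
  have "continuous_on {0..1} \<eta>" unfolding continuous_on_eq_continuous_within
  proof
    fix x :: real assume x: "x \<in> {0..1}"
    show "continuous (at x within {0..1}) \<eta>"
    proof (cases "x = 0")
      case False
      then have "isCont (\<lambda>x. - (x * ln x)) x" by (intro continuous_intros) auto
      then show ?thesis unfolding \<eta>_def[abs_def] by (rule continuous_at_imp_continuous_at_within)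
    next
      case True
      have "((\<lambda>x :: real. - (x * ln x)) \<longlongrightarrow> 0) (at_right 0)" by real_asymp
      then have "((\<lambda>x :: real. - (x * ln x)) \<longlongrightarrow> 0) (at 0 within {0..1})"
        by (rule tendsto_mono[rotated]) (auto simp: at_within_Icc_at_right)
      then show ?thesis by (simp add: continuous_within True \<eta>_def[abs_def])
    qed
  qed
  then have "uniformly_continuous_on {0..1} \<eta>" by (rule compact_uniformly_continuous) simp
  then obtain d where "d > 0" "\<And>x x'. x \<in> {0..1} \<Longrightarrow> x' \<in> {0..1} \<Longrightarrow> dist x' x < d \<Longrightarrow> dist (\<eta> x') (\<eta> x) < e"
    using assms unfolding uniformly_continuous_on_def by metis
  then show thesis by (intro that[of d]) (auto simp: dist_real_def)
qed

context prob_space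
begin

definition fiber_prob :: "('a \<Rightarrow> 'b) \<Rightarrow> 'a \<Rightarrow> real"
  where "fiber_prob X s = prob {s' \<in> space M. X s' = X s}"

text \<open>Entropy as the integral of the information function, rather than as a sum over the values of
  \<open>X\<close>: for different variables the integrals are over the same space and can be combined.\<close>

definition ent :: "('a \<Rightarrow> 'b) \<Rightarrow> real"
  where "ent X = (\<integral>s. - ln (fiber_prob X s) \<partial>M)"

definition determines :: "('a \<Rightarrow> 'b) \<Rightarrow> ('a \<Rightarrow> 'c) \<Rightarrow> bool"
  where "determines X Y \<longleftrightarrow> (\<forall>s\<in>space M. \<forall>s'\<in>space M. X s = X s' \<longrightarrow> Y s = Y s')"

lemma fiber_sets: "simple_function M X \<Longrightarrow> {s \<in> space M. X s = v} \<in> sets M"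
  using simple_functionD(2)[of M X "{v}"] by (simp add: vimage_def Int_def conj_commute)

lemma integral_simple:
  fixes g :: "'b \<Rightarrow> real"
  assumes X: "simple_function M X"
  shows "integrable M (\<lambda>s. g (X s))"
    and "(\<integral>s. g (X s) \<partial>M) = (\<Sum>v\<in>X ` space M. prob {s \<in> space M. X s = v} * g v)"
proof -
  have fin: "finite (X ` space M)" using X by (rule simple_functionD)
  have eq: "g (X s) = (\<Sum>v\<in>X ` space M. indicator {s \<in> space M. X s = v} s * g v)" if "s \<in> space M" for s
  proof -
    have "(\<Sum>v\<in>X ` space M. indicator {s \<in> space M. X s = v} s * g v) = (\<Sum>v\<in>X ` space M. if v = X s then g v else 0)"
      using that by (intro sum.cong) (auto simp: indicator_def)
    then show ?thesis using that fin by simp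
  qed
  have i: "integrable M (\<lambda>s. indicator {s \<in> space M. X s = v} s * g v)" for v
    by (intro integrable_mult_left integrable_real_indicator fiber_sets X) (simp add: emeasure_finite less_top[symmetric])
  show "integrable M (\<lambda>s. g (X s))"
    by (subst Bochner_Integration.integrable_cong[OF refl eq]) (auto intro!: Bochner_Integration.integrable_sum i)
  have "(\<integral>s. g (X s) \<partial>M) = (\<integral>s. (\<Sum>v\<in>X ` space M. indicator {s \<in> space M. X s = v} s * g v) \<partial>M)"
    by (rule Bochner_Integration.integral_cong[OF refl eq])
  also have "\<dots> = (\<Sum>v\<in>X ` space M. \<integral>s. indicator {s \<in> space M. X s = v} s * g v \<partial>M)"
    by (rule Bochner_Integration.integral_sum) (rule i)
  also have "\<dots> = (\<Sum>v\<in>X ` space M. prob {s \<in> space M. X s = v} * g v)"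
    using fiber_sets[OF X] by (intro sum.cong refl) (simp add: Int_absorb1)
  finally show "(\<integral>s. g (X s) \<partial>M) = (\<Sum>v\<in>X ` space M. prob {s \<in> space M. X s = v} * g v)" .
qed

lemma sum_fibers:
  assumes "simple_function M X" "finite S" "X ` space M \<subseteq> S"
  shows "(\<Sum>v\<in>S. prob {s \<in> space M. X s = v}) = 1"
proof -
  have "(\<Sum>v\<in>S. prob {s \<in> space M. X s = v}) = (\<Sum>v\<in>X ` space M. prob {s \<in> space M. X s = v})"
  proof (rule sum.mono_neutral_right)
    show "\<forall>v\<in>S - X ` space M. prob {s \<in> space M. X s = v} = 0"
    proof
      fix v assume "v \<in> S - X ` space M"
      then have "{s \<in> space M. X s = v} = {}" by auto
      then show "prob {s \<in> space M. X s = v} = 0" by (simp only: measure_empty)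
    qed
  qed (use assms in auto)
  also have "\<dots> = 1" using integral_simple(2)[OF assms(1), of "\<lambda>_. 1"] prob_space by simp
  finally show ?thesis .
qed

lemma ent_eq_sum:
  assumes X: "simple_function M X" and S: "finite S" "X ` space M \<subseteq> S"
  shows "ent X = - (\<Sum>v\<in>S. prob {s \<in> space M. X s = v} * ln (prob {s \<in> space M. X s = v}))"
proof -
  have "ent X = (\<Sum>v\<in>X ` space M. prob {s \<in> space M. X s = v} * - ln (prob {s \<in> space M. X s = v}))"
    unfolding ent_def fiber_prob_def by (rule integral_simple(2)[OF X])
  also have "\<dots> = (\<Sum>v\<in>S. prob {s \<in> space M. X s = v} * - ln (prob {s \<in> space M. X s = v}))"
  proof (rule sum.mono_neutral_left)
    show "\<forall>v\<in>S - X ` space M. prob {s \<in> space M. X s = v} * - ln (prob {s \<in> space M. X s = v}) = 0"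
    proof
      fix v assume "v \<in> S - X ` space M"
      then have "{s \<in> space M. X s = v} = {}" by auto
      then show "prob {s \<in> space M. X s = v} * - ln (prob {s \<in> space M. X s = v}) = 0" by (simp only: measure_empty mult_zero_left)
    qed
  qed (use S in auto)
  finally show ?thesis by (simp add: sum_negf)
qed

lemma integrable_ln_fiber_prob: "simple_function M X \<Longrightarrow> integrable M (\<lambda>s. ln (fiber_prob X s))"
  unfolding fiber_prob_def using integral_simple(1)[of X "\<lambda>v. ln (prob {s \<in> space M. X s = v})"] by simp

lemma AE_fiber_prob_pos:
  assumes X: "simple_function M X"
  shows "AE s in M. fiber_prob X s > 0"
proof -
  let ?N = "\<Union>v\<in>{v \<in> X ` space M. prob {s \<in> space M. X s = v} = 0}. {s \<in> space M. X s = v}"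
  have "?N \<in> null_sets M"
  proof (rule null_sets_UN')
    show "countable {v \<in> X ` space M. prob {s \<in> space M. X s = v} = 0}"
      using simple_functionD(1)[OF X] by (auto intro!: countable_finite)
    fix v assume "v \<in> {v \<in> X ` space M. prob {s \<in> space M. X s = v} = 0}"
    then show "{s \<in> space M. X s = v} \<in> null_sets M"
      using fiber_sets[OF X, of v] by (auto simp: null_sets_def emeasure_eq_measure)
  qed
  then show ?thesis
  proof (rule AE_I')
    show "{s \<in> space M. \<not> 0 < fiber_prob X s} \<subseteq> ?N"
      by (auto simp: fiber_prob_def zero_less_measure_iff)
  qed
qed

lemma ent_mono:
  assumes X: "simple_function M X" and Y: "simple_function M Y" and d: "determines X Y"
  shows "ent Y \<le> ent X"
  unfolding ent_def
proof (rule integral_mono_AE)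
  show "AE s in M. - ln (fiber_prob Y s) \<le> - ln (fiber_prob X s)"
    using AE_fiber_prob_pos[OF X] AE_space
  proof eventually_elim
    case (elim s)
    have "fiber_prob X s \<le> fiber_prob Y s" unfolding fiber_prob_def
    proof (rule finite_measure_mono[OF _ fiber_sets[OF Y]])
      show "{s' \<in> space M. X s' = X s} \<subseteq> {s' \<in> space M. Y s' = Y s}"
        using d elim(2) unfolding determines_def by blast
    qed
    then show ?case using elim(1) by simp
  qed
qed (use integrable_ln_fiber_prob X Y in auto)

lemma ent_cong:
  assumes "simple_function M X" "simple_function M Y" "determines X Y" "determines Y X"
  shows "ent X = ent Y"
  using ent_mono[OF assms(1,2,3)] ent_mono[OF assms(2,1,4)] by simp

lemma ent_nonneg:
  assumes "simple_function M X" shows "ent X \<ge> 0"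
proof -
  have "ln x \<le> 0" if "0 \<le> x" "x \<le> 1" for x :: real using that by (cases "x = 0") auto
  then show ?thesis unfolding ent_def fiber_prob_def by (intro Bochner_Integration.integral_nonneg) simp
qed

lemma prob_marginal:
  assumes X: "simple_function M X" and A: "A \<in> sets M"
  shows "(\<Sum>x\<in>X ` space M. prob {s \<in> A. X s = x}) = prob A"
proof -
  have sub: "A \<subseteq> space M" using A by (rule sets.sets_into_space)
  have "prob A = prob (\<Union>x\<in>X ` space M. {s \<in> A. X s = x})"
    using sub by (intro arg_cong[where f=prob]) auto
  also have "\<dots> = (\<Sum>x\<in>X ` space M. prob {s \<in> A. X s = x})"
  proof (rule finite_measure_finite_Union)
    have "{s \<in> A. X s = x} = A \<inter> {s \<in> space M. X s = x}" for x using sub by auto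
    then show "(\<lambda>x. {s \<in> A. X s = x}) ` X ` space M \<subseteq> events" using A fiber_sets[OF X] by auto
  qed (auto simp: disjoint_family_on_def simple_functionD[OF X])
  finally show ?thesis by simp
qed

text \<open>The conditional mutual information of \<open>X\<close> and \<open>Y\<close> given \<open>Z\<close> is not negative: after \<open>ln r \<le> r - 1\<close> it
  remains to sum the ratio \<open>r\<close> of the conditionally independent law to the joint law.\<close>

lemma ent_submodular:
  assumes X: "simple_function M X" and Y: "simple_function M Y" and Z: "simple_function M Z"
  shows "ent (\<lambda>s. (X s, Y s, Z s)) + ent Z \<le> ent (\<lambda>s. (X s, Z s)) + ent (\<lambda>s. (Y s, Z s))"
proof -
  note sp = simple_function_Pair
  have XYZ: "simple_function M (\<lambda>s. (X s, Y s, Z s))" and XZ: "simple_function M (\<lambda>s. (X s, Z s))"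
    and YZ: "simple_function M (\<lambda>s. (Y s, Z s))" using X Y Z by (auto intro: sp)
  let ?XYZ = "\<lambda>s. (X s, Y s, Z s)" and ?XZ = "\<lambda>s. (X s, Z s)" and ?YZ = "\<lambda>s. (Y s, Z s)"
  let ?p = "\<lambda>x y z. prob {s \<in> space M. ?XYZ s = (x, y, z)}"
  let ?pxz = "\<lambda>x z. prob {s \<in> space M. ?XZ s = (x, z)}"
  let ?pyz = "\<lambda>y z. prob {s \<in> space M. ?YZ s = (y, z)}"
  let ?pz = "\<lambda>z. prob {s \<in> space M. Z s = z}"
  define r where "r = (\<lambda>(x, y, z). ?pxz x z * ?pyz y z / (?p x y z * ?pz z))"
  have "ent ?XYZ + ent Z - ent ?XZ - ent ?YZ
      = (\<integral>s. ln (fiber_prob ?XZ s) + ln (fiber_prob ?YZ s) - ln (fiber_prob ?XYZ s) - ln (fiber_prob Z s) \<partial>M)"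
    unfolding ent_def using integrable_ln_fiber_prob[OF XYZ] integrable_ln_fiber_prob[OF XZ] integrable_ln_fiber_prob[OF YZ] integrable_ln_fiber_prob[OF Z]
    by simp
  also have "\<dots> \<le> (\<integral>s. r (?XYZ s) - 1 \<partial>M)"
  proof (rule integral_mono_AE)
    show "integrable M (\<lambda>s. r (?XYZ s) - 1)" using integral_simple(1)[OF XYZ, of r] by simp
    show "AE s in M. ln (fiber_prob ?XZ s) + ln (fiber_prob ?YZ s) - ln (fiber_prob ?XYZ s) - ln (fiber_prob Z s) \<le> r (?XYZ s) - 1"
      using AE_fiber_prob_pos[OF XYZ] AE_fiber_prob_pos[OF XZ] AE_fiber_prob_pos[OF YZ] AE_fiber_prob_pos[OF Z]
    proof eventually_elim
      case (elim s)
      have r: "r (?XYZ s) = fiber_prob ?XZ s * fiber_prob ?YZ s / (fiber_prob ?XYZ s * fiber_prob Z s)"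
        by (simp add: r_def fiber_prob_def)
      have "ln (r (?XYZ s)) \<le> r (?XYZ s) - 1" using elim unfolding r by (intro ln_le_minus_one) simp
      moreover have "ln (r (?XYZ s)) = ln (fiber_prob ?XZ s) + ln (fiber_prob ?YZ s) - ln (fiber_prob ?XYZ s) - ln (fiber_prob Z s)"
        unfolding r using elim by (simp add: ln_div ln_mult)
      ultimately show ?case by simp
    qed
  qed (use integrable_ln_fiber_prob[OF XYZ] integrable_ln_fiber_prob[OF XZ] integrable_ln_fiber_prob[OF YZ] integrable_ln_fiber_prob[OF Z] in auto)
  also have "\<dots> = (\<integral>s. r (?XYZ s) \<partial>M) - 1"
    using integral_simple(1)[OF XYZ, of r] prob_space by simp
  also have "(\<integral>s. r (?XYZ s) \<partial>M) \<le> 1"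
  proof -
    let ?SX = "X ` space M" and ?SY = "Y ` space M" and ?SZ = "Z ` space M"
    have fin: "finite ?SX" "finite ?SY" "finite ?SZ" using X Y Z by (auto dest: simple_functionD)
    define t where "t = (\<lambda>(x, y, z). ?pxz x z * ?pyz y z / ?pz z)"
    have "(\<integral>s. r (?XYZ s) \<partial>M) = (\<Sum>v\<in>?XYZ ` space M. prob {s \<in> space M. ?XYZ s = v} * r v)"
      by (rule integral_simple(2)[OF XYZ])
    also have "\<dots> \<le> (\<Sum>v\<in>?XYZ ` space M. t v)"
    proof (rule sum_mono)
      fix v assume "v \<in> ?XYZ ` space M"
      obtain x y z where v: "v = (x, y, z)" by (cases v)
      show "prob {s \<in> space M. ?XYZ s = v} * r v \<le> t v"
        by (cases "?p x y z = 0") (auto simp: v r_def t_def)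
    qed
    also have "\<dots> \<le> (\<Sum>v\<in>?SX \<times> ?SY \<times> ?SZ. t v)"
      using fin by (intro sum_mono2) (auto simp: t_def)
    also have "\<dots> = (\<Sum>z\<in>?SZ. \<Sum>x\<in>?SX. \<Sum>y\<in>?SY. ?pxz x z * ?pyz y z / ?pz z)"
    proof -
      have "(\<Sum>v\<in>?SX \<times> ?SY \<times> ?SZ. t v) = (\<Sum>x\<in>?SX. \<Sum>y\<in>?SY. \<Sum>z\<in>?SZ. t (x, y, z))"
        by (simp add: sum.cartesian_product)
      also have "\<dots> = (\<Sum>x\<in>?SX. \<Sum>z\<in>?SZ. \<Sum>y\<in>?SY. t (x, y, z))"
        by (intro sum.cong refl) (rule sum.swap)
      also have "\<dots> = (\<Sum>z\<in>?SZ. \<Sum>x\<in>?SX. \<Sum>y\<in>?SY. t (x, y, z))"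
        by (rule sum.swap)
      finally show ?thesis by (simp add: t_def)
    qed
    also have "\<dots> = (\<Sum>z\<in>?SZ. (\<Sum>x\<in>?SX. ?pxz x z) * (\<Sum>y\<in>?SY. ?pyz y z) / ?pz z)"
      by (simp add: sum_product sum_divide_distrib)
    also have "\<dots> = (\<Sum>z\<in>?SZ. ?pz z)"
    proof (rule sum.cong[OF refl])
      fix z
      have "(\<Sum>x\<in>?SX. ?pxz x z) = ?pz z"
        using prob_marginal[OF X fiber_sets[OF Z, of z]] by (simp add: conj_ac)
      moreover have "(\<Sum>y\<in>?SY. ?pyz y z) = ?pz z"
        using prob_marginal[OF Y fiber_sets[OF Z, of z]] by (simp add: conj_ac)
      ultimately show "(\<Sum>x\<in>?SX. ?pxz x z) * (\<Sum>y\<in>?SY. ?pyz y z) / ?pz z = ?pz z" by simp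
    qed
    also have "\<dots> = 1" by (rule sum_fibers[OF Z]) (use fin in auto)
    finally show ?thesis .
  qed
  finally show ?thesis by simp
qed

text \<open>Conditioning on more information lowers the entropy.\<close>

lemma ent_cond_mono:
  assumes X: "simple_function M X" and Q: "simple_function M Q" and R: "simple_function M R" and d: "determines Q R"
  shows "ent (\<lambda>s. (X s, Q s)) - ent Q \<le> ent (\<lambda>s. (X s, R s)) - ent R"
proof -
  have "ent (\<lambda>s. (X s, Q s, R s)) = ent (\<lambda>s. (X s, Q s))"
  proof (rule ent_cong)
    show "determines (\<lambda>s. (X s, Q s, R s)) (\<lambda>s. (X s, Q s))" by (simp add: determines_def)
    show "determines (\<lambda>s. (X s, Q s)) (\<lambda>s. (X s, Q s, R s))" using d unfolding determines_def prod.inject by blast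
  qed (intro simple_function_Pair X Q R)+
  moreover have "ent (\<lambda>s. (Q s, R s)) = ent Q"
  proof (rule ent_cong)
    show "determines (\<lambda>s. (Q s, R s)) Q" by (simp add: determines_def)
    show "determines Q (\<lambda>s. (Q s, R s))" using d unfolding determines_def prod.inject by blast
  qed (intro simple_function_Pair Q R)+
  ultimately show ?thesis using ent_submodular[OF X Q R] by simp
qed

text \<open>The equality case of \<open>ln x \<le> x - 1\<close>.\<close>

lemma ent_max_uniform:
  assumes X: "simple_function M X" and S: "finite S" "X ` space M \<subseteq> S" and N: "card S = N" "N > 0"
    and e: "ent X \<ge> ln (real N)" and v: "v \<in> S"
  shows "prob {s \<in> space M. X s = v} = 1 / real N"
proof -
  let ?p = "\<lambda>v. prob {s \<in> space M. X s = v}"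
  define d where "d v = ?p v * ln (?p v * N) - (?p v - 1 / N)" for v
  have d0: "d v \<ge> 0" and d1: "d v = 0 \<Longrightarrow> ?p v = 1 / N" for v
  proof -
    consider "?p v = 0" | "?p v > 0" using zero_less_measure_iff by blast
    then have "d v \<ge> 0 \<and> (d v = 0 \<longrightarrow> ?p v = 1 / N)"
    proof cases
      case 1
      then show ?thesis using N by (simp add: d_def)
    next
      case 2
      define q where "q = ?p v * N"
      have q: "q > 0" using 2 N by (simp add: q_def)
      have dq: "d v = ?p v * (ln q - (1 - 1 / q))" using 2 N by (simp add: d_def q_def field_simps)
      have l: "ln (1 / q) \<le> 1 / q - 1" using q by (intro ln_le_minus_one) simp
      have "ln q - (1 - 1 / q) \<ge> 0" using l q by (simp add: ln_div)
      moreover have "?p v = 1 / N" if "ln q - (1 - 1 / q) = 0"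
      proof -
        have "ln (1 / q) = 1 / q - 1" using that q by (simp add: ln_div)
        then have "1 / q = 1" using ln_eq_minus_one[of "1 / q"] q by simp
        then have "q = 1" using q by simp
        then show ?thesis using N by (simp add: q_def field_simps)
      qed
      ultimately show ?thesis using dq 2 by simp
    qed
    then show "d v \<ge> 0" "d v = 0 \<Longrightarrow> ?p v = 1 / N" by auto
  qed
  have "(\<Sum>v\<in>S. d v) = (\<Sum>v\<in>S. ?p v * ln (?p v) + ?p v * ln N - (?p v - 1 / N))"
  proof (rule sum.cong[OF refl])
    fix v
    show "d v = ?p v * ln (?p v) + ?p v * ln N - (?p v - 1 / N)"
      using N zero_less_measure_iff[of M "{s \<in> space M. X s = v}"]
      by (cases "?p v = 0") (auto simp: d_def ln_mult distrib_left)
  qed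
  also have "\<dots> = - ent X + ln N * (\<Sum>v\<in>S. ?p v) - ((\<Sum>v\<in>S. ?p v) - card S * (1 / N))"
    unfolding ent_eq_sum[OF X S] by (simp add: sum.distrib sum_subtractf sum_distrib_left mult.commute)
  also have "\<dots> \<le> 0" using e N sum_fibers[OF X S] by simp
  finally have "(\<Sum>v\<in>S. d v) = 0" using d0 by (meson order_antisym sum_nonneg)
  then have "d v = 0" using d0 S v by (simp add: sum_nonneg_eq_0_iff)
  then show ?thesis by (rule d1)
qed

lemma ent_uniform:
  assumes X: "simple_function M X" and S: "finite S" "X ` space M \<subseteq> S" and N: "card S = N" "N > 0"
    and p: "\<And>v. v \<in> S \<Longrightarrow> prob {s \<in> space M. X s = v} = 1 / real N"
  shows "ent X = ln (real N)"
  unfolding ent_eq_sum[OF X S] using p N by (simp add: ln_div)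

text \<open>If \<open>Y\<close> equals \<open>X\<close> with high probability then the joint law is nearly diagonal. Uniform continuity of
  \<open>\<eta>\<close> then bounds the conditional entropy of \<open>X\<close> given \<open>Y\<close>.\<close>

lemma ent_close:
  assumes X: "simple_function M X" and e: "e > 0"
  obtains d where "d > 0" "\<And>Y. simple_function M Y \<Longrightarrow> Y ` space M \<subseteq> X ` space M \<Longrightarrow>
    prob {s \<in> space M. X s \<noteq> Y s} < d \<Longrightarrow> ent (\<lambda>s. (X s, Y s)) - ent Y \<le> e"
proof -
  let ?S = "X ` space M"
  have fin: "finite ?S" using X by (rule simple_functionD)
  have ne: "?S \<noteq> {}" using not_empty by simp
  define N where "N = real (card ?S)"
  have N: "N > 0" using fin ne by (simp add: N_def card_gt_0_iff)
  from eta_uniform[of "e / (N * N)"] e N obtain d where d: "d > 0"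
    "\<And>a b. 0 \<le> a \<Longrightarrow> a \<le> 1 \<Longrightarrow> 0 \<le> b \<Longrightarrow> b \<le> 1 \<Longrightarrow> \<bar>a - b\<bar> < d \<Longrightarrow> \<bar>\<eta> a - \<eta> b\<bar> < e / (N * N)" by auto
  show thesis
  proof (rule that[OF d(1)])
    fix Y assume Y: "simple_function M Y" and YS: "Y ` space M \<subseteq> ?S" and p: "prob {s \<in> space M. X s \<noteq> Y s} < d"
    let ?q = "\<lambda>x y. prob {s \<in> space M. (X s, Y s) = (x, y)}"
    let ?py = "\<lambda>y. prob {s \<in> space M. Y s = y}"
    have XY: "simple_function M (\<lambda>s. (X s, Y s))" using X Y by (rule simple_function_Pair)
    have neq: "{s \<in> space M. X s \<noteq> Y s} \<in> sets M"
      using simple_functionD(2)[OF XY, of "{(x, y). x \<noteq> y}"] by (simp add: vimage_def Int_def conj_commute)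
    have eXY: "ent (\<lambda>s. (X s, Y s)) = (\<Sum>y\<in>?S. \<Sum>x\<in>?S. \<eta> (?q x y))"
    proof -
      have "ent (\<lambda>s. (X s, Y s)) = - (\<Sum>v\<in>?S \<times> ?S. prob {s \<in> space M. (X s, Y s) = v} * ln (prob {s \<in> space M. (X s, Y s) = v}))"
        by (rule ent_eq_sum[OF XY]) (use fin YS in auto)
      also have "\<dots> = (\<Sum>v\<in>?S \<times> ?S. \<eta> (prob {s \<in> space M. (X s, Y s) = v}))"
        by (simp only: \<eta>_def sum_negf)
      also have "\<dots> = (\<Sum>x\<in>?S. \<Sum>y\<in>?S. \<eta> (?q x y))"
        by (subst sum.cartesian_product) (auto intro!: sum.cong)
      also have "\<dots> = (\<Sum>y\<in>?S. \<Sum>x\<in>?S. \<eta> (?q x y))" by (rule sum.swap)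
      finally show ?thesis .
    qed
    have eY: "ent Y = (\<Sum>y\<in>?S. \<eta> (?py y))"
      unfolding ent_eq_sum[OF Y fin YS] \<eta>_def by (simp add: sum_negf)
    have diag: "\<eta> (?q y y) \<le> \<eta> (?py y) + e / (N * N)" for y
    proof -
      have "?py y - ?q y y = prob ({s \<in> space M. Y s = y} - {s \<in> space M. (X s, Y s) = (y, y)})"
        by (rule finite_measure_Diff[symmetric]) (use fiber_sets[OF Y] fiber_sets[OF XY] in auto)
      also have "\<dots> \<le> prob {s \<in> space M. X s \<noteq> Y s}"
        by (rule finite_measure_mono) (use neq in auto)
      finally have "?py y - ?q y y < d" using p by simp
      moreover have "?q y y \<le> ?py y" by (rule finite_measure_mono) (use fiber_sets[OF Y] in auto)
      ultimately have "\<bar>\<eta> (?q y y) - \<eta> (?py y)\<bar> < e / (N * N)" by (intro d(2)) auto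
      then show ?thesis by simp
    qed
    have off: "\<eta> (?q x y) \<le> e / (N * N)" if "x \<noteq> y" for x y
    proof -
      have "?q x y \<le> prob {s \<in> space M. X s \<noteq> Y s}" by (rule finite_measure_mono) (use neq that in auto)
      then have "?q x y < d" using p by linarith
      then have "\<bar>\<eta> (?q x y) - \<eta> 0\<bar> < e / (N * N)" by (intro d(2)) auto
      then show ?thesis by (simp add: \<eta>_def)
    qed
    have "ent (\<lambda>s. (X s, Y s)) \<le> (\<Sum>y\<in>?S. \<Sum>x\<in>?S. (if x = y then \<eta> (?py y) else 0) + e / (N * N))"
      unfolding eXY by (intro sum_mono) (use diag off in \<open>auto\<close>)
    also have "\<dots> = (\<Sum>y\<in>?S. \<eta> (?py y) + N * (e / (N * N)))"
      using fin by (intro sum.cong refl) (simp add: sum.distrib N_def)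
    also have "\<dots> = ent Y + N * (N * (e / (N * N)))" unfolding eY by (simp add: sum.distrib N_def)
    also have "N * (N * (e / (N * N))) = e" using N by simp
    finally show "ent (\<lambda>s. (X s, Y s)) - ent Y \<le> e" by simp
  qed
qed

end

text \<open>A concave sequence that vanishes at \<open>0\<close> has decreasing averages. Applied to the entropies of
  longer and longer words, this gives existence of the entropy rate.\<close>

lemma antitone_average:
  fixes a :: "nat \<Rightarrow> real"
  assumes a0: "a 0 = 0" and nn: "\<And>n. a n \<ge> 0" and d: "\<And>n. a (Suc (Suc n)) - a (Suc n) \<le> a (Suc n) - a n"
  shows "1 \<le> k \<Longrightarrow> k \<le> n \<Longrightarrow> a n / n \<le> a k / k"
    and "convergent (\<lambda>n. a n / n)"
proof -
  have dec: "a (Suc n) - a n \<le> a (Suc k) - a k" if "k \<le> n" for k n using that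
  proof (induction n rule: dec_induct)
    case (step n)
    then show ?case using d[of n] by linarith
  qed simp
  have low: "real n * (a (Suc n) - a n) \<le> a n" for n
  proof -
    have "(\<Sum>k<n. a (Suc n) - a n) \<le> (\<Sum>k<n. a (Suc k) - a k)" by (intro sum_mono dec) auto
    then show ?thesis using a0 by (simp add: sum_lessThan_telescope)
  qed
  have step_le: "a (Suc n) / Suc n \<le> a n / n" if "n \<ge> 1" for n
    using low[of n] that by (simp add: field_simps)
  have mono: "a n / n \<le> a k / k" if "1 \<le> k" "k \<le> n" for k n using that(2)
  proof (induction n rule: dec_induct)
    case (step n)
    have "a (Suc n) / Suc n \<le> a n / n" by (rule step_le) (use step.hyps that(1) in linarith)
    then show ?case using step.IH by linarith
  qed simp
  then show "1 \<le> k \<Longrightarrow> k \<le> n \<Longrightarrow> a n / n \<le> a k / k" .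
  have "decseq (\<lambda>n. a (Suc n) / Suc n)" by (intro decseq_SucI step_le) simp
  then have "convergent (\<lambda>n. a (Suc n) / Suc n)"
    by (rule decseq_convergent[where B=0]) (use nn in \<open>auto simp: convergent_def\<close>)
  then show "convergent (\<lambda>n. a n / n)" by (rule convergent_Suc_iff[THEN iffD1])
qed

locale mpt = prob_space M for M :: "'a measure" +
  fixes T :: "'a \<Rightarrow> 'a"
  assumes T_meas [measurable]: "T \<in> M \<rightarrow>\<^sub>M M" and T_inv: "distr M M T = M"
begin

definition word :: "('a \<Rightarrow> 'b) \<Rightarrow> nat \<Rightarrow> 'a \<Rightarrow> 'b list"
  where "word X n s = map (\<lambda>i. X ((T ^^ i) s)) [0..<n]"

lemma T_space: "s \<in> space M \<Longrightarrow> T s \<in> space M"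
  using T_meas by (rule measurable_space)

lemma simple_function_T:
  assumes "simple_function M X" shows "simple_function M (\<lambda>s. X (T s))"
  using simple_function_comp[OF T_meas assms] by (simp add: comp_def)

lemma word_0 [simp]: "word X 0 s = []"
  by (simp add: word_def)

lemma word_Suc: "word X (Suc n) s = X s # word X n (T s)"
  unfolding word_def upt_conv_Cons[OF zero_less_Suc] by (simp add: map_Suc_upt[symmetric] funpow_swap1 del: upt_Suc)

lemma simple_function_word:
  assumes "simple_function M X" shows "simple_function M (word X n)"
proof (induction n)
  case 0
  have "word X 0 = (\<lambda>_. [])" by auto
  then show ?case by simp
next
  case (Suc n)
  have "word X (Suc n) = (\<lambda>s. (\<lambda>(a, b). a # b) ((\<lambda>s. (X s, word X n (T s))) s))"
    by (auto simp: word_Suc)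
  then show ?case
    using simple_function_compose1[OF simple_function_Pair[OF assms simple_function_T[OF Suc]], of "\<lambda>(a, b). a # b"] by simp
qed

lemma prob_T:
  assumes "A \<in> sets M" shows "prob {s \<in> space M. T s \<in> A} = prob A"
proof -
  have "prob A = measure (distr M M T) A" by (simp add: T_inv)
  also have "\<dots> = prob (T -` A \<inter> space M)" by (rule measure_distr[OF T_meas assms])
  finally show ?thesis by (simp add: vimage_def Int_def conj_commute)
qed

lemma ent_T:
  assumes X: "simple_function M X" shows "ent (\<lambda>s. X (T s)) = ent X"
proof -
  have "ent (\<lambda>s. X (T s)) = (\<integral>s. - ln (fiber_prob X (T s)) \<partial>M)"
    unfolding ent_def
  proof (rule Bochner_Integration.integral_cong[OF refl])
    fix s assume "s \<in> space M"
    have "fiber_prob (\<lambda>s. X (T s)) s = prob {s' \<in> space M. T s' \<in> {s'' \<in> space M. X s'' = X (T s)}}"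
      unfolding fiber_prob_def by (intro arg_cong[where f=prob]) (auto simp: T_space)
    also have "\<dots> = fiber_prob X (T s)" unfolding fiber_prob_def by (rule prob_T[OF fiber_sets[OF X]])
    finally show "- ln (fiber_prob (\<lambda>s. X (T s)) s) = - ln (fiber_prob X (T s))" by simp
  qed
  also have "\<dots> = (\<integral>s. - ln (fiber_prob X s) \<partial>distr M M T)"
    by (rule integral_distr[symmetric, OF T_meas])
      (use integrable_ln_fiber_prob[OF X] in \<open>auto dest: borel_measurable_integrable\<close>)
  finally show ?thesis by (simp add: T_inv ent_def)
qed

lemma determines_word_le:
  "n \<le> m \<Longrightarrow> determines (word X m) (word X n)"
proof -
  assume "n \<le> m"
  then have "word X n s = take n (word X m s)" for s by (simp add: word_def take_map)
  then show ?thesis by (simp add: determines_def)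
qed

lemma determines_T: "determines X Y \<Longrightarrow> determines (\<lambda>s. X (T s)) (\<lambda>s. Y (T s))"
  using T_space unfolding determines_def by blast

lemma ent_word_Suc:
  assumes X: "simple_function M X"
  shows "ent (word X (Suc n)) = ent (\<lambda>s. (X s, word X n (T s)))"
proof (rule ent_cong)
  show "simple_function M (\<lambda>s. (X s, word X n (T s)))"
    by (intro simple_function_Pair X simple_function_T simple_function_word)
qed (auto simp: determines_def word_Suc intro: simple_function_word X)

lemma ent_word_average:
  assumes X: "simple_function M X"
  shows "1 \<le> k \<Longrightarrow> k \<le> n \<Longrightarrow> ent (word X n) / n \<le> ent (word X k) / k"
    and "convergent (\<lambda>n. ent (word X n) / n)"
proof -
  note W = simple_function_word[OF X]
  have d: "ent (word X (Suc n)) - ent (word X n) = ent (\<lambda>s. (X s, word X n (T s))) - ent (\<lambda>s. word X n (T s))" for n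
    using ent_word_Suc[OF X] ent_T[OF W] by simp
  have *: "ent (word X (Suc (Suc n))) - ent (word X (Suc n)) \<le> ent (word X (Suc n)) - ent (word X n)" for n
    unfolding d by (intro ent_cond_mono X simple_function_T W determines_T determines_word_le) simp
  have 0: "ent (word X 0) = 0" using prob_space by (simp add: ent_def fiber_prob_def)
  show "1 \<le> k \<Longrightarrow> k \<le> n \<Longrightarrow> ent (word X n) / n \<le> ent (word X k) / k"
    by (rule antitone_average(1)[OF 0 ent_nonneg[OF W] *])
  show "convergent (\<lambda>n. ent (word X n) / n)"
    by (rule antitone_average(2)[OF 0 ent_nonneg[OF W] *])
qed

text \<open>Each further letter of the \<open>X\<close>-word costs at most the conditional entropy of \<open>X\<close> given \<open>m\<close> letters of \<open>D\<close>,
  because the \<open>D\<close>-word overhangs the \<open>X\<close>-word by \<open>m\<close> letters.\<close>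

lemma ent_word_compare:
  assumes X: "simple_function M X" and D: "simple_function M D"
  shows "ent (\<lambda>s. (word X n s, word D (n + m) s))
    \<le> ent (word D (n + m)) + real n * (ent (\<lambda>s. (X s, word D m s)) - ent (word D m))"
proof (induction n)
  case 0
  have "ent (\<lambda>s. (word X 0 s, word D (0 + m) s)) = ent (word D (0 + m))"
    by (rule ent_cong) (auto simp: determines_def intro!: simple_function_Pair simple_function_word D)
  then show ?case by simp
next
  case (Suc n)
  note WX = simple_function_word[OF X] and WD = simple_function_word[OF D] and sp = simple_function_Pair and sT = simple_function_T
  let ?\<delta> = "ent (\<lambda>s. (X s, word D m s)) - ent (word D m)"
  let ?Q = "\<lambda>s. (word X n (T s), word D (Suc (n + m)) s)"
  let ?Q' = "\<lambda>s. (word X n (T s), word D (n + m) (T s))"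
  have Q: "simple_function M ?Q" and Q': "simple_function M ?Q'" by (intro sp sT[OF WX] sT[OF WD] WD)+
  have "ent (\<lambda>s. (word X (Suc n) s, word D (Suc n + m) s)) = ent (\<lambda>s. (X s, ?Q s))"
  proof (rule ent_cong)
    show "simple_function M (\<lambda>s. (word X (Suc n) s, word D (Suc n + m) s))" by (rule sp[OF WX WD])
    show "simple_function M (\<lambda>s. (X s, ?Q s))" by (rule sp[OF X Q])
    show "determines (\<lambda>s. (word X (Suc n) s, word D (Suc n + m) s)) (\<lambda>s. (X s, ?Q s))"
      by (simp add: determines_def word_Suc[of X])
    show "determines (\<lambda>s. (X s, ?Q s)) (\<lambda>s. (word X (Suc n) s, word D (Suc n + m) s))"
      by (simp add: determines_def word_Suc[of X])
  qed
  also have "\<dots> \<le> ent ?Q + ?\<delta>"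
  proof -
    have "determines ?Q (word D m)"
    proof -
      have "determines (word D (Suc (n + m))) (word D m)" by (rule determines_word_le) simp
      then show ?thesis unfolding determines_def prod.inject by blast
    qed
    from ent_cond_mono[OF X Q WD this] show ?thesis by simp
  qed
  also have "ent ?Q = ent (\<lambda>s. (D s, ?Q' s))"
    by (rule ent_cong[OF Q sp[OF D Q']]) (simp_all add: determines_def word_Suc[of D])
  also have "\<dots> \<le> ent ?Q' + (ent (\<lambda>s. (D s, word D (n + m) (T s))) - ent (\<lambda>s. word D (n + m) (T s)))"
    using ent_cond_mono[OF D Q' sT[OF WD], of "n + m"] by (simp add: determines_def)
  also have "ent ?Q' = ent (\<lambda>s. (word X n s, word D (n + m) s))"
    using ent_T[OF sp[OF WX WD], of n "n + m"] by simp
  also have "ent (\<lambda>s. (D s, word D (n + m) (T s))) = ent (word D (Suc n + m))"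
    using ent_word_Suc[OF D] by simp
  also have "ent (\<lambda>s. word D (n + m) (T s)) = ent (word D (n + m))" by (rule ent_T[OF WD])
  finally show ?case using Suc by (simp add: algebra_simps)
qed

text \<open>If the words of \<open>D\<close> generate, \<open>X\<close> can be approximated by a function \<open>Y\<close> of a word of \<open>D\<close>, so the
  conditional entropy per letter in the previous comparison becomes arbitrarily small.\<close>

lemma entropy_rate_le:
  assumes X: "simple_function M X" and D: "simple_function M D" and k: "k \<ge> 1"
    and gen: "\<And>A e. A \<in> sets M \<Longrightarrow> e > 0 \<Longrightarrow> \<exists>m S. prob {s \<in> space M. s \<in> A \<longleftrightarrow> word D m s \<notin> S} < e"
  shows "lim (\<lambda>n. ent (word X n) / n) \<le> ent (word D k) / k"
proof -
  note WX = simple_function_word[OF X] and WD = simple_function_word[OF D] and sp = simple_function_Pair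
  define a where "a = ent (word D k) / k"
  have lim: "(\<lambda>n. ent (word X n) / n) \<longlonglongrightarrow> lim (\<lambda>n. ent (word X n) / n)"
    using ent_word_average(2)[OF X] by (simp add: convergent_LIMSEQ_iff)
  have le: "lim (\<lambda>n. ent (word X n) / n) \<le> a + e" if e: "e > 0" for e
  proof -
    let ?R = "X ` space M"
    have fin: "finite ?R" using X by (rule simple_functionD)
    have ne: "?R \<noteq> {}" using not_empty by simp
    from ent_close[OF X e] obtain d where d: "d > 0" "\<And>Y. simple_function M Y \<Longrightarrow> Y ` space M \<subseteq> ?R \<Longrightarrow>
      prob {s \<in> space M. X s \<noteq> Y s} < d \<Longrightarrow> ent (\<lambda>s. (X s, Y s)) - ent Y \<le> e" by blast
    define d' where "d' = d / card ?R"
    have d': "d' > 0" using d(1) fin ne by (simp add: d'_def card_gt_0_iff)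
    have "\<forall>v. \<exists>m S. prob {s \<in> space M. X s = v \<longleftrightarrow> word D m s \<notin> S} < d'"
    proof
      fix v
      from gen[OF fiber_sets[OF X, of v] d'] obtain m S where
        "prob {s \<in> space M. s \<in> {s \<in> space M. X s = v} \<longleftrightarrow> word D m s \<notin> S} < d'" by blast
      moreover have "{s \<in> space M. s \<in> {s \<in> space M. X s = v} \<longleftrightarrow> word D m s \<notin> S} = {s \<in> space M. X s = v \<longleftrightarrow> word D m s \<notin> S}"
        by auto
      ultimately show "\<exists>m S. prob {s \<in> space M. X s = v \<longleftrightarrow> word D m s \<notin> S} < d'" by auto
    qed
    then obtain mm SS where mS: "\<And>v. prob {s \<in> space M. X s = v \<longleftrightarrow> word D (mm v) s \<notin> SS v} < d'" by metis
    define m where "m = Max (mm ` ?R)"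
    have mm: "mm v \<le> m" if "v \<in> ?R" for v unfolding m_def using fin that by simp
    define in_approx where "in_approx w v \<longleftrightarrow> take (mm v) w \<in> SS v" for w v
    have ia: "in_approx (word D m s) v \<longleftrightarrow> word D (mm v) s \<in> SS v" if "v \<in> ?R" for v s
      using mm[OF that] by (simp add: in_approx_def word_def take_map)
    obtain v0 where v0: "v0 \<in> ?R" using ne by auto
    \<comment> \<open>when no value is approximately taken any value will do, since this happens with small probability\<close>
    define F where "F w = (if \<exists>v\<in>?R. in_approx w v then SOME v. v \<in> ?R \<and> in_approx w v else v0)" for w
    have FR: "F w \<in> ?R" for w
      unfolding F_def using v0 someI_ex[of "\<lambda>v. v \<in> ?R \<and> in_approx w v"] by auto
    let ?Y = "\<lambda>s. F (word D m s)"
    have Y: "simple_function M ?Y" by (rule simple_function_compose1[OF WD])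
    define B where "B v = {s \<in> space M. X s = v \<longleftrightarrow> word D (mm v) s \<notin> SS v}" for v
    have BM: "B v \<in> sets M" for v
      using simple_functionD(2)[OF sp[OF X WD[of "mm v"]], of "{(x, w). x = v \<longleftrightarrow> w \<notin> SS v}"]
      by (simp add: B_def vimage_def Int_def conj_commute)
    have "{s \<in> space M. X s \<noteq> ?Y s} \<subseteq> (\<Union>v\<in>?R. B v)"
    proof
      fix s assume w: "s \<in> {s \<in> space M. X s \<noteq> ?Y s}"
      show "s \<in> (\<Union>v\<in>?R. B v)"
      proof (rule ccontr)
        assume "\<not> ?thesis"
        then have *: "X s = v \<longleftrightarrow> in_approx (word D m s) v" if "v \<in> ?R" for v
          using w that ia[OF that, of s] by (auto simp: B_def)
        have X1: "X s \<in> ?R" using w by auto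
        then have ex: "\<exists>v\<in>?R. in_approx (word D m s) v" using * by blast
        then have "?Y s \<in> ?R \<and> in_approx (word D m s) (?Y s)"
          unfolding F_def using someI_ex[of "\<lambda>v. v \<in> ?R \<and> in_approx (word D m s) v"] by auto
        then have "X s = ?Y s" using * by blast
        then show False using w by simp
      qed
    qed
    then have "prob {s \<in> space M. X s \<noteq> ?Y s} \<le> prob (\<Union>v\<in>?R. B v)"
      by (rule finite_measure_mono) (rule sets.finite_UN[OF fin BM])
    also have "\<dots> \<le> (\<Sum>v\<in>?R. prob (B v))"
      by (rule finite_measure_subadditive_finite[OF fin]) (use BM in blast)
    also have "\<dots> < (\<Sum>v\<in>?R. d')" using fin ne mS by (intro sum_strict_mono) (auto simp: B_def)
    also have "\<dots> = d" using fin ne by (simp add: d'_def)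
    finally have "prob {s \<in> space M. X s \<noteq> ?Y s} < d" .
    then have "ent (\<lambda>s. (X s, ?Y s)) - ent ?Y \<le> e" using Y FR by (intro d(2)) auto
    moreover have "ent (\<lambda>s. (X s, word D m s)) - ent (word D m) \<le> ent (\<lambda>s. (X s, ?Y s)) - ent ?Y"
      by (rule ent_cond_mono[OF X WD Y]) (simp add: determines_def)
    ultimately have \<delta>: "ent (\<lambda>s. (X s, word D m s)) - ent (word D m) \<le> e" by linarith
    have b: "ent (word X n) / n \<le> a + a * (real m / n) + e" if n: "n \<ge> k" for n
    proof -
      have "ent (word X n) \<le> ent (\<lambda>s. (word X n s, word D (n + m) s))"
        by (rule ent_mono) (auto simp: determines_def intro!: sp WX WD)
      also have "\<dots> \<le> ent (word D (n + m)) + real n * (ent (\<lambda>s. (X s, word D m s)) - ent (word D m))"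
        by (rule ent_word_compare[OF X D])
      also have "\<dots> \<le> ent (word D (n + m)) + real n * e" using \<delta> by (intro add_left_mono mult_left_mono) auto
      also have "ent (word D (n + m)) \<le> a * real (n + m)"
        using ent_word_average(1)[OF D, of k "n + m"] k n by (simp add: a_def field_simps)
      finally show ?thesis using n k by (simp add: field_simps)
    qed
    have "(\<lambda>n. a + a * (real m / n) + e) \<longlonglongrightarrow> a + a * 0 + e"
      by (intro tendsto_intros lim_const_over_n)
    from LIMSEQ_le[OF lim this] b show ?thesis by auto
  qed
  show ?thesis unfolding a_def[symmetric] by (rule field_le_epsilon) (rule le)
qed

end

section \<open>Linearization of an expanding lift\<close>

text \<open>The smoothness of the circle map enters only through a Lipschitz bound for the logarithm of the
  derivative of its lift.\<close>

locale expanding_lift =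
  fixes F F' :: "real \<Rightarrow> real" and K :: nat and \<kappa> \<Lambda> :: real
  assumes DF: "\<And>x. (F has_real_derivative F' x) (at x)"
    and per: "\<And>x. F (x + 1) = F x + real K"
    and \<kappa>: "\<kappa> > 1" and F'_ge: "\<And>x. F' x \<ge> \<kappa>"
    and lip: "\<And>x y. \<bar>ln (F' x) - ln (F' y)\<bar> \<le> \<Lambda> * \<bar>x - y\<bar>"
begin

lemma F'_pos: "F' x > 0"
  using F'_ge[of x] \<kappa> by linarith

lemma F_diff_ge:
  assumes "x \<le> y" shows "\<kappa> * (y - x) \<le> F y - F x"
proof (cases "x = y")
  case False
  then have "x < y" using assms by simp
  from MVT2[OF this DF] obtain z where "F y - F x = (y - x) * F' z" by blast
  then show ?thesis using mult_right_mono[OF F'_ge[of z], of "y - x"] assms by (simp add: mult.commute)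
qed simp

lemma F_iter_diff_ge:
  assumes "x \<le> y" shows "\<kappa> ^ n * (y - x) \<le> (F ^^ n) y - (F ^^ n) x"
proof (induction n)
  case (Suc n)
  have "0 \<le> \<kappa> ^ n * (y - x)" using assms \<kappa> by simp
  then have le: "(F ^^ n) x \<le> (F ^^ n) y" using Suc by simp
  have "\<kappa> ^ Suc n * (y - x) \<le> \<kappa> * ((F ^^ n) y - (F ^^ n) x)"
    using Suc \<kappa> by (simp add: mult.assoc)
  also have "\<dots> \<le> (F ^^ Suc n) y - (F ^^ Suc n) x" using F_diff_ge[OF le] by simp
  finally show ?case .
qed simp

lemma K_ge_2: "K \<ge> 2"
proof -
  have "real K > 1" using F_diff_ge[of 0 1] per[of 0] \<kappa> by simp
  then show ?thesis by simp
qed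

sublocale transfer K "1 / \<kappa>" by standard (use K_ge_2 \<kappa> in auto)

lemma F_cont: "continuous_on UNIV F"
  using DF by (auto intro!: continuous_at_imp_continuous_on DERIV_isCont)

lemma F_plus_nat: "F (x + real k) = F x + real (K * k)"
proof (induction k)
  case (Suc k)
  then show ?case using per[of "x + real k"] by (simp add: ac_simps distrib_left)
qed simp

lemma F_iter_plus: "(F ^^ n) (x + 1) = (F ^^ n) x + real (K ^ n)"
  by (induction n) (simp_all add: F_plus_nat del: of_nat_power of_nat_mult)

definition defect :: "real \<Rightarrow> real" where "defect x = F x - real K * x"

lemma defect_plus_nat: "defect (x + real k) = defect x"
  using F_plus_nat[of x k] by (simp add: defect_def algebra_simps)

lemma defect_bounded: obtains B where "B > 0" "\<And>x. \<bar>defect x\<bar> \<le> B"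
proof -
  have "continuous_on UNIV (\<lambda>x. - \<bar>defect x\<bar>)"
    unfolding defect_def by (intro continuous_intros F_cont)
  then obtain x0 where x0: "\<And>x. - \<bar>defect x0\<bar> \<le> - \<bar>defect x\<bar>"
    using periodic_attains_inf[of "\<lambda>x. - \<bar>defect x\<bar>"] defect_plus_nat[of _ 1] by auto
  have "\<bar>defect x\<bar> \<le> \<bar>defect x0\<bar> + 1" for x using x0[of x] by simp
  then show thesis by (intro that[of "\<bar>defect x0\<bar> + 1"]) auto
qed

text \<open>The limit of \<open>(F ^^ n) x / K ^ n\<close>, as a telescoping sum.\<close>

definition H :: "real \<Rightarrow> real"
  where "H x = x + (\<Sum>n. defect ((F ^^ n) x) / real K ^ Suc n)"

lemma summable_inverse_powers: "summable (\<lambda>n. B / real K ^ Suc n)"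
proof -
  have "summable (\<lambda>n. (B / K) * (1 / real K) ^ n)"
    using K_ge_2 by (intro summable_mult summable_geometric) auto
  then show ?thesis by (simp add: power_one_over divide_inverse mult.assoc power_inverse)
qed

lemma H_summable: "summable (\<lambda>n. defect ((F ^^ n) x) / real K ^ Suc n)"
proof -
  obtain B where "B > 0" "\<And>x. \<bar>defect x\<bar> \<le> B" using defect_bounded by blast
  then show ?thesis
    by (intro summable_comparison_test'[OF summable_inverse_powers[of B]]) (simp add: divide_right_mono abs_divide)
qed

lemma H_cont: "continuous_on UNIV H"
proof -
  obtain B where B: "B > 0" "\<And>x. \<bar>defect x\<bar> \<le> B" using defect_bounded by blast
  have ic: "continuous_on UNIV (F ^^ n)" for n
  proof (induction n)
    case (Suc n)
    have "continuous_on UNIV (\<lambda>x. F ((F ^^ n) x))"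
      by (rule continuous_on_compose2[OF F_cont Suc]) auto
    then show ?case by (simp add: comp_def)
  qed (simp add: id_def continuous_on_id)
  have dc: "continuous_on UNIV defect" unfolding defect_def[abs_def] by (intro continuous_intros F_cont)
  have "uniform_limit UNIV (\<lambda>n x. \<Sum>i<n. defect ((F ^^ i) x) / real K ^ Suc i)
      (\<lambda>x. \<Sum>i. defect ((F ^^ i) x) / real K ^ Suc i) sequentially"
  proof (rule Weierstrass_m_test)
    show "norm (defect ((F ^^ n) x) / real K ^ Suc n) \<le> B / real K ^ Suc n" for n x
      using B(2)[of "(F ^^ n) x"] by (simp add: abs_divide divide_right_mono)
  qed (rule summable_inverse_powers)
  then have "continuous_on UNIV (\<lambda>x. \<Sum>i. defect ((F ^^ i) x) / real K ^ Suc i)"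
  proof (rule uniform_limit_theorem[rotated])
    show "\<forall>\<^sub>F n in sequentially. continuous_on UNIV (\<lambda>x. \<Sum>i<n. defect ((F ^^ i) x) / real K ^ Suc i)"
      by (intro always_eventually allI continuous_intros continuous_on_compose2[OF dc ic]) auto
  qed simp
  then show ?thesis unfolding H_def[abs_def] by (intro continuous_intros)
qed

lemma H_near_id: obtains C where "\<And>x. \<bar>H x - x\<bar> \<le> C"
proof -
  obtain B where B: "B > 0" "\<And>x. \<bar>defect x\<bar> \<le> B" using defect_bounded by blast
  have "norm (\<Sum>n. defect ((F ^^ n) x) / real K ^ Suc n) \<le> (\<Sum>n. B / real K ^ Suc n)" for x
  proof (rule norm_suminf_le)
    show "norm (defect ((F ^^ n) x) / real K ^ Suc n) \<le> B / real K ^ Suc n" for n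
      using B(2)[of "(F ^^ n) x"] by (simp add: abs_divide divide_right_mono)
  qed (rule summable_inverse_powers)
  then show thesis by (intro that[of "\<Sum>n. B / real K ^ Suc n"]) (simp add: H_def)
qed

lemma H_conj: "H (F x) = real K * H x"
proof -
  let ?a = "\<lambda>n. defect ((F ^^ n) x) / real K ^ Suc n"
  have "(\<Sum>n. defect ((F ^^ n) (F x)) / real K ^ Suc n) = (\<Sum>n. real K * ?a (Suc n))"
    by (simp add: funpow_swap1)
  also have "\<dots> = real K * (\<Sum>n. ?a (Suc n))"
    by (rule suminf_mult[OF summable_Suc_iff[THEN iffD2, OF H_summable]])
  also have "(\<Sum>n. ?a (Suc n)) = (\<Sum>n. ?a n) - ?a 0" by (rule suminf_split_head[OF H_summable])
  also have "real K * ((\<Sum>n. ?a n) - ?a 0) = real K * (\<Sum>n. ?a n) - (F x - real K * x)"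
    by (simp add: right_diff_distrib) (simp add: defect_def)
  finally have "F x + (\<Sum>n. defect ((F ^^ n) (F x)) / real K ^ Suc n) = real K * (x + (\<Sum>n. ?a n))"
    by (simp add: distrib_left)
  then show ?thesis by (simp only: H_def)
qed

lemma H_plus_1: "H (x + 1) = H x + 1"
proof -
  have "defect ((F ^^ n) (x + 1)) = defect ((F ^^ n) x)" for n
    unfolding F_iter_plus by (rule defect_plus_nat)
  then show ?thesis by (simp add: H_def)
qed

lemma H_iter: "H ((F ^^ n) x) = real K ^ n * H x"
  by (induction n) (simp_all add: H_conj)

text \<open>Two points that \<open>H\<close> fails to separate stay within bounded distance under all iterates of \<open>F\<close>,
  because \<open>H\<close> is close to the identity; this contradicts expansion.\<close>

lemma H_strict_mono: "strict_mono H"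
proof (rule strict_monoI, rule ccontr)
  fix x y :: real assume xy: "x < y" and "\<not> H x < H y"
  then have le: "H y \<le> H x" by simp
  obtain C where C: "\<And>x. \<bar>H x - x\<bar> \<le> C" using H_near_id by blast
  obtain n where "2 * C / (y - x) < \<kappa> ^ n" using real_arch_pow[OF \<kappa>] by blast
  then have "2 * C < \<kappa> ^ n * (y - x)" using xy by (simp add: field_simps)
  also have "\<dots> \<le> (F ^^ n) y - (F ^^ n) x" using xy by (intro F_iter_diff_ge) simp
  also have "\<dots> \<le> H ((F ^^ n) y) - H ((F ^^ n) x) + 2 * C"
    using C[of "(F ^^ n) y"] C[of "(F ^^ n) x"] by linarith
  also have "H ((F ^^ n) y) - H ((F ^^ n) x) \<le> 0"
    using le unfolding H_iter by (simp add: mult_left_mono)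
  finally show False by simp
qed

definition G :: "real \<Rightarrow> real" where "G = inv H"

lemmas H_bij = lift_bij(1)[OF H_cont H_strict_mono H_plus_1]

lemma HG [simp]: "H (G x) = x" and GH [simp]: "G (H x) = x"
  using H_bij by (simp_all add: G_def bij_is_surj surj_f_inv_f bij_is_inj)

lemma G_cont: "continuous_on UNIV G" and G_strict_mono: "strict_mono G" and G_plus_1: "G (x + 1) = G x + 1"
  unfolding G_def by (rule lift_bij[OF H_cont H_strict_mono H_plus_1])+

lemma G_iter: "(F ^^ n) (G x) = G (real K ^ n * x)"
proof -
  have "G (H ((F ^^ n) (G x))) = G (real K ^ n * x)" unfolding H_iter by simp
  then show ?thesis by simp
qed

lemma G_conj: "F (G x) = G (real K * x)"
  using G_iter[of 1 x] by simp

text \<open>After \<open>n\<close> iterations the images are less than one period apart, and each iteration has expanded the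
  distance at least by \<open>\<kappa>\<close>.\<close>

lemma G_modulus:
  assumes "\<bar>x - y\<bar> \<le> 1 / real K ^ n" shows "\<bar>G x - G y\<bar> \<le> (1 / \<kappa>) ^ n"
proof -
  have *: "G y - G x \<le> (1 / \<kappa>) ^ n" if xy: "x \<le> y" "y - x \<le> 1 / real K ^ n" for x y
  proof -
    have "\<kappa> ^ n * (G y - G x) \<le> (F ^^ n) (G y) - (F ^^ n) (G x)"
      using xy by (intro F_iter_diff_ge) (simp add: strict_mono_less_eq[OF G_strict_mono])
    also have "\<dots> = G (real K ^ n * y) - G (real K ^ n * x)" by (simp add: G_iter)
    also have "\<dots> \<le> G (real K ^ n * x + 1) - G (real K ^ n * x)"
      using xy(2) by (simp add: strict_mono_less_eq[OF G_strict_mono] field_simps)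
    also have "\<dots> = 1" by (simp add: G_plus_1)
    finally show ?thesis using \<kappa> by (simp add: field_simps power_one_over)
  qed
  show ?thesis
    using *[of x y] *[of y x] assms strict_mono_less_eq[OF G_strict_mono, of x y] strict_mono_less_eq[OF G_strict_mono, of y x]
    by (cases "x \<le> y") auto
qed

definition \<phi> :: "real \<Rightarrow> real" where "\<phi> x = ln (F' (G x))"

lemma F'_plus_1: "F' (x + 1) = F' x"
  by (rule deriv_periodic[OF DF per])

lemma hoelder_\<phi>: "hoelder \<Lambda> \<phi>"
  unfolding hoelder_def
proof (intro conjI allI impI)
  show "\<phi> (x + 1) = \<phi> x" for x by (simp add: \<phi>_def G_plus_1 F'_plus_1)
  have L: "\<Lambda> \<ge> 0" using lip[of 0 1] by simp
  fix n x y assume "\<bar>x - y\<bar> \<le> 1 / real K ^ n"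
  from G_modulus[OF this] have "\<Lambda> * \<bar>G x - G y\<bar> \<le> \<Lambda> * (1 / \<kappa>) ^ n" using L by (intro mult_left_mono)
  then show "\<bar>\<phi> x - \<phi> y\<bar> \<le> \<Lambda> * (1 / \<kappa>) ^ n" using lip[of "G x" "G y"] by (simp add: \<phi>_def)
qed

lemma iter_deriv: "((F ^^ n) has_real_derivative (\<Prod>i<n. F' ((F ^^ i) x))) (at x)"
proof (induction n)
  case (Suc n)
  have "((\<lambda>x. F ((F ^^ n) x)) has_real_derivative F' ((F ^^ n) x) * (\<Prod>i<n. F' ((F ^^ i) x))) (at x)"
    by (rule DERIV_chain2[OF DF Suc])
  then show ?case by (simp add: comp_def mult.commute)
qed (simp add: id_def)

lemma ln_iter_deriv: "ln (\<Prod>i<n. F' ((F ^^ i) (G x))) = birkhoff \<phi> n x"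
proof -
  have "ln (\<Prod>i<n. F' ((F ^^ i) (G x))) = (\<Sum>i<n. ln (F' ((F ^^ i) (G x))))"
    by (rule ln_prod) (simp_all add: less_imp_neq[OF F'_pos, symmetric])
  then show ?thesis by (simp add: birkhoff_def \<phi>_def G_iter)
qed

text \<open>The measure with density \<open>exp (- g (H y))\<close> is multiplied by the constant \<open>exp c\<close> under \<open>F\<close>, so its
  distribution function conjugates \<open>F\<close> to an affine map. Comparing the growth over a period shows
  that the constant is \<open>K\<close>, and a translation removes the constant term of the affine map.\<close>

lemma coboundary_conjugacy:
  assumes g: "hoelder B g" and cob: "\<And>x. \<phi> x = c + g (real K * x) - g x"
  obtains \<psi> w where "\<And>x. (\<psi> has_real_derivative w x) (at x)" "continuous_on UNIV w" "\<And>x. w x > 0"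
    "\<And>x. \<psi> (x + 1) = \<psi> x + 1" "\<And>x. \<psi> (F x) = real K * \<psi> x"
proof -
  define v where "v y = exp (- g (H y))" for y
  have vc: "continuous_on UNIV v"
    unfolding v_def by (intro continuous_intros continuous_on_compose2[OF hoelder_continuous[OF g] H_cont]) auto
  have v0: "v y > 0" for y by (simp add: v_def)
  have v1: "v (y + 1) = v y" for y using hoelder_periodic_nat[OF g, of "H y" 1] by (simp add: v_def H_plus_1)
  have vF: "v (F y) * F' y = exp c * v y" for y
  proof -
    have "F' y = exp (\<phi> (H y))" using F'_pos by (simp add: \<phi>_def)
    then show ?thesis unfolding v_def cob H_conj by (simp add: exp_add[symmetric])
  qed
  obtain W where W: "\<And>x. (W has_real_derivative v x) (at x)" using antiderivative_real[OF vc] by blast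
  define I where "I = W 1 - W 0"
  have W1: "W (y + 1) = W y + I" for y
  proof -
    have "((\<lambda>y. W (y + 1) - W y) has_real_derivative v (y + 1) - v y) (at y)" for y
    proof -
      have "((\<lambda>y. W (y + 1)) has_real_derivative v (y + 1)) (at y)" using W by (subst DERIV_shift[symmetric]) simp
      then show ?thesis by (intro DERIV_diff W)
    qed
    then have "W (y + 1) - W y = W (0 + 1) - W 0" by (intro DERIV_isconst_all) (simp add: v1)
    then show ?thesis by (simp add: I_def)
  qed
  have I: "I > 0"
  proof -
    from MVT2[of 0 1 W v] W obtain z where "W 1 - W 0 = (1 - 0) * v z" by auto
    then show ?thesis using v0[of z] by (simp add: I_def)
  qed
  define d where "d = W (F 0) - exp c * W 0"
  have WF: "W (F y) = exp c * W y + d" for y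
  proof -
    have "((\<lambda>y. W (F y) - exp c * W y) has_real_derivative v (F y) * F' y - exp c * v y) (at y)" for y
      by (intro DERIV_diff DERIV_cmult W DERIV_chain2[OF W DF])
    then have "W (F y) - exp c * W y = W (F 0) - exp c * W 0" by (intro DERIV_isconst_all) (simp add: vF)
    then show ?thesis by (simp add: d_def)
  qed
  have Wk: "W (y + real k) = W y + real k * I" for y k
  proof (induction k)
    case (Suc k)
    then show ?case using W1[of "y + real k"] by (simp add: ac_simps distrib_right distrib_left)
  qed simp
  have point: "exp c = real K"
  proof -
    have "W (F (0 + 1)) = W (F 0) + real K * I" unfolding per by (rule Wk)
    moreover have "W (F (0 + 1)) = W (F 0) + exp c * I" unfolding WF W1 by (simp add: algebra_simps)
    ultimately show ?thesis using I by simp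
  qed
  define a where "a = d / (real K - 1)"
  have K1: "real K > 1" using K_ge_2 by simp
  have a: "a + d = real K * a"  using K1 by (simp add: a_def field_simps)
  show thesis
  proof (rule that[of "\<lambda>y. (W y + a) / I" "\<lambda>y. v y / I"])
    show "((\<lambda>y. (W y + a) / I) has_real_derivative v x / I) (at x)" for x
      using W[of x] I by (auto intro!: derivative_eq_intros)
    show "continuous_on UNIV (\<lambda>y. v y / I)" using I by (intro continuous_intros vc) auto
    show "v x / I > 0" for x using v0 I by simp
    show "(W (x + 1) + a) / I = (W x + a) / I + 1" for x unfolding W1 using I by (simp add: field_simps)
    show "(W (F x) + a) / I = real K * ((W x + a) / I)" for x
      unfolding WF point using a by (simp add: algebra_simps)
  qed
qed

end

section \<open>The circle map in linear coordinates\<close>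

lemma abs_circle_surj: "\<exists>y. abs_circle y = p"
  by (induction p rule: circle.abs_induct) blast

lemma continuous_on_abs_circle: "continuous_on UNIV abs_circle"
  unfolding continuous_on_open_vimage[OF open_UNIV] by (simp add: open_circle_def)

locale expanding_circle = expanding_lift F F' K \<kappa> \<Lambda> for F F' K \<kappa> \<Lambda> +
  fixes f :: "circle \<Rightarrow> circle"
  assumes lift: "is_lift F f"
begin

text \<open>The parametrization of the circle in which \<open>f\<close> is multiplication by \<open>K\<close>.\<close>

definition point :: "real \<Rightarrow> circle" where "point x = abs_circle (G x)"

lemma G_plus_int: "G (x + of_int k) = G x + of_int k"
  by (rule lift_plus_int) (rule G_plus_1)

lemma point_eq_iff: "point x = point y \<longleftrightarrow> x - y \<in> \<int>"
proof
  assume "point x = point y"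
  then have "G x - G y \<in> \<int>" by (simp add: point_def abs_circle_eq_iff)
  then obtain k where "G x - G y = of_int k" by (rule Ints_cases)
  then have "G x = G (y + of_int k)" by (simp add: G_plus_int)
  then have "x = y + of_int k" using G_strict_mono by (simp add: strict_mono_eq)
  then show "x - y \<in> \<int>" by simp
next
  assume "x - y \<in> \<int>"
  then obtain k where "x - y = of_int k" by (rule Ints_cases)
  then have "x = y + of_int k" by simp
  then show "point x = point y" by (simp add: point_def abs_circle_eq_iff G_plus_int)
qed

lemma f_point: "f (point x) = point (real K * x)"
  using lift by (simp add: is_lift_def point_def G_conj)

lemma f_iter_point: "(f ^^ n) (point x) = point (real K ^ n * x)"
  by (induction n) (simp_all add: f_point mult.assoc)

definition coord :: "circle \<Rightarrow> real" where "coord p = frac (H (SOME y. abs_circle y = p))"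

lemma coord_bounds: "0 \<le> coord p" "coord p < 1"
  by (simp_all add: coord_def frac_ge_0 frac_lt_1)

lemma point_coord [simp]: "point (coord p) = p"
proof -
  define y where "y = (SOME y. abs_circle y = p)"
  have y: "abs_circle y = p" unfolding y_def using abs_circle_surj[of p] by (rule someI_ex)
  have "point (frac (H y)) = point (H y)" unfolding point_eq_iff by (simp add: frac_def)
  then show ?thesis using y by (simp add: coord_def y_def[symmetric] point_def)
qed

lemma coord_point: "coord (point x) = frac x"
proof -
  have "coord (point x) - frac x \<in> \<int>"
    using point_coord[of "point x"] unfolding point_eq_iff by (simp add: frac_def algebra_simps) (metis Ints_add Ints_of_int diff_diff_eq2 diff_add_cancel add.commute add_diff_eq)
  moreover have "\<bar>coord (point x) - frac x\<bar> < 1"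
    using coord_bounds[of "point x"] frac_ge_0[of x] frac_lt_1[of x] by linarith
  ultimately show ?thesis using Ints_nonzero_abs_less1 by fastforce
qed

lemma coord_f: "coord (f p) = frac (real K * coord p)"
  using coord_point[of "real K * coord p"] f_point[of "coord p"] by simp

lemma is_lift_iter: "is_lift (F ^^ n) (f ^^ n)"
proof (induction n)
  case (Suc n)
  have "continuous_on UNIV (\<lambda>x. F ((F ^^ n) x))"
    by (rule continuous_on_compose2[OF F_cont, of UNIV]) (use Suc in \<open>auto simp: is_lift_def\<close>)
  then show ?case using Suc lift by (simp add: is_lift_def comp_def)
qed (simp add: is_lift_def id_def)

lemma periodic_exponent_point: "periodic_exponent f n (point x) = birkhoff \<phi> n x / real n"
  unfolding periodic_exponent_def point_def circle_deriv_eq[OF is_lift_iter iter_deriv] ln_iter_deriv ..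

lemma circle_deriv_point: "ln (circle_deriv f (point x)) = \<phi> x"
  unfolding point_def circle_deriv_eq[OF lift DF] \<phi>_def ..

lemma Fix_iter:
  assumes n: "n \<ge> 1"
  shows "Fix (f ^^ n) = (\<lambda>j. point (real j / (real K ^ n - 1))) ` {..<K ^ n - 1}"
    and "inj_on (\<lambda>j. point (real j / (real K ^ n - 1))) {..<K ^ n - 1}"
proof -
  have K1: "real K ^ n > 1" using K2 n by (intro one_less_power) auto
  have KN: "real (K ^ n - 1) = real K ^ n - 1" using K2 by (simp add: of_nat_diff)
  show "Fix (f ^^ n) = (\<lambda>j. point (real j / (real K ^ n - 1))) ` {..<K ^ n - 1}"
  proof (intro equalityI subsetI)
    fix p assume "p \<in> Fix (f ^^ n)"
    then have "point (real K ^ n * coord p) = point (coord p)" using f_iter_point[of n "coord p"] by (simp add: Fix_def)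
    then obtain k where k: "real K ^ n * coord p - coord p = of_int k" unfolding point_eq_iff by (rule Ints_cases)
    then have ck: "coord p = of_int k / (real K ^ n - 1)" using K1 by (simp add: field_simps)
    have "0 \<le> of_int k / (real K ^ n - 1)" "of_int k / (real K ^ n - 1) < 1" using coord_bounds[of p] unfolding ck by auto
    then have k0: "0 \<le> k" and "of_int k < real K ^ n - 1" using K1 by (auto simp: field_simps zero_le_divide_iff)
    then have "of_int k < real (K ^ n - 1)" using KN by simp
    then have "nat k < K ^ n - 1" using k0 by linarith
    moreover have "p = point (real (nat k) / (real K ^ n - 1))" using point_coord[of p] ck k0 by simp
    ultimately show "p \<in> (\<lambda>j. point (real j / (real K ^ n - 1))) ` {..<K ^ n - 1}" by blast
  next
    fix p assume "p \<in> (\<lambda>j. point (real j / (real K ^ n - 1))) ` {..<K ^ n - 1}"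
    then obtain j where p: "p = point (real j / (real K ^ n - 1))" by blast
    have "real K ^ n * (real j / (real K ^ n - 1)) - real j / (real K ^ n - 1) = (real K ^ n - 1) * (real j / (real K ^ n - 1))"
      by (simp only: left_diff_distrib mult_1_left)
    also have "\<dots> = real j" using K1 by simp
    finally have "real K ^ n * (real j / (real K ^ n - 1)) - real j / (real K ^ n - 1) = real j" .
    then show "p \<in> Fix (f ^^ n)" by (simp add: Fix_def p f_iter_point point_eq_iff)
  qed
  show "inj_on (\<lambda>j. point (real j / (real K ^ n - 1))) {..<K ^ n - 1}"
  proof (rule inj_onI)
    fix i j assume ij: "i \<in> {..<K ^ n - 1}" "j \<in> {..<K ^ n - 1}" and "point (real i / (real K ^ n - 1)) = point (real j / (real K ^ n - 1))"
    then have Z: "real i / (real K ^ n - 1) - real j / (real K ^ n - 1) \<in> \<int>" by (simp add: point_eq_iff)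
    have b: "real l < real K ^ n - 1" if "l \<in> {..<K ^ n - 1}" for l
      using that KN by (metis lessThan_iff of_nat_less_iff)
    have "0 \<le> real i / (real K ^ n - 1)" "real i / (real K ^ n - 1) < 1" "0 \<le> real j / (real K ^ n - 1)" "real j / (real K ^ n - 1) < 1"
      using b[OF ij(1)] b[OF ij(2)] K1 by auto
    then have "\<bar>real i / (real K ^ n - 1) - real j / (real K ^ n - 1)\<bar> < 1" by linarith
    then have "real i / (real K ^ n - 1) - real j / (real K ^ n - 1) = 0" using Z Ints_nonzero_abs_less1 by blast
    then have "real i / (real K ^ n - 1) = real j / (real K ^ n - 1)" by (simp only: right_minus_eq)
    then show "i = j" using K1 by simp
  qed
qed

lemma coboundary_imp_conjugate:
  assumes g: "hoelder B g" and cob: "\<And>x. \<phi> x = c + g (real K * x) - g x"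
  shows "smoothly_conjugate f (linear_map (int K))"
proof -
  obtain \<psi> w where D: "\<And>x. (\<psi> has_real_derivative w x) (at x)" and wc: "continuous_on UNIV w" and w0: "\<And>x. w x > 0"
    and p: "\<And>x. \<psi> (x + 1) = \<psi> x + 1" and conj: "\<And>x. \<psi> (F x) = real K * \<psi> x"
    by (rule coboundary_conjugacy[OF g cob]) blast
  have c: "continuous_on UNIV \<psi>" using D by (auto intro!: continuous_at_imp_continuous_on DERIV_isCont)
  have m: "strict_mono \<psi>"
  proof (rule strict_monoI)
    fix x y :: real assume "x < y"
    from MVT2[OF this D] obtain z where "\<psi> y - \<psi> x = (y - x) * w z" by blast
    moreover have "(y - x) * w z > 0" using \<open>x < y\<close> w0 by simp
    ultimately show "\<psi> x < \<psi> y" by simp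
  qed
  note b = lift_bij[OF c m p]
  let ?\<psi>i = "inv \<psi>"
  have inv1: "?\<psi>i (\<psi> x) = x" and inv2: "\<psi> (?\<psi>i x) = x" for x
    using b(1) by (simp_all add: bij_is_inj bij_is_surj surj_f_inv_f)
  have Di: "(?\<psi>i has_real_derivative inverse (w (?\<psi>i x))) (at x)" for x
  proof (rule DERIV_inverse_function[where f = \<psi> and a = "x - 1" and b = "x + 1"])
    show "isCont ?\<psi>i x" using b(2) by (simp add: continuous_on_eq_continuous_at)
    show "w (?\<psi>i x) \<noteq> 0" using w0[of "?\<psi>i x"] by simp
  qed (use D inv2 in auto)
  define ext :: "(real \<Rightarrow> real) \<Rightarrow> circle \<Rightarrow> circle" where "ext u q = abs_circle (u (SOME y. abs_circle y = q))" for u q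
  have ext: "ext u (abs_circle x) = abs_circle (u x)" if u: "\<And>x. u (x + 1) = u x + 1" for u x
  proof -
    define y where "y = (SOME y. abs_circle y = abs_circle x)"
    have "abs_circle y = abs_circle x" unfolding y_def by (rule someI) simp
    then have "y - x \<in> \<int>" by (simp only: abs_circle_eq_iff)
    then obtain k where "y - x = of_int k" by (rule Ints_cases)
    then have "y = x + of_int k" by simp
    then have "u y = u x + of_int k" using lift_plus_int[where u = u, OF u] by simp
    moreover have "ext u (abs_circle x) = abs_circle (u y)" by (simp only: ext_def y_def)
    ultimately show ?thesis by (simp add: abs_circle_eq_iff)
  qed
  let ?\<Phi> = "ext \<psi>" and ?\<Psi> = "ext ?\<psi>i"
  have e1: "?\<Phi> (abs_circle x) = abs_circle (\<psi> x)" and e2: "?\<Psi> (abs_circle x) = abs_circle (?\<psi>i x)" for x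
    by (rule ext, rule p) (rule ext, rule b(4))
  have i1: "?\<Psi> (?\<Phi> q) = q" and i2: "?\<Phi> (?\<Psi> q) = q" for q
  proof -
    obtain y where "abs_circle y = q" using abs_circle_surj by blast
    then show "?\<Psi> (?\<Phi> q) = q" "?\<Phi> (?\<Psi> q) = q" by (auto simp: e1 e2 inv1 inv2)
  qed
  have bij: "bij ?\<Phi>" by (rule bij_betw_byWitness[where f' = ?\<Psi>]) (auto simp: i1 i2)
  have invP: "inv ?\<Phi> = ?\<Psi>" by (rule inv_unique_comp) (auto simp: i1 i2 fun_eq_iff)
  have C1: "C_circle 1 g'" if l: "is_lift u g'" and d: "\<And>x. (u has_real_derivative u' x) (at x)" and c: "continuous_on UNIV u'" for u g' u'
  proof -
    have "deriv u = u'" using d by (auto intro: DERIV_imp_deriv)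
    then have "C_real 1 u" using d c by (auto simp: C_real_def real_differentiable_def)
    then show ?thesis using l by (auto simp: C_circle_def)
  qed
  have "C_circle 1 ?\<Phi>" by (rule C1[OF _ D wc]) (simp add: is_lift_def c e1)
  moreover have "C_circle 1 (inv ?\<Phi>)" unfolding invP
  proof (rule C1[OF _ Di])
    show "is_lift ?\<psi>i ?\<Psi>" using b(2) by (simp add: is_lift_def e2)
    have "continuous_on UNIV (\<lambda>x. w (?\<psi>i x))" by (rule continuous_on_compose2[OF wc b(2)]) auto
    then show "continuous_on UNIV (\<lambda>x. inverse (w (?\<psi>i x)))"
      by (rule continuous_on_inverse) (use w0 in \<open>auto simp: less_imp_neq[symmetric]\<close>)
  qed
  moreover have "?\<Phi> (f q) = linear_map (int K) (?\<Phi> q)" for q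
  proof -
    obtain y where y: "abs_circle y = q" using abs_circle_surj by blast
    have "f q = abs_circle (F y)" using lift y by (auto simp: is_lift_def)
    then show ?thesis by (simp add: y[symmetric] e1 conj linear_map.abs_eq)
  qed
  ultimately show ?thesis unfolding smoothly_conjugate_def C1_diffeo_def using bij by blast
qed

lemma degree_eq: "circle_degree f = int K"
  using lift_degree[OF lift, of 0] per[of 0] by simp

end

section \<open>The measure of maximal entropy\<close>

context mpt
begin

text \<open>The sets that can be approximated by unions of cylinders form a \<open>\<sigma>\<close>-algebra.\<close>

lemma approx_by_words:
  assumes D: "simple_function M D"
    and A: "A \<in> sigma_sets (space M) {{s \<in> space M. word D m s = w} | m w. True}"
  shows "A \<in> sets M" and "e > 0 \<Longrightarrow> \<exists>m S. prob {s \<in> space M. s \<in> A \<longleftrightarrow> word D m s \<notin> S} < e"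
proof -
  note WD = simple_function_word[OF D]
  let ?E = "\<lambda>A m S. {s \<in> space M. s \<in> A \<longleftrightarrow> word D m s \<notin> S}"
  have cyl: "{s \<in> space M. word D m s \<in> S} \<in> sets M" for m S
    using simple_functionD(2)[OF WD[of m], of S] by (simp add: vimage_def Int_def conj_commute)
  have E: "?E A m S \<in> sets M" if "A \<in> sets M" for A m S
  proof -
    have "?E A m S = (A - {s \<in> space M. word D m s \<in> S}) \<union> ({s \<in> space M. word D m s \<in> S} - A)"
      using sets.sets_into_space[OF that] by auto
    then show ?thesis using cyl that by auto
  qed
  from A have "A \<in> sets M \<and> (\<forall>e>0. \<exists>m S. prob (?E A m S) < e)"
  proof induction
    case (Basic a)
    then obtain m w where a: "a = {s \<in> space M. word D m s = w}" by blast
    have "?E a m {w} = {}" using a by auto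
    moreover have "a \<in> sets M" using cyl[of m "{w}"] a by simp
    ultimately show ?case by (metis measure_empty)
  next
    case Empty
    have "?E {} 0 {} = {}" by auto
    then show ?case by (metis measure_empty sets.empty_sets)
  next
    case (Compl a)
    have "?E (space M - a) m (- S) = ?E a m S" for m S by auto
    then have eq: "prob (?E (space M - a) m (- S)) = prob (?E a m S)" for m S by simp
    have "\<exists>m S. prob (?E (space M - a) m S) < e" if e: "e > 0" for e
    proof -
      obtain m S where "prob (?E a m S) < e" using Compl.IH e by blast
      then have "prob (?E (space M - a) m (- S)) < e" unfolding eq .
      then show ?thesis by blast
    qed
    then show ?case using Compl.IH by blast
  next
    case (Union a)
    then have am: "a i \<in> sets M" for i by blast
    let ?U = "\<Union>i. a i"
    have "\<exists>m S. prob (?E ?U m S) < e" if e: "e > 0" for e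
    proof -
      let ?V = "\<lambda>N. \<Union>i<N. a i"
      have "(\<lambda>N. prob (?V N)) \<longlonglongrightarrow> prob (\<Union>N. ?V N)"
      proof (rule finite_Lim_measure_incseq)
        show "range ?V \<subseteq> events" using am by auto
        show "incseq ?V" unfolding incseq_def by (intro allI impI UN_mono) auto
      qed
      moreover have "(\<Union>N. ?V N) = ?U" by auto
      ultimately have "\<forall>\<^sub>F N in sequentially. prob ?U - e / 2 < prob (?V N)"
        using e by (intro order_tendstoD) auto
      then obtain N where N: "prob ?U - e / 2 < prob (?V N)" using eventually_happens'[OF sequentially_bot] by blast
      have diff: "prob (?U - ?V N) < e / 2"
      proof -
        have "prob (?U - ?V N) = prob ?U - prob (?V N)" by (rule finite_measure_Diff) (use am in auto)
        then show ?thesis using N by simp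
      qed
      have "\<forall>i. \<exists>m S. prob (?E (a i) m S) < e / (2 * (real N + 1))"
      proof
        fix i
        have "e / (2 * (real N + 1)) > 0" using e by simp
        then show "\<exists>m S. prob (?E (a i) m S) < e / (2 * (real N + 1))" using Union.IH[of i] by blast
      qed
      then obtain mm SS where mS: "\<And>i. prob (?E (a i) (mm i) (SS i)) < e / (2 * (real N + 1))" by metis
      define m where "m = Max (mm ` {..N})"
      define S where "S = {w. \<exists>i<N. take (mm i) w \<in> SS i}"
      have tk: "take (mm i) (word D m s) = word D (mm i) s" if "i < N" for i s
      proof -
        have "mm i \<le> m" unfolding m_def using that by (intro Max_ge) auto
        then show ?thesis by (simp add: word_def take_map)
      qed
      have "?E ?U m S \<subseteq> (?U - ?V N) \<union> (\<Union>i<N. ?E (a i) (mm i) (SS i))"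
      proof
        fix s assume w: "s \<in> ?E ?U m S"
        have S: "word D m s \<in> S \<longleftrightarrow> (\<exists>i<N. word D (mm i) s \<in> SS i)" using tk by (auto simp: S_def)
        show "s \<in> (?U - ?V N) \<union> (\<Union>i<N. ?E (a i) (mm i) (SS i))"
        proof (cases "\<exists>i<N. (s \<in> a i) \<noteq> (word D (mm i) s \<in> SS i)")
          case True
          then show ?thesis using w by auto
        next
          case False
          then have "word D m s \<in> S \<longleftrightarrow> s \<in> ?V N" using S by auto
          moreover have "s \<in> ?V N \<Longrightarrow> s \<in> ?U" by auto
          ultimately show ?thesis using w by auto
        qed
      qed
      then have "prob (?E ?U m S) \<le> prob ((?U - ?V N) \<union> (\<Union>i<N. ?E (a i) (mm i) (SS i)))"
        by (rule finite_measure_mono) (use am E in auto)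
      also have "\<dots> \<le> prob (?U - ?V N) + prob (\<Union>i<N. ?E (a i) (mm i) (SS i))"
        by (rule measure_Un_le) (use am E in auto)
      also have "prob (\<Union>i<N. ?E (a i) (mm i) (SS i)) \<le> (\<Sum>i<N. prob (?E (a i) (mm i) (SS i)))"
        by (rule finite_measure_subadditive_finite) (use am E in auto)
      also have "\<dots> \<le> (\<Sum>i<N. e / (2 * (real N + 1)))" by (intro sum_mono less_imp_le mS)
      also have "\<dots> = real N * (e / (2 * (real N + 1)))" by simp
      also have "\<dots> \<le> e / 2" using e by (simp add: field_simps)
      finally have "prob (?E ?U m S) < e" using diff by linarith
      then show ?thesis by blast
    qed
    then show ?case using am by auto
  qed
  then show "A \<in> sets M" and "e > 0 \<Longrightarrow> \<exists>m S. prob (?E A m S) < e" by auto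
qed

definition block :: "'a set set \<Rightarrow> 'a \<Rightarrow> 'a set" where "block P s = (THE A. A \<in> P \<and> s \<in> A)"

lemma block_eq_iff:
  assumes P: "partition_on UNIV P" and A: "A \<in> P"
  shows "block P s = A \<longleftrightarrow> s \<in> A"
proof -
  have u: "B = C" if "B \<in> P" "C \<in> P" "s \<in> B" "s \<in> C" for B C
    using disjointD[OF partition_onD2[OF P], of B C] that by blast
  obtain B where B: "B \<in> P" "s \<in> B" using partition_onD1[OF P] by blast
  have "block P s = B" unfolding block_def by (rule the_equality) (use B u in auto)
  then show ?thesis using u[OF B(1) A B(2)] B by auto
qed

lemma block_in:
  assumes P: "partition_on UNIV P"
  shows "block P s \<in> P"
proof -
  obtain B where B: "B \<in> P" "s \<in> B" using partition_onD1[OF P] by blast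
  then show ?thesis using block_eq_iff[OF P B(1), of s] by simp
qed

lemma iterated_join_words:
  assumes P: "partition_on UNIV P"
  shows "iterated_join T P n = (\<lambda>w. {s. word (block P) n s = w}) ` {w. set w \<subseteq> P \<and> length w = n}"
proof (induction n)
  case 0
  have "{w. set w \<subseteq> P \<and> length w = 0} = {[]}" by auto
  then show ?case by simp
next
  case (Suc n)
  let ?c = "\<lambda>n w. {s. word (block P) n s = w}"
  have c: "?c (Suc n) (A # w) = A \<inter> T -` ?c n w" if "A \<in> P" for A w
    using block_eq_iff[OF P that] by (auto simp: word_Suc)
  show ?case
  proof (intro equalityI subsetI)
    fix x assume "x \<in> iterated_join T P (Suc n)"
    then obtain A B where x: "x = A \<inter> T -` B" and A: "A \<in> P" and "B \<in> iterated_join T P n" by auto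
    then obtain w where w: "set w \<subseteq> P" "length w = n" "B = ?c n w" using Suc by auto
    have "x = ?c (Suc n) (A # w)" using c[OF A] x w by simp
    then show "x \<in> ?c (Suc n) ` {w. set w \<subseteq> P \<and> length w = Suc n}" using A w by (intro image_eqI[of _ _ "A # w"]) auto
  next
    fix x assume "x \<in> ?c (Suc n) ` {w. set w \<subseteq> P \<and> length w = Suc n}"
    then obtain v where v: "set v \<subseteq> P" "length v = Suc n" "x = ?c (Suc n) v" by blast
    then obtain A w where Aw: "v = A # w" by (cases v) auto
    have A: "A \<in> P" using v Aw by auto
    have "?c n w \<in> iterated_join T P n" using Suc v Aw by auto
    moreover have "x = A \<inter> T -` ?c n w" using c[OF A] v Aw by simp
    ultimately show "x \<in> iterated_join T P (Suc n)" unfolding iterated_join.simps using A by blast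
  qed
qed

lemma simple_function_block:
  assumes P: "partition_on UNIV P" "finite P" "P \<subseteq> sets M"
  shows "simple_function M (block P)"
  unfolding simple_function_def
proof (intro conjI ballI)
  have r: "block P ` space M \<subseteq> P" using block_in[OF P(1)] by auto
  then show "finite (block P ` space M)" using P(2) by (rule finite_subset)
  fix A assume "A \<in> block P ` space M"
  then have A: "A \<in> P" using r by auto
  then have "block P -` {A} \<inter> space M = A" using block_eq_iff[OF P(1) A] sets.sets_into_space P(3) by blast
  then show "block P -` {A} \<inter> space M \<in> sets M" using A P(3) by auto
qed

text \<open>Distinct words may both give the empty set, so the sum over the words may have more terms than the sum
  over the sets of the refinement; the additional terms vanish.\<close>

lemma entropy_wrt_eq:
  assumes P: "partition_on UNIV P" "finite P" "P \<subseteq> sets M" and sp: "space M = UNIV"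
  shows "entropy_wrt M T P = lim (\<lambda>n. ent (word (block P) n) / real n)"
proof -
  have "partition_entropy M (iterated_join T P n) = ent (word (block P) n)" for n
  proof -
    let ?W = "{w. set w \<subseteq> P \<and> length w = n}" and ?c = "\<lambda>w. {s. word (block P) n s = w}"
    have fin: "finite ?W" using P(2) by (rule finite_lists_length_eq)
    have "ent (word (block P) n) = - (\<Sum>w\<in>?W. prob {s \<in> space M. word (block P) n s = w} * ln (prob {s \<in> space M. word (block P) n s = w}))"
      by (rule ent_eq_sum[OF simple_function_word[OF simple_function_block[OF P]] fin])
        (auto simp: word_def block_in[OF P(1)])
    also have "\<dots> = - (\<Sum>w\<in>?W. prob (?c w) * ln (prob (?c w)))" by (simp add: sp)
    also have "(\<Sum>w\<in>?W. prob (?c w) * ln (prob (?c w))) = (\<Sum>A\<in>?c ` ?W. prob A * ln (prob A))"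
    proof (rule sum.reindex_nontrivial[OF fin, symmetric, unfolded comp_def])
      fix v w assume "v \<noteq> w" "?c v = ?c w"
      then have "?c v = {}" by blast
      then show "prob (?c v) * ln (prob (?c v)) = 0" by (simp only: measure_empty mult_zero_left)
    qed
    finally show ?thesis by (simp only: partition_entropy_def iterated_join_words[OF P(1)])
  qed
  then show ?thesis by (simp only: entropy_wrt_def)
qed

end

context expanding_circle
begin

text \<open>The index of the cylinder of length \<open>n\<close> that contains \<open>p\<close>: its digits in base \<open>K\<close> are the
  first \<open>n\<close> digits of the linear coordinate.\<close>

definition cyl :: "nat \<Rightarrow> circle \<Rightarrow> nat" where "cyl n p = nat \<lfloor>real K ^ n * coord p\<rfloor>"

lemma cyl_less: "cyl n p < K ^ n"
proof -
  have "real K ^ n * coord p < real K ^ n * 1" using coord_bounds[of p] by (intro mult_strict_left_mono) auto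
  then have "\<lfloor>real K ^ n * coord p\<rfloor> < int (K ^ n)" by (simp add: floor_less_iff)
  then show ?thesis unfolding cyl_def using coord_bounds[of p] by (simp add: nat_less_iff)
qed

lemma cyl_eq_iff: "cyl n p = j \<longleftrightarrow> real j \<le> real K ^ n * coord p \<and> real K ^ n * coord p < real j + 1"
proof -
  have "0 \<le> real K ^ n * coord p" using coord_bounds[of p] by simp
  then have "nat \<lfloor>real K ^ n * coord p\<rfloor> = j \<longleftrightarrow> \<lfloor>real K ^ n * coord p\<rfloor> = int j" by auto
  then show ?thesis unfolding cyl_def by (simp add: floor_eq_iff)
qed

lemma cyl_close:
  assumes "cyl n p = cyl n q" shows "\<bar>coord p - coord q\<bar> < 1 / real K ^ n"
proof -
  have "\<bar>real K ^ n * coord p - real K ^ n * coord q\<bar> < 1"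
    using cyl_eq_iff[of n p "cyl n p"] cyl_eq_iff[of n q "cyl n p"] assms by linarith
  then have "real K ^ n * \<bar>coord p - coord q\<bar> < 1" by (simp add: right_diff_distrib[symmetric] abs_mult)
  then show ?thesis by (simp add: field_simps)
qed

lemma cyl_Suc: "cyl (Suc n) p = cyl n (f p) + K ^ n * cyl 1 p"
proof -
  define i where "i = cyl 1 p"
  have i: "real i \<le> real K * coord p" "real K * coord p < real i + 1" using cyl_eq_iff[of 1 p i] by (auto simp: i_def)
  then have "\<lfloor>real K * coord p\<rfloor> = int i" by (intro floor_unique) auto
  then have f: "coord (f p) = real K * coord p - real i" by (simp add: coord_f frac_def)
  have "real (cyl n (f p)) \<le> real K ^ n * coord (f p)" "real K ^ n * coord (f p) < real (cyl n (f p)) + 1"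
    using cyl_eq_iff[of n "f p"] by blast+
  then show ?thesis unfolding cyl_eq_iff i_def[symmetric] unfolding f by (simp add: algebra_simps)
qed

text \<open>The coordinate jumps at the fixed point \<open>point 0\<close>; a set where it is below a bound is an open arc
  together with that point.\<close>

lemma borel_measurable_coord [measurable]: "coord \<in> borel_measurable borel"
  unfolding borel_measurable_iff_less
proof
  have op: "open (point ` {0<..<a})" if "a \<le> 1" for a
  proof -
    have "abs_circle -` (point ` {0<..<a}) = H -` (\<Union>k. {of_int k<..<of_int k + a})"
    proof -
      have "abs_circle y \<in> point ` {0<..<a} \<longleftrightarrow> H y \<in> (\<Union>k. {of_int k<..<of_int k + a})" for y
      proof -
        have y: "abs_circle y = point (H y)" by (simp add: point_def)
        have "point (H y) \<in> point ` {0<..<a} \<longleftrightarrow> (\<exists>x\<in>{0<..<a}. H y - x \<in> \<int>)"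
          by (simp add: image_iff point_eq_iff)
        also have "\<dots> \<longleftrightarrow> (\<exists>k. H y - of_int k \<in> {0<..<a})"
        proof
          assume "\<exists>x\<in>{0<..<a}. H y - x \<in> \<int>"
          then obtain x k where "x \<in> {0<..<a}" "H y - x = of_int k" by (auto elim: Ints_cases)
          moreover from this have "H y - of_int k = x" by simp
          ultimately show "\<exists>k. H y - of_int k \<in> {0<..<a}" by metis
        next
          assume "\<exists>k. H y - of_int k \<in> {0<..<a}"
          then obtain k where k: "H y - of_int k \<in> {0<..<a}" ..
          have "H y - (H y - of_int k) \<in> \<int>" by simp
          with k show "\<exists>x\<in>{0<..<a}. H y - x \<in> \<int>" by blast
        qed
        also have "\<dots> \<longleftrightarrow> H y \<in> (\<Union>k. {of_int k<..<of_int k + a})" by (auto simp: algebra_simps)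
        finally show ?thesis by (simp only: y)
      qed
      then show ?thesis unfolding vimage_def by (simp only:)
    qed
    moreover have "open (H -` (\<Union>k. {of_int k<..<of_int k + a}))"
      by (rule open_vimage[OF _ H_cont]) auto
    ultimately show ?thesis by (simp add: open_circle_def)
  qed
  have im: "p \<in> point ` {0<..<a} \<longleftrightarrow> 0 < coord p \<and> coord p < a" if "a \<le> 1" for a p
  proof
    assume "p \<in> point ` {0<..<a}"
    then obtain x where "p = point x" "0 < x" "x < a" by auto
    then show "0 < coord p \<and> coord p < a" using that by (simp add: coord_point frac_eq[THEN iffD2])
  next
    assume "0 < coord p \<and> coord p < a"
    then show "p \<in> point ` {0<..<a}" by (intro image_eqI[of _ _ "coord p"]) auto
  qed
  fix a :: real
  consider "a \<le> 0" | "0 < a" "a \<le> 1" | "a > 1" by linarith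
  then show "{p \<in> space borel. coord p < a} \<in> sets borel"
  proof cases
    case 1
    then have "{p \<in> space borel. coord p < a} = {}" using coord_bounds(1) by (auto simp: not_less intro: order_trans)
    then show ?thesis by (simp only: sets.empty_sets)
  next
    case 2
    have "{p \<in> space borel. coord p < a} = point ` {0<..<a} \<union> - (point ` {0<..<1})"
      using im[OF 2(2)] im[OF order_refl] coord_bounds 2 by (auto simp: not_less)
    moreover have "point ` {0<..<a} \<in> sets borel" "point ` {0<..<1} \<in> sets borel"
      using op[OF 2(2)] op[OF order_refl] by simp_all
    ultimately show ?thesis by simp
  next
    case 3
    then have "{p \<in> space borel. coord p < a} = UNIV" using coord_bounds(2) by (auto intro: less_trans)
    then show ?thesis by simp
  qed
qed

lemma continuous_on_point: "continuous_on UNIV point"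
  unfolding point_def[abs_def] by (rule continuous_on_compose2[OF continuous_on_abs_circle G_cont]) auto

lemma point_measurable [measurable]: "point \<in> borel_measurable borel"
  by (rule borel_measurable_continuous_onI[OF continuous_on_point])

lemma f_measurable [measurable]: "f \<in> borel_measurable borel"
proof -
  have "f p = point (real K * coord p)" for p using f_point[of "coord p"] by simp
  then have "f = (\<lambda>p. point (real K * coord p))" by auto
  then show ?thesis by simp
qed

lemma cyl_measurable: "{p. cyl n p = j} \<in> sets borel"
proof -
  have "{p \<in> space borel. real j \<le> real K ^ n * coord p \<and> real K ^ n * coord p < real j + 1} \<in> sets borel" by measurable
  then show ?thesis by (simp add: cyl_eq_iff)
qed

lemma simple_function_cyl:
  assumes "sets M = sets borel" shows "simple_function M (cyl n)" unfolding simple_function_def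
proof (intro conjI ballI)
  show "finite (cyl n ` space M)" by (rule finite_subset[of _ "{..<K ^ n}"]) (auto simp: cyl_less)
  fix j
  have "space M = UNIV" using sets_eq_imp_space_eq[OF assms] by simp
  then have "cyl n -` {j} \<inter> space M = {p. cyl n p = j}" by auto
  then show "cyl n -` {j} \<inter> space M \<in> sets M" using cyl_measurable assms by simp
qed

lemma word_cyl:
  assumes "mpt M f"
  shows "mpt.word f (cyl 1) n p = mpt.word f (cyl 1) n q \<longleftrightarrow> cyl n p = cyl n q"
proof -
  interpret mpt M f by fact
  show ?thesis
  proof (induction n arbitrary: p q)
    case 0
    show ?case using cyl_less[of 0 p] cyl_less[of 0 q] by simp
  next
    case (Suc n)
    have "cyl (Suc n) p mod K ^ n = cyl n (f p) \<and> cyl (Suc n) p div K ^ n = cyl 1 p" for p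
      unfolding cyl_Suc using cyl_less[of n "f p"] by simp
    then have "cyl (Suc n) p = cyl (Suc n) q \<longleftrightarrow> cyl 1 p = cyl 1 q \<and> cyl n (f p) = cyl n (f q)"
      by (metis cyl_Suc)
    then show ?case by (simp add: word_Suc Suc del: One_nat_def)
  qed
qed

lemma cyl_generate:
  assumes M: "mpt M f" "sets M = sets borel" and A: "A \<in> sets M"
  shows "A \<in> sigma_sets (space M) {{s \<in> space M. mpt.word f (cyl 1) m s = w} | m w. True}"
proof -
  interpret mpt M f by fact
  have sp: "space M = UNIV" using sets_eq_imp_space_eq[OF M(2)] by simp
  let ?G = "{{s \<in> space M. word (cyl 1) m s = w} | m w. True}"
  have cG: "countable ?G"
  proof -
    have "?G = (\<lambda>(m, w). {s \<in> space M. word (cyl 1) m s = w}) ` (UNIV :: (nat \<times> nat list) set)" by auto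
    then show ?thesis by simp
  qed
  have op: "U \<in> sigma_sets (space M) ?G" if U: "open U" for U
  proof -
    have "U = \<Union>{C \<in> ?G. C \<subseteq> U}"
    proof (intro equalityI subsetI)
      fix p assume p: "p \<in> U"
      have "open (point -` U)" by (rule open_vimage[OF U continuous_on_point])
      moreover have "coord p \<in> point -` U" using p by simp
      ultimately obtain d where d: "d > 0" "\<And>x. dist x (coord p) < d \<Longrightarrow> x \<in> point -` U" unfolding open_dist by blast
      obtain m where "(1 / real K) ^ m < d" using real_arch_pow_inv[OF d(1), of "1 / real K"] K2 by auto
      then have m: "1 / real K ^ m < d" by (simp add: power_one_over)
      let ?C = "{s \<in> space M. word (cyl 1) m s = word (cyl 1) m p}"
      have "?C \<subseteq> U"
      proof
        fix q assume "q \<in> ?C"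
        then have "cyl m q = cyl m p" using word_cyl[OF M(1), of m q p] by simp
        from cyl_close[OF this] m have "coord q \<in> point -` U" by (intro d(2)) (simp add: dist_real_def)
        then show "q \<in> U" by simp
      qed
      moreover have "?C \<in> ?G" by blast
      moreover have "p \<in> ?C" by (simp add: sp)
      ultimately show "p \<in> \<Union>{C \<in> ?G. C \<subseteq> U}" by blast
    qed blast
    moreover have "\<Union>{C \<in> ?G. C \<subseteq> U} \<in> sigma_sets (space M) ?G"
    proof (rule sigma_sets_UNION)
      show "countable {C \<in> ?G. C \<subseteq> U}" by (rule countable_subset[OF _ cG]) blast
      show "C \<in> sigma_sets (space M) ?G" if "C \<in> {C \<in> ?G. C \<subseteq> U}" for C
        using that by (intro sigma_sets.Basic) blast
    qed
    ultimately show ?thesis by simp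
  qed
  have "A \<in> sigma_sets UNIV {S. open S}" using A M(2) by (simp add: borel_def)
  then show ?thesis using sigma_sets_mono[of "{S. open S}" "space M" ?G] op sp by auto
qed

text \<open>Lebesgue measure in the linear coordinate, the measure that turns out to have maximal entropy.\<close>

definition parry :: "circle measure" where "parry = distr (uniform_measure lborel {0..<1}) borel point"

lemma emeasure_parry:
  assumes "A \<in> sets borel" shows "emeasure parry A = emeasure lborel (point -` A \<inter> {0..<1})"
proof -
  have "point -` A \<in> sets borel" using measurable_sets[OF point_measurable assms] by simp
  then show ?thesis unfolding parry_def using assms
    by (subst emeasure_distr) (auto simp: Int_commute divide_ennreal_def measurable_cong_sets[OF sets_uniform_measure refl])
qed

lemma parry_prob: "prob_space parry"
proof -
  interpret U: prob_space "uniform_measure lborel {0..<1 :: real}"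
    by (rule prob_space_uniform_measure) auto
  show ?thesis unfolding parry_def
    by (rule U.prob_space_distr) (simp add: measurable_cong_sets[OF sets_uniform_measure refl])
qed

lemma sets_parry: "sets parry = sets borel"
  by (simp add: parry_def)

lemma parry_cyl:
  assumes "j < K ^ n" shows "measure parry {p. cyl n p = j} = 1 / real K ^ n"
proof -
  have N: "real K ^ n > 0" by simp
  have j: "real j + 1 \<le> real K ^ n"
  proof -
    have "j + 1 \<le> K ^ n" using assms by simp
    then have "real (j + 1) \<le> real (K ^ n)" by (rule of_nat_mono)
    then show ?thesis by simp
  qed
  have "point -` {p. cyl n p = j} \<inter> {0..<1} = {real j / real K ^ n..<(real j + 1) / real K ^ n}"
  proof (intro set_eqI)
    fix x
    show "x \<in> point -` {p. cyl n p = j} \<inter> {0..<1} \<longleftrightarrow> x \<in> {real j / real K ^ n..<(real j + 1) / real K ^ n}"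
    proof (cases "0 \<le> x \<and> x < 1")
      case True
      then have "coord (point x) = x" by (simp add: coord_point frac_eq)
      then show ?thesis using True by (auto simp: cyl_eq_iff field_simps)
    next
      case False
      moreover have "0 \<le> real j / real K ^ n" "(real j + 1) / real K ^ n \<le> 1" using j by auto
      ultimately show ?thesis by (meson IntE atLeastLessThan_iff order_trans less_le_trans)
    qed
  qed
  then have "emeasure parry {p. cyl n p = j} = ennreal ((real j + 1) / real K ^ n - real j / real K ^ n)"
    by (subst emeasure_parry[OF cyl_measurable]) (simp add: divide_right_mono)
  also have "(real j + 1) / real K ^ n - real j / real K ^ n = 1 / real K ^ n" by (simp add: add_divide_distrib)
  finally show ?thesis by (simp add: measure_def)
qed

lemma lborel_periodic_dilate:
  fixes B :: "real set"
  assumes B: "B \<in> sets borel" and per: "\<And>x k :: nat. x + real k \<in> B \<longleftrightarrow> x \<in> B"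
  shows "emeasure lborel ({x. real K * x \<in> B} \<inter> {0..<1}) = emeasure lborel (B \<inter> {0..<1})"
proof -
  have Bm: "B \<inter> {real j..<real j + 1} \<in> sets borel" for j using B by auto
  have tr: "emeasure lborel (B \<inter> {real j..<real j + 1}) = emeasure lborel (B \<inter> {0..<1})" for j
  proof -
    have "emeasure lborel (B \<inter> {real j..<real j + 1}) = (\<integral>\<^sup>+ x. indicator (B \<inter> {real j..<real j + 1}) x \<partial>lborel)"
      using Bm by simp
    also have "\<dots> = ennreal \<bar>1\<bar> * (\<integral>\<^sup>+ x. indicator (B \<inter> {real j..<real j + 1}) (real j + 1 * x) \<partial>lborel)"
      by (rule nn_integral_real_affine) (use Bm in auto)
    also have "\<dots> = (\<integral>\<^sup>+ x. indicator (B \<inter> {0..<1}) x \<partial>lborel)"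
    proof -
      have "indicator (B \<inter> {real j..<real j + 1}) (real j + 1 * x) = (indicator (B \<inter> {0..<1}) x :: ennreal)" for x
        using per[of x j] by (auto simp: indicator_def add.commute)
      then show ?thesis by simp
    qed
    also have "\<dots> = emeasure lborel (B \<inter> {0..<1})" using B by simp
    finally show ?thesis .
  qed
  have un: "B \<inter> {0..<real K} = (\<Union>j<K. B \<inter> {real j..<real j + 1})"
  proof (intro equalityI subsetI)
    fix x assume x: "x \<in> B \<inter> {0..<real K}"
    then have "real (nat \<lfloor>x\<rfloor>) \<le> x" "x < real (nat \<lfloor>x\<rfloor>) + 1" "nat \<lfloor>x\<rfloor> < K"
      by (auto simp: nat_less_iff floor_less_iff)
    then show "x \<in> (\<Union>j<K. B \<inter> {real j..<real j + 1})" using x by auto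
  next
    fix x assume "x \<in> (\<Union>j<K. B \<inter> {real j..<real j + 1})"
    then obtain j where "j < K" "x \<in> B" "real j \<le> x" "x < real j + 1" by auto
    moreover from this have "real j + 1 \<le> real K" by linarith
    ultimately show "x \<in> B \<inter> {0..<real K}" by auto
  qed
  have disj: "disjoint_family_on (\<lambda>j. B \<inter> {real j..<real j + 1}) {..<K}"
    unfolding disjoint_family_on_def by (auto) 
  have "emeasure lborel (B \<inter> {0..<real K}) = (\<Sum>j<K. emeasure lborel (B \<inter> {real j..<real j + 1}))"
    unfolding un by (rule sum_emeasure[symmetric]) (use Bm disj in auto)
  also have "\<dots> = of_nat K * emeasure lborel (B \<inter> {0..<1})" by (simp add: tr)
  finally have 1: "emeasure lborel (B \<inter> {0..<real K}) = of_nat K * emeasure lborel (B \<inter> {0..<1})" .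
  have BK: "B \<inter> {0..<real K} \<in> sets borel" using B by auto
  have "emeasure lborel (B \<inter> {0..<real K}) = (\<integral>\<^sup>+ x. indicator (B \<inter> {0..<real K}) x \<partial>lborel)" using BK by simp
  also have "\<dots> = \<bar>real K\<bar> * (\<integral>\<^sup>+ x. indicator (B \<inter> {0..<real K}) (0 + real K * x) \<partial>lborel)"
    by (rule nn_integral_real_affine) (use BK in auto)
  also have "(\<integral>\<^sup>+ x. indicator (B \<inter> {0..<real K}) (0 + real K * x) \<partial>lborel) = (\<integral>\<^sup>+ x. indicator ({x. real K * x \<in> B} \<inter> {0..<1}) x \<partial>lborel)"
  proof -
    have "0 \<le> real K * x \<longleftrightarrow> 0 \<le> x" "real K * x < real K \<longleftrightarrow> x < 1" for x
      by (simp_all add: zero_le_mult_iff)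
    then have "indicator (B \<inter> {0..<real K}) (0 + real K * x) = (indicator ({x. real K * x \<in> B} \<inter> {0..<1}) x :: ennreal)" for x
      by (auto simp: indicator_def)
    then show ?thesis by simp
  qed
  also have "\<dots> = emeasure lborel ({x. real K * x \<in> B} \<inter> {0..<1})"
  proof -
    have "(\<lambda>x :: real. real K * x) -` B \<inter> space borel \<in> sets borel" by (rule measurable_sets[OF _ B]) simp
    then show ?thesis by (simp add: vimage_def)
  qed
  finally have "of_nat K * emeasure lborel ({x. real K * x \<in> B} \<inter> {0..<1}) = of_nat K * emeasure lborel (B \<inter> {0..<1})"
    using 1 by (simp add: ennreal_of_nat_eq_real_of_nat)
  then show ?thesis by (subst (asm) ennreal_mult_cancel_left) (auto simp: ennreal_of_nat_eq_real_of_nat)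
qed

lemma parry_invariant: "invariant_prob f parry"
  unfolding invariant_prob_def
proof (intro conjI parry_prob sets_parry)
  show fm: "f \<in> parry \<rightarrow>\<^sub>M parry" using f_measurable by (simp add: measurable_cong_sets[OF sets_parry sets_parry])
  show "distr parry parry f = parry"
  proof (rule measure_eqI)
    fix A assume "A \<in> sets (distr parry parry f)"
    then have A: "A \<in> sets borel" by (simp add: sets_parry)
    have fA: "f -` A \<in> sets borel" using measurable_sets[OF f_measurable A] by simp
    have B: "point -` A \<in> sets borel" using measurable_sets[OF point_measurable A] by simp
    have sp: "space parry = UNIV" by (simp add: parry_def)
    have "emeasure (distr parry parry f) A = emeasure parry (f -` A)"
      using A sp by (subst emeasure_distr[OF fm]) (auto simp: sets_parry)
    also have "\<dots> = emeasure lborel ({x. real K * x \<in> point -` A} \<inter> {0..<1})"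
      by (subst emeasure_parry[OF fA]) (simp add: vimage_def f_point)
    also have "\<dots> = emeasure lborel (point -` A \<inter> {0..<1})"
    proof (rule lborel_periodic_dilate[OF B])
      have "point (x + real k) = point x" for x k by (simp add: point_eq_iff)
      then show "x + real k \<in> point -` A \<longleftrightarrow> x \<in> point -` A" for x k by simp
    qed
    also have "\<dots> = emeasure parry A" by (rule emeasure_parry[OF A, symmetric])
    finally show "emeasure (distr parry parry f) A = emeasure parry A" .
  qed simp
qed

lemma mpt_of_invariant:
  assumes "invariant_prob f M" shows "mpt M f"
  using assms by (simp add: mpt_def mpt_axioms_def invariant_prob_def)

lemma ent_word_cyl:
  assumes M: "mpt M f" "sets M = sets borel"
  shows "prob_space.ent M (mpt.word f (cyl 1) n) = prob_space.ent M (cyl n)"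
proof -
  interpret mpt M f by fact
  show ?thesis
    by (rule ent_cong[OF simple_function_word[OF simple_function_cyl[OF M(2)]] simple_function_cyl[OF M(2)]])
      (simp_all add: determines_def word_cyl[OF M(1)] del: One_nat_def)
qed

lemma metric_entropy_le:
  assumes M: "mpt M f" "sets M = sets borel" and k: "k \<ge> 1"
  shows "metric_entropy M f \<le> ereal (prob_space.ent M (cyl k) / real k)"
proof -
  interpret mpt M f by fact
  have sp: "space M = UNIV" using sets_eq_imp_space_eq[OF M(2)] by simp
  note D = simple_function_cyl[OF M(2), of 1]
  show ?thesis unfolding metric_entropy_def
  proof (rule SUP_least)
    fix P assume "P \<in> {P. finite P \<and> partition_on UNIV P \<and> P \<subseteq> sets M}"
    then have P: "partition_on UNIV P" "finite P" "P \<subseteq> sets M" by auto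
    have "lim (\<lambda>n. ent (word (block P) n) / real n) \<le> ent (word (cyl 1) k) / real k"
      by (rule entropy_rate_le[OF simple_function_block[OF P] D k])
        (rule approx_by_words(2)[OF D cyl_generate[OF M]])
    then show "ereal (entropy_wrt M f P) \<le> ereal (ent (cyl k) / real k)"
      by (simp add: entropy_wrt_eq[OF P sp] ent_word_cyl[OF M] del: One_nat_def)
  qed
qed

text \<open>The entropy is computed for the partition into cylinders of length \<open>1\<close>, whose words of length \<open>n\<close> are
  uniformly distributed over \<open>K ^ n\<close> values.\<close>

lemma metric_entropy_parry_ge: "ereal (ln (real K)) \<le> metric_entropy parry f"
proof -
  have M: "mpt parry f" by (rule mpt_of_invariant[OF parry_invariant])
  interpret mpt parry f by fact
  have sp: "space parry = UNIV" by (simp add: parry_def)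
  note D = simple_function_cyl[OF sets_parry]
  define P where "P = (\<lambda>j. {p. cyl 1 p = j}) ` {..<K}"
  have ne: "\<exists>p. cyl 1 p = j" if "j < K" for j
  proof (rule exI[of _ "point (real j / real K)"])
    have "frac (real j / real K) = real j / real K" using that by (simp add: frac_eq)
    then show "cyl 1 (point (real j / real K)) = j" by (simp add: cyl_eq_iff coord_point)
  qed
  have P1: "partition_on UNIV P"
  proof (rule partition_onI)
    show "\<Union>P = UNIV" using cyl_less[of 1] by (auto simp: P_def)
    show "{} \<notin> P" using ne by (auto simp: P_def)
    show "disjnt p q" if "p \<in> P" "q \<in> P" "p \<noteq> q" for p q using that by (auto simp: P_def disjnt_def)
  qed
  have P: "partition_on UNIV P" "finite P" "P \<subseteq> sets parry"
    using P1 cyl_measurable by (auto simp: P_def sets_parry)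
  have bl: "block P p = {q. cyl 1 q = cyl 1 p}" for p
    using block_eq_iff[OF P1, of "{q. cyl 1 q = cyl 1 p}" p] cyl_less[of 1 p] by (auto simp: P_def)
  have ent: "ent (word (block P) n) / real n = ln (real K)" if n: "n \<ge> 1" for n
  proof -
    have w: "word (block P) n p = map (\<lambda>j. {q. cyl 1 q = j}) (word (cyl 1) n p)" for p
      by (simp add: word_def bl)
    have "ent (word (block P) n) = ent (word (cyl 1) n)"
    proof (rule ent_cong[OF simple_function_word[OF simple_function_block[OF P]] simple_function_word[OF D]])
      show "determines (word (cyl 1) n) (word (block P) n)" by (simp add: determines_def w)
      have inv: "map (\<lambda>A. THE j. \<exists>q\<in>A. cyl 1 q = j) (word (block P) n p) = word (cyl 1) n p" for p
      proof -
        have "(THE j. \<exists>q\<in>{q. cyl 1 q = cyl 1 r}. cyl 1 q = j) = cyl 1 r" for r by (rule the_equality) auto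
        then show ?thesis by (simp add: word_def bl)
      qed
      show "determines (word (block P) n) (word (cyl 1) n)" unfolding determines_def
      proof (intro ballI impI)
        fix p q assume "word (block P) n p = word (block P) n q"
        then show "word (cyl 1) n p = word (cyl 1) n q" unfolding inv[symmetric] by (rule arg_cong)
      qed
    qed
    also have "\<dots> = ent (cyl n)" by (rule ent_word_cyl[OF M sets_parry])
    also have "\<dots> = ln (real (K ^ n))"
      by (rule ent_uniform[OF D, of "{..<K ^ n}"]) (auto simp: cyl_less sp parry_cyl)
    also have "\<dots> = real n * ln (real K)" by (simp add: ln_realpow)
    finally show ?thesis using n by simp
  qed
  have "(\<lambda>n. ent (word (block P) n) / real n) \<longlonglongrightarrow> ln (real K)"
    by (rule tendsto_eventually) (use ent in \<open>auto simp: eventually_sequentially\<close>)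
  then have "entropy_wrt parry f P = ln (real K)" unfolding entropy_wrt_eq[OF P sp] by (rule limI)
  then show ?thesis unfolding metric_entropy_def by (intro SUP_upper2[of P]) (use P in auto)
qed

text \<open>The entropy of \<open>\<mu>\<close> is at least \<open>ln K\<close> by maximality and at most the entropy of the cylinders of
  length \<open>n\<close> divided by \<open>n\<close>, so these cylinders are uniformly distributed.\<close>

theorem max_entropy_uniform:
  assumes \<mu>: "max_entropy_measure f \<mu>" and j: "j < K ^ n"
  shows "measure \<mu> {p. cyl n p = j} = 1 / real K ^ n"
proof (cases "n = 0")
  case True
  have "prob_space \<mu>" "sets \<mu> = sets borel" using \<mu> by (auto simp: max_entropy_measure_def invariant_prob_def)
  then have "measure \<mu> UNIV = 1" using prob_space.prob_space sets_eq_imp_space_eq by (metis space_borel)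
  moreover have "{p. cyl 0 p = 0} = UNIV" using cyl_less[of 0] by auto
  ultimately show ?thesis using True j by simp
next
  case False
  have inv: "invariant_prob f \<mu>" and max: "metric_entropy parry f \<le> metric_entropy \<mu> f"
    using \<mu> parry_invariant by (auto simp: max_entropy_measure_def)
  have M: "mpt \<mu> f" by (rule mpt_of_invariant[OF inv])
  have s: "sets \<mu> = sets borel" using inv by (simp add: invariant_prob_def)
  interpret mpt \<mu> f by fact
  have sp: "space \<mu> = UNIV" using sets_eq_imp_space_eq[OF s] by simp
  have "ereal (ln (real K)) \<le> ereal (ent (cyl n) / real n)"
    using metric_entropy_parry_ge max metric_entropy_le[OF M s, of n] False by (metis One_nat_def Suc_leI not_gr_zero order_trans)
  then have "ln (real (K ^ n)) \<le> ent (cyl n)" using False by (simp add: ln_realpow field_simps)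
  from ent_max_uniform[OF simple_function_cyl[OF s] _ _ _ _ this, of "{..<K ^ n}" j] j cyl_less
  show ?thesis by (auto simp: sp)
qed

theorem lyapunov_eq_mean:
  assumes \<mu>: "max_entropy_measure f \<mu>"
  shows "lyapunov_exponent f \<mu> = mean \<phi>"
proof -
  have inv: "invariant_prob f \<mu>" using \<mu> by (simp add: max_entropy_measure_def)
  have s [measurable_cong]: "sets \<mu> = sets borel" using inv by (simp add: invariant_prob_def)
  interpret prob_space \<mu> using inv by (simp add: invariant_prob_def)
  have sp: "space \<mu> = UNIV" using sets_eq_imp_space_eq[OF s] by simp
  have [measurable]: "\<phi> \<in> borel_measurable borel"
    by (rule borel_measurable_continuous_onI[OF hoelder_continuous[OF hoelder_\<phi>]])
  have m: "(\<lambda>p. \<phi> (coord p)) \<in> borel_measurable \<mu>" by measurable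
  have int: "integrable \<mu> (\<lambda>p. \<phi> (coord p))"
    by (rule integrable_const_bound[OF _ m]) (use hoelder_bounded[OF hoelder_\<phi>] in auto)
  have L: "lyapunov_exponent f \<mu> = (\<integral>p. \<phi> (coord p) \<partial>\<mu>)"
    unfolding lyapunov_exponent_def using circle_deriv_point[of "coord _"] by simp
  have b: "\<bar>(\<integral>p. \<phi> (coord p) \<partial>\<mu>) - mean \<phi>\<bar> \<le> 2 * \<Lambda> * (1 / \<kappa>) ^ n" for n
  proof -
    let ?g = "\<lambda>j. \<phi> (real j / real K ^ n)"
    note C = simple_function_cyl[OF s, of n]
    have "(\<integral>p. ?g (cyl n p) \<partial>\<mu>) = (\<Sum>j\<in>cyl n ` space \<mu>. prob {p \<in> space \<mu>. cyl n p = j} * ?g j)"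
      by (rule integral_simple(2)[OF C])
    also have "\<dots> = (\<Sum>j<K ^ n. prob {p \<in> space \<mu>. cyl n p = j} * ?g j)"
    proof (rule sum.mono_neutral_left)
      show "\<forall>i\<in>{..<K ^ n} - cyl n ` space \<mu>. prob {p \<in> space \<mu>. cyl n p = i} * ?g i = 0"
      proof
        fix i assume "i \<in> {..<K ^ n} - cyl n ` space \<mu>"
        then have "{p \<in> space \<mu>. cyl n p = i} = {}" by auto
        then show "prob {p \<in> space \<mu>. cyl n p = i} * ?g i = 0" by (simp only: measure_empty mult_zero_left)
      qed
    qed (auto simp: cyl_less)
    also have "\<dots> = avg n \<phi> 0"
      using max_entropy_uniform[OF \<mu>, of _ n] by (simp add: sp avg_def sum_divide_distrib)
    finally have a: "(\<integral>p. ?g (cyl n p) \<partial>\<mu>) = avg n \<phi> 0" .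
    have "\<bar>\<phi> (coord p) - ?g (cyl n p)\<bar> \<le> \<Lambda> * (1 / \<kappa>) ^ n" for p
    proof (rule hoelder_modulus[OF hoelder_\<phi>])
      have "0 \<le> real K ^ n * coord p - real (cyl n p)" "real K ^ n * coord p - real (cyl n p) < 1"
        using cyl_eq_iff[of n p "cyl n p"] by auto
      moreover have "coord p - real (cyl n p) / real K ^ n = (real K ^ n * coord p - real (cyl n p)) / real K ^ n"
        by (simp add: field_simps)
      ultimately show "\<bar>coord p - real (cyl n p) / real K ^ n\<bar> \<le> 1 / real K ^ n" by (simp add: divide_right_mono)
    qed
    then have "\<bar>\<integral>p. \<phi> (coord p) - ?g (cyl n p) \<partial>\<mu>\<bar> \<le> (\<integral>p. \<Lambda> * (1 / \<kappa>) ^ n \<partial>\<mu>)"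
      using integral_simple(1)[OF C, of ?g] int by (intro order_trans[OF integral_abs_bound] integral_mono) auto
    then have "\<bar>(\<integral>p. \<phi> (coord p) \<partial>\<mu>) - avg n \<phi> 0\<bar> \<le> \<Lambda> * (1 / \<kappa>) ^ n"
      using integral_simple(1)[OF C, of ?g] int a prob_space by simp
    then show ?thesis using avg_mean[OF hoelder_\<phi>, of n 0] by linarith
  qed
  then have "\<bar>(\<integral>p. \<phi> (coord p) \<partial>\<mu>) - mean \<phi>\<bar> \<le> 0" by (rule le_geometric_imp_nonpos)
  then show ?thesis using L by simp
qed

end

section \<open>Counting and Gaussian integrals\<close>

lemma gauss_integral:
  assumes "ereal a < b"
  shows "1 / sqrt (2 * pi) * (LBINT x=ereal a..b. exp (- (x\<^sup>2) / 2))
    = (case b of ereal c \<Rightarrow> Phi c | _ \<Rightarrow> 1) - Phi a"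
proof (cases b)
  case (real c)
  then have ac: "a \<le> c" using assms by simp
  have "1 / sqrt (2 * pi) * (LBINT x=ereal a..b. exp (- (x\<^sup>2) / 2)) = (LBINT x=ereal a..ereal c. std_normal_density x)"
    unfolding real std_normal_density_def by (subst interval_lebesgue_integral_mult_right) simp
  also have "\<dots> = (LINT x|lborel. indicator {a<..<c} x * std_normal_density x)"
    using ac by (simp add: interval_lebesgue_integral_def set_lebesgue_integral_def)
  also have "\<dots> = (LINT x|lborel. indicator {a<..c} x * std_normal_density x)"
  proof (rule integral_cong_AE)
    have "AE x in lborel. x \<noteq> c" by (rule AE_lborel_singleton)
    then show "AE x in lborel. indicator {a<..<c} x * std_normal_density x = indicator {a<..c} x * std_normal_density x"
      by eventually_elim (auto simp: indicator_def)
  qed measurable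
  also have "\<dots> = Phi c - Phi a" by (rule Phi_diff[OF ac, symmetric])
  finally show ?thesis using real by simp
next
  case PInf
  have "1 / sqrt (2 * pi) * (LBINT x=ereal a..b. exp (- (x\<^sup>2) / 2)) = (LBINT x=ereal a..\<infinity>. std_normal_density x)"
    unfolding PInf std_normal_density_def by (subst interval_lebesgue_integral_mult_right) simp
  also have "\<dots> = (LINT x|lborel. indicator {a<..} x * std_normal_density x)"
    by (simp add: interval_lebesgue_integral_def set_lebesgue_integral_def)
  also have "\<dots> = (LINT x|std_normal_distribution. indicator {a<..} x)"
    by (subst integral_density) (auto simp: normal_density_nonneg mult.commute)
  also have "\<dots> = measure std_normal_distribution {a<..}" by simp
  also have "\<dots> = measure std_normal_distribution (space std_normal_distribution - {..a})"
    by (intro arg_cong[where f = "measure std_normal_distribution"]) auto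
  also have "\<dots> = 1 - Phi a" unfolding cdf_def by (rule stdn.prob_compl) simp
  finally show ?thesis using PInf by simp
qed (use assms in simp)

text \<open>The left end point of a closed interval calls for the probability of \<open>X p < a\<close>, which obeys the same
  bound because the normal distribution function is continuous.\<close>

lemma interval_of_cdf_bound:
  fixes X :: "'a \<Rightarrow> real"
  assumes A: "finite A" "A \<noteq> {}" and d: "\<And>x. \<bar>real (card {p\<in>A. X p \<le> x}) / card A - Phi x\<bar> \<le> d"
    and ab: "ereal a < b"
  shows "\<bar>real (card {p\<in>A. ereal (X p) \<in> {ereal a..b}}) / card A
     - 1 / sqrt (2 * pi) * (LBINT x=ereal a..b. exp (- (x\<^sup>2) / 2))\<bar> \<le> 2 * d"
proof -
  let ?lt = "real (card {p\<in>A. X p < a}) / card A"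
  have cA: "card A > 0" using A by (simp add: card_gt_0_iff)
  have lt: "\<bar>?lt - Phi a\<bar> \<le> d"
  proof -
    have "?lt \<le> real (card {p\<in>A. X p \<le> a}) / card A"
      using A by (intro divide_right_mono of_nat_mono card_mono) auto
    then have 1: "?lt \<le> Phi a + d" using d[of a] by linarith
    have "Phi a - d \<le> ?lt"
    proof (rule field_le_epsilon)
      fix h :: real assume h: "h > 0"
      have "real (card {p\<in>A. X p \<le> a - h}) / card A \<le> ?lt"
        using A h by (intro divide_right_mono of_nat_mono card_mono) auto
      moreover have "Phi a - h \<le> Phi (a - h)" using Phi_lipschitz[of a "a - h"] h by linarith
      ultimately show "Phi a - d \<le> ?lt + h" using d[of "a - h"] by linarith
    qed
    with 1 show ?thesis by linarith
  qed
  let ?B = "{p\<in>A. ereal (X p) \<in> {ereal a..b}}"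
  let ?C = "{p\<in>A. ereal (X p) \<le> b}"
  have "?C = ?B \<union> {p\<in>A. X p < a}" "?B \<inter> {p\<in>A. X p < a} = {}"
    using ab by (auto simp: not_less) (metis dual_order.strict_trans1 ereal_less_eq(3) less_imp_le not_less order_trans linorder_le_less_linear less_ereal.simps(1))+
  then have "card ?C = card ?B + card {p\<in>A. X p < a}" using A by (simp add: card_Un_disjoint)
  then have B: "real (card ?B) / card A = real (card ?C) / card A - ?lt" by (simp add: add_divide_distrib)
  have C: "\<bar>real (card ?C) / card A - (case b of ereal c \<Rightarrow> Phi c | _ \<Rightarrow> 1)\<bar> \<le> d"
  proof (cases b)
    case (real c)
    then show ?thesis using d[of c] by simp
  next
    case PInf
    have "d \<ge> 0" using d[of 0] by linarith
    then show ?thesis using PInf cA by simp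
  qed (use ab in simp)
  show ?thesis unfolding gauss_integral[OF ab] B using C lt by linarith
qed

text \<open>Removes the second copy of the fixed point from the count.\<close>

lemma drop_last_ratio:
  assumes N: "N \<ge> (2 :: nat)"
  shows "\<bar>real (card {j. j < N - 1 \<and> Q j}) / real (N - 1) - real (card {j. j < N \<and> Q j}) / real N\<bar> \<le> 1 / real N"
proof -
  define c where "c = card {j. j < N - 1 \<and> Q j}"
  have c: "c \<le> N - 1" unfolding c_def using card_mono[of "{..<N - 1}" "{j. j < N - 1 \<and> Q j}"] by auto
  have "card {j. j < N \<and> Q j} = c + (if Q (N - 1) then 1 else 0)"
  proof (cases N)
    case (Suc M)
    have "{j. j < N \<and> Q j} = (if Q M then insert M {j. j < M \<and> Q j} else {j. j < M \<and> Q j})"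
      unfolding Suc by (auto simp: less_Suc_eq)
    then show ?thesis by (simp add: c_def Suc)
  qed (use N in simp)
  then obtain e :: real where e: "real (card {j. j < N \<and> Q j}) = c + e" "0 \<le> e" "e \<le> 1" by (cases "Q (N - 1)") auto
  define M where "M = real N - 1"
  have M: "M > 0" "real (N - 1) = M" "real N = M + 1" using N by (auto simp: M_def of_nat_diff)
  have cM: "real c \<le> M" using c M(2) by simp
  have "real c / M - (c + e) / (M + 1) = (real c / M - e) / (M + 1)"
    using M(1) by (simp add: field_simps)
  moreover have "\<bar>real c / M - e\<bar> \<le> 1"
  proof -
    have "0 \<le> real c / M" "real c / M \<le> 1" using cM M(1) by auto
    then show ?thesis using e by linarith
  qed
  ultimately have "\<bar>real c / M - (c + e) / (M + 1)\<bar> \<le> 1 / (M + 1)"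
    using M(1) by (simp add: abs_divide divide_right_mono)
  then show ?thesis unfolding c_def[symmetric] e(1) M(2) unfolding M(3) .
qed

text \<open>Positivity of the degree comes from the derivative being larger than \<open>1\<close>. By periodicity, the derivative
  attains its infimum and the second derivative is bounded.\<close>

lemma expanding_circle_of_smooth:
  assumes r: "r \<ge> 2" and C: "C_circle r f" and ex: "expanding f"
  obtains F F' K \<kappa> \<Lambda> where "expanding_circle F F' K \<kappa> \<Lambda> f"
proof -
  obtain F where F: "is_lift F f" and CF: "C_real r F" using C by (auto simp: C_circle_def)
  define F' where "F' = deriv F"
  define F2 where "F2 = deriv F'"
  have diff: "(deriv ^^ i) F differentiable (at x)" if "i < r" for i x using CF that by (simp add: C_real_def)
  have DF: "(F has_real_derivative F' x) (at x)" for x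
    using diff[of 0 x] r unfolding F'_def by (auto simp: DERIV_deriv_iff_real_differentiable)
  have DF2: "(F' has_real_derivative F2 x) (at x)" for x
    using diff[of 1 x] r unfolding F2_def F'_def by (auto simp: DERIV_deriv_iff_real_differentiable)
  have cF2: "continuous_on UNIV F2"
  proof -
    have e: "(deriv ^^ 2) F = F2" by (simp add: numeral_2_eq_2 F2_def F'_def)
    show ?thesis
    proof (cases "r = 2")
      case True
      then show ?thesis using CF e by (simp add: C_real_def)
    next
      case False
      then have "F2 differentiable (at x)" for x using diff[of 2 x] r e by simp
      then show ?thesis by (auto intro!: continuous_at_imp_continuous_on differentiable_imp_continuous_within)
    qed
  qed
  have F'1: "F' x > 1" for x using ex circle_deriv_eq[OF F DF[of x]] unfolding expanding_def by metis
  have per: "F (x + 1) = F x + of_int (circle_degree f)" for x by (rule lift_degree[OF F])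
  have "F 1 - F 0 > 0"
  proof -
    obtain z where "F 1 - F 0 = (1 - 0) * F' z" using MVT2[of 0 1 F F'] DF by auto
    then show ?thesis using F'1[of z] by simp
  qed
  then have "circle_degree f > 0" using per[of 0] by simp
  define K where "K = nat (circle_degree f)"
  have perK: "F (x + 1) = F x + real K" for x using per \<open>circle_degree f > 0\<close> by (simp add: K_def)
  have p1: "F' (x + 1) = F' x" for x by (rule deriv_periodic[OF DF per])
  have p2: "F2 (x + 1) = F2 x" for x by (rule deriv_periodic[OF DF2, of 0]) (simp add: p1)
  have cF': "continuous_on UNIV F'" using DF2 by (auto intro!: continuous_at_imp_continuous_on DERIV_isCont)
  obtain x0 where x0: "\<And>x. F' x0 \<le> F' x" using periodic_attains_inf[OF cF' p1] by blast
  have "continuous_on UNIV (\<lambda>x. - \<bar>F2 x\<bar>)" by (intro continuous_intros cF2)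
  then obtain x1 where x1: "\<And>x. - \<bar>F2 x1\<bar> \<le> - \<bar>F2 x\<bar>" using periodic_attains_inf[of "\<lambda>x. - \<bar>F2 x\<bar>"] p2 by auto
  have lip: "\<bar>ln (F' x) - ln (F' y)\<bar> \<le> \<bar>F2 x1\<bar> * \<bar>x - y\<bar>" for x y
  proof -
    have "norm (ln (F' x) - ln (F' y)) \<le> \<bar>F2 x1\<bar> * norm (x - y)"
    proof (rule field_differentiable_bound[of UNIV])
      fix z :: real
      show "((\<lambda>x. ln (F' x)) has_field_derivative F2 z / F' z) (at z within UNIV)"
        using DF2[of z] F'1[of z] by (auto intro!: derivative_eq_intros)
      have "\<bar>F2 z\<bar> / F' z \<le> \<bar>F2 x1\<bar> / 1" using x1[of z] F'1[of z] by (intro frac_le) auto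
      then show "norm (F2 z / F' z) \<le> \<bar>F2 x1\<bar>" using F'1[of z] by simp
    qed auto
    then show ?thesis by simp
  qed
  have "expanding_circle F F' K (F' x0) \<bar>F2 x1\<bar> f"
    by unfold_locales (use DF perK F'1 x0 lip F in auto)
  then show thesis by (rule that)
qed

section \<open>The central limit theorem for periodic Lyapunov exponents\<close>

theorem mainTheorem1:
  fixes r :: nat and f :: "circle \<Rightarrow> circle" and \<mu> :: "circle measure"
  assumes "r \<ge> 2"
    and "C_circle r f"
    and "expanding f"
    and "\<not> smoothly_conjugate f (linear_map (circle_degree f))"
    and "max_entropy_measure f \<mu>"
  shows "\<exists>\<sigma>>0. \<exists>C>0. \<forall>n\<ge>1. \<forall>a b :: ereal. a \<noteq> -\<infinity> \<and> b \<noteq> -\<infinity> \<and> a < b \<longrightarrow>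
    \<bar>\<P>(p in uniform_count_measure (Fix (f ^^ n)).
          ereal ((periodic_exponent f n p - lyapunov_exponent f \<mu>) * sqrt (real n) / \<sigma>) \<in> {a..b})
      - 1 / sqrt (2 * pi) * (LBINT x=a..b. exp (- (x\<^sup>2) / 2))\<bar>
    \<le> C / root 4 (real n)"
proof -
  obtain F F' K \<kappa> \<Lambda> where "expanding_circle F F' K \<kappa> \<Lambda> f"
    using expanding_circle_of_smooth[OF assms(1-3)] by blast
  then interpret expanding_circle F F' K \<kappa> \<Lambda> f .
  define ave where "ave = mean \<phi>"
  have L: "lyapunov_exponent f \<mu> = ave" unfolding ave_def by (rule lyapunov_eq_mean[OF assms(5)])
  from hoelder_\<phi> show ?thesis
  proof (cases rule: periodic_char)
    case (coboundary B g)
    then have "smoothly_conjugate f (linear_map (int K))" by (intro coboundary_imp_conjugate)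
    then show ?thesis using assms(4) by (simp add: degree_eq)
  next
    case (clt \<sigma> C)
    obtain C1 :: real where C1: "C1 > 0"
      "\<And>(A :: nat set) X D x. finite A \<Longrightarrow> A \<noteq> {} \<Longrightarrow> D > 0 \<Longrightarrow>
        (\<And>t. cmod ((\<Sum>p\<in>A. iexp (t * X p)) / card A - exp (- t\<^sup>2 / 2)) \<le> D * \<bar>t\<bar>) \<Longrightarrow>
        \<bar>real (card {p\<in>A. X p \<le> x}) / card A - Phi x\<bar> \<le> C1 * sqrt D"
      using kolmogorov_distance_of_char by blast
    define C2 where "C2 = 2 * (C1 * sqrt (C / \<sigma>)) + 1"
    have C2: "C2 > 0" unfolding C2_def using C1(1) clt by (intro add_nonneg_pos) auto
    show ?thesis
    proof (rule exI[of _ \<sigma>], intro conjI exI[of _ C2] allI impI)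
      fix n :: nat and a b :: ereal
      assume n: "1 \<le> n" and ab: "a \<noteq> -\<infinity> \<and> b \<noteq> -\<infinity> \<and> a < b"
      then obtain a' where a': "a = ereal a'" by (cases a) auto
      define N where "N = K ^ n"
      \<comment> \<open>the error \<open>1 / N\<close> from the point counted twice is at most \<open>1 / root 4 n\<close>\<close>
      have "(2 :: nat) ^ n \<le> K ^ n" using K2 by (intro power_mono) auto
      then have Nn: "n < N" unfolding N_def using less_exp[of n] by linarith
      have "(2 :: nat) ^ 1 \<le> 2 ^ n" using n by (intro power_increasing) auto
      with \<open>2 ^ n \<le> K ^ n\<close> have N2: "N \<ge> 2" unfolding N_def by simp
      have rN: "real K ^ n = real N" by (simp add: N_def)
      define x where "x j = real j / (real N - 1)" for j
      define X where "X j = (birkhoff \<phi> n (x j) - real n * ave) / (\<sigma> * sqrt n)" for j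
      have sn: "\<sigma> * sqrt n > 0" using n clt by simp
      have "cmod ((\<Sum>j<N. iexp (t * X j)) / of_nat N - exp (- t\<^sup>2 / 2)) \<le> C / (\<sigma> * sqrt n) * \<bar>t\<bar>" for t
      proof -
        define s where "s = t / (\<sigma> * sqrt n)"
        have e1: "t * X j = s * (birkhoff \<phi> n (x j) - real n * ave)" for j by (simp add: X_def s_def)
        have "real n * (s * \<sigma>)\<^sup>2 = t\<^sup>2"
          using n clt by (simp add: s_def power_divide power_mult_distrib)
        then have e2: "- real n * (s * \<sigma>)\<^sup>2 / 2 = - t\<^sup>2 / 2" by simp
        have "cmod ((\<Sum>j<N. iexp (s * (birkhoff \<phi> n (x j) - real n * ave))) / of_nat N - exp (- real n * (s * \<sigma>)\<^sup>2 / 2)) \<le> C * \<bar>s\<bar>"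
          using clt(3)[OF n, of s] unfolding rN x_def ave_def N_def[symmetric] .
        also have "C * \<bar>s\<bar> = C / (\<sigma> * sqrt n) * \<bar>t\<bar>" using sn by (simp add: s_def abs_divide)
        finally show ?thesis unfolding e1 e2 .
      qed
      then have cdf: "\<bar>real (card {j\<in>{..<N}. X j \<le> y}) / card {..<N} - Phi y\<bar> \<le> C1 * sqrt (C / (\<sigma> * sqrt n))" for y
        using N2 clt sn by (intro C1(2)) (auto simp: lessThan_empty_iff)
      let ?I = "1 / sqrt (2 * pi) * (LBINT x=a..b. exp (- (x\<^sup>2) / 2))"
      let ?Q = "\<lambda>j. ereal (X j) \<in> {a..b}"
      have ne: "{..<N} \<noteq> {}" using N2 by (simp add: lessThan_empty_iff)
      have 1: "\<bar>real (card {j. j < N \<and> ?Q j}) / real N - ?I\<bar> \<le> 2 * (C1 * sqrt (C / (\<sigma> * sqrt n)))"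
        using interval_of_cdf_bound[OF finite_lessThan ne cdf, of a' b] ab unfolding a' by simp
      have 2: "\<bar>real (card {j. j < N - 1 \<and> ?Q j}) / real (N - 1) - real (card {j. j < N \<and> ?Q j}) / real N\<bar> \<le> 1 / real N"
        by (rule drop_last_ratio[OF N2])
      have P: "\<P>(p in uniform_count_measure (Fix (f ^^ n)).
          ereal ((periodic_exponent f n p - lyapunov_exponent f \<mu>) * sqrt (real n) / \<sigma>) \<in> {a..b})
        = real (card {j. j < N - 1 \<and> ?Q j}) / real (N - 1)"
      proof -
        let ?q = "\<lambda>p. ereal ((periodic_exponent f n p - lyapunov_exponent f \<mu>) * sqrt (real n) / \<sigma>) \<in> {a..b}"
        have Fx: "Fix (f ^^ n) = (\<lambda>j. point (x j)) ` {..<N - 1}" and inj: "inj_on (\<lambda>j. point (x j)) {..<N - 1}"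
          using Fix_iter[OF n] unfolding rN x_def N_def[symmetric] by auto
        have X: "(periodic_exponent f n (point (x j)) - lyapunov_exponent f \<mu>) * sqrt (real n) / \<sigma> = X j" for j
        proof -
          define q where "q = sqrt (real n)"
          have q: "q > 0" "real n = q * q" using n by (auto simp: q_def)
          show ?thesis unfolding periodic_exponent_point L X_def q_def[symmetric] unfolding q(2)
            using q(1) clt(1) by (simp add: field_simps)
        qed
        have set: "{p \<in> Fix (f ^^ n). ?q p} = (\<lambda>j. point (x j)) ` {j. j < N - 1 \<and> ?Q j}"
          unfolding Fx by (auto simp: X)
        have c1: "card {p \<in> Fix (f ^^ n). ?q p} = card {j. j < N - 1 \<and> ?Q j}"
          unfolding set by (rule card_image[OF inj_on_subset[OF inj]]) auto
        have c2: "card (Fix (f ^^ n)) = N - 1" unfolding Fx card_image[OF inj] by simp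
        have fin: "finite (Fix (f ^^ n))" unfolding Fx by simp
        have "measure (uniform_count_measure (Fix (f ^^ n))) {p \<in> Fix (f ^^ n). ?q p}
          = real (card {p \<in> Fix (f ^^ n). ?q p}) / real (card (Fix (f ^^ n)))"
          by (rule measure_uniform_count_measure[OF fin]) auto
        then show ?thesis unfolding c1 c2 by (simp add: space_uniform_count_measure)
      qed
      have r4: "root 4 (real n) > 0" using n by simp
      have "1 / real N \<le> 1 / root 4 (real n)"
      proof -
        have "root 4 (real n) \<le> root 1 (real n)" using n by (intro real_root_decreasing) auto
        also have "\<dots> \<le> real N" using Nn by simp
        finally show ?thesis using r4 by (intro frac_le) auto
      qed
      moreover have "sqrt (C / (\<sigma> * sqrt n)) = sqrt (C / \<sigma>) / root 4 (real n)"
      proof -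
        have "root 4 (real n) = sqrt (sqrt (real n))" using real_root_mult_exp[of 2 2 "real n"] by (simp add: sqrt_def)
        then show ?thesis by (simp add: real_sqrt_divide real_sqrt_mult)
      qed
      moreover have gen: "\<bar>q - i\<bar> \<le> u \<Longrightarrow> \<bar>p - q\<bar> \<le> v \<Longrightarrow> u + v \<le> w \<Longrightarrow> \<bar>p - i\<bar> \<le> w"
        for p q i u v w :: real by linarith
      ultimately have "2 * (C1 * sqrt (C / (\<sigma> * sqrt n))) + 1 / real N \<le> C2 / root 4 (real n)"
        unfolding C2_def by (simp add: add_divide_distrib)
      then show "\<bar>\<P>(p in uniform_count_measure (Fix (f ^^ n)).
          ereal ((periodic_exponent f n p - lyapunov_exponent f \<mu>) * sqrt (real n) / \<sigma>) \<in> {a..b}) - ?I\<bar> \<le> C2 / root 4 (real n)"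
        unfolding P by (rule gen[OF 1 2])
    qed (use clt C2 in auto)
  qed
qed

end
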